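(* Let $E$ be a complex Banach space, $U\subset E$ a non-empty balanced open subset, and $w$ a radial weight on $U$ such that $\mathcal{P}(E)\subset\mathcal{H}_w(U)$. Then the following assertions are equivalent: (a) $E$ has the compact approximation property. (b) $\overline{\mathcal{H}_w^c(U,F)}^{\tau_{\mathcal{M}}}=\mathcal{H}_w(U,F)$ for every Banach space $F$. (c) $\mathcal{H}_w(U,F)\subset\overline{\mathcal{H}_w^c(U,F)}^{\tau_c}$ for every Banach space $F$.
   Context: All Banach spaces are complex. $\mathcal{P}(E)$ is the space of continuous scalar-valued polynomials on $E$ (finite sums of continuous homogeneous polynomials, constants included); the inclusion $\mathcal{P}(E)\subset\mathcal{H}_w(U)$ refers to restrictions to $U$. $\mathcal{H}(U,F)$ is the space of holomorphic maps $U\to F$, and $\tau_c$ is the topology on it of uniform convergence on compact subsets of $U$ (closures for $\tau_c$ are taken in $\mathcal{H}(U,F)$). A set $A\subset U$ is $U$-bounded if it is bounded and there is a neighborhood $V$ of $0$ with $A+V\subset U$. A weight $w$ on $U$ is a continuous strictly positive function on $U$ with $0<\inf_A w\le\sup_A w<\infty$ for every $U$-bounded set $A$. A weight on a balanced open set $U$ is radial if $w(tx)=w(x)$ for all $x\in U$ and $t\in\mathbb{C}$ with $|t|=1$. $\mathcal{H}_w(U,F)=\{f\in\mathcal{H}(U,F):\|f\|_w=\sup_{x\in U}w(x)\|f(x)\|<\infty\}$; $\mathcal{H}_w(U)=\mathcal{H}_w(U,\mathbb{C})$. $\mathcal{H}_w^c(U,F)$ is the set of $f\in\mathcal{H}_w(U,F)$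 such that $wf:x\mapsto w(x)f(x)$ has relatively compact range in $F$. $\tau_{\mathcal{M}}$ is the locally convex topology on $\mathcal{H}_w(U,F)$ generated by the seminorms $p_{\bar\alpha,\bar A}(f)=\sup_{j\in\mathbb{N}}\big(\alpha_j\inf_{x\in A_j}w(x)\sup_{y\in A_j}\|f(y)\|\big)$, where $\bar\alpha=(\alpha_j)$ ranges over the null sequences of non-negative reals ($c_0^+$) and $\bar A=(A_j)$ over sequences of non-empty finite subsets of $U$. $E$ has the compact approximation property (CAP) if for every compact $K\subset E$ and $\epsilon>0$ there is a compact linear operator $T:E\to E$ with $\sup_{x\in K}\|T(x)-x\|<\epsilon$. *)

theory Defs
  imports "HOL-Analysis.Analysis"
begin

section \<open>Complex Banach spaces\<close>

class complex_banach = banach +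
  fixes scaleC :: "complex \<Rightarrow> 'a \<Rightarrow> 'a"
  assumes scaleC_add_right: "scaleC a (x + y) = scaleC a x + scaleC a y"
    and scaleC_add_left: "scaleC (a + b) x = scaleC a x + scaleC b x"
    and scaleC_scaleC: "scaleC a (scaleC b x) = scaleC (a * b) x"
    and scaleR_scaleC: "scaleR r x = scaleC (complex_of_real r) x"
    and norm_scaleC: "norm (scaleC a x) = cmod a * norm x"

instantiation complex :: complex_banach
begin

definition scaleC_complex :: "complex \<Rightarrow> complex \<Rightarrow> complex" where
  "scaleC_complex a x = a * x"

instance
  by standard (simp_all add: scaleC_complex_def algebra_simps scaleR_conv_of_real norm_mult)

end

instantiation prod :: (complex_banach, complex_banach) complex_banach
begin

definition scaleC_prod :: "complex \<Rightarrow> 'a \<times> 'b \<Rightarrow> 'a \<times> 'b" where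
  "scaleC_prod a x = (scaleC a (fst x), scaleC a (snd x))"

instance
proof
  fix a b :: complex and r :: real and x y :: "'a \<times> 'b"
  show "scaleC a (x + y) = scaleC a x + scaleC a y"
    by (simp add: scaleC_prod_def scaleC_add_right)
  show "scaleC (a + b) x = scaleC a x + scaleC b x"
    by (simp add: scaleC_prod_def scaleC_add_left)
  show "scaleC a (scaleC b x) = scaleC (a * b) x"
    by (simp add: scaleC_prod_def scaleC_scaleC)
  show "scaleR r x = scaleC (complex_of_real r) x"
    by (simp add: scaleC_prod_def scaleR_prod_def scaleR_scaleC)
  have "norm (scaleC a x) = sqrt ((cmod a)\<^sup>2 * ((norm (fst x))\<^sup>2 + (norm (snd x))\<^sup>2))"
    by (simp add: scaleC_prod_def norm_Pair norm_scaleC power_mult_distrib algebra_simps)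
  then show "norm (scaleC a x) = cmod a * norm x"
    by (simp add: real_sqrt_mult norm_prod_def)
qed

end

global_interpretation complex_vs: vector_space "scaleC :: complex \<Rightarrow> 'a \<Rightarrow> 'a::complex_banach"
proof
  fix x :: 'a
  show "scaleC 1 x = x"
    using scaleR_scaleC[of 1 x] by simp
qed (simp_all add: scaleC_add_right scaleC_add_left scaleC_scaleC)

abbreviation clinear :: "('a::complex_banach \<Rightarrow> 'b::complex_banach) \<Rightarrow> bool" where
  "clinear \<equiv> Vector_Spaces.linear scaleC scaleC"

text \<open>
  HOL cannot quantify over types inside a formula.  The Banach spaces \<open>F\<close> over which a formula
  quantifies are therefore the closed complex subspaces of an ambient Banach space type, with
  the induced norm.  If the ambient type is \<open>'e \<times> 'f\<close> with an arbitrary type \<open>'f\<close>, then up to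
  isometric isomorphism they include every space \<open>'f\<close> (as \<open>{0} \<times> UNIV\<close>) and the space \<open>'e\<close>
  (as \<open>UNIV \<times> {0}\<close>).
\<close>

definition banach_subspace :: "'b::complex_banach set \<Rightarrow> bool" where
  "banach_subspace F \<longleftrightarrow> complex_vs.subspace F \<and> closed F"

definition compact_operator :: "('a::complex_banach \<Rightarrow> 'b::complex_banach) \<Rightarrow> bool" where
  "compact_operator T \<longleftrightarrow> clinear T \<and> (\<forall>S. bounded S \<longrightarrow> compact (closure (T ` S)))"

definition compact_approximation_property :: "'e::complex_banach itself \<Rightarrow> bool" where
  "compact_approximation_property _ \<longleftrightarrow>
     (\<forall>K :: 'e set. \<forall>\<epsilon> > 0. compact K \<longrightarrow>
        (\<exists>T :: 'e \<Rightarrow> 'e. compact_operator T \<and> (\<forall>x\<in>K. norm (T x - x) < \<epsilon>)))"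


section \<open>Polynomials\<close>

text \<open>
  An \<open>m\<close>-linear form on \<open>'e\<close> is encoded as a function of a sequence that depends only on the
  entries with index below \<open>m\<close>; its continuity for the product topology on sequences is then
  continuity on the \<open>m\<close>-fold product of \<open>'e\<close>.
\<close>

definition continuous_multilinear_form :: "nat \<Rightarrow> ((nat \<Rightarrow> 'e::complex_banach) \<Rightarrow> complex) \<Rightarrow> bool"
  where
  "continuous_multilinear_form m A \<longleftrightarrow>
     (\<forall>v v'. (\<forall>i<m. v i = v' i) \<longrightarrow> A v = A v') \<and>
     (\<forall>v. \<forall>i<m. clinear (\<lambda>x. A (v(i := x)))) \<and>
     continuous_on UNIV A"

definition homogeneous_polynomial :: "nat \<Rightarrow> ('e::complex_banach \<Rightarrow> complex) \<Rightarrow> bool" where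
  "homogeneous_polynomial m P \<longleftrightarrow>
     (\<exists>A. continuous_multilinear_form m A \<and> P = (\<lambda>x. A (\<lambda>_. x)))"

definition polynomials :: "('e::complex_banach \<Rightarrow> complex) set" where
  "polynomials = {\<lambda>x. \<Sum>m\<le>N. P m x | N P. \<forall>m\<le>N. homogeneous_polynomial m (P m)}"


section \<open>Weights and spaces of holomorphic maps\<close>

definition balanced :: "'e::complex_banach set \<Rightarrow> bool" where
  "balanced U \<longleftrightarrow> (\<forall>x\<in>U. \<forall>t. cmod t \<le> 1 \<longrightarrow> scaleC t x \<in> U)"

definition bounded_within :: "'e::complex_banach set \<Rightarrow> 'e set \<Rightarrow> bool" where
  "bounded_within U A \<longleftrightarrow> A \<subseteq> U \<and> bounded A \<and>
     (\<exists>V. open V \<and> 0 \<in> V \<and> (\<forall>a\<in>A. \<forall>v\<in>V. a + v \<in> U))"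

definition weight_on :: "'e::complex_banach set \<Rightarrow> ('e \<Rightarrow> real) \<Rightarrow> bool" where
  "weight_on U w \<longleftrightarrow> continuous_on U w \<and> (\<forall>x\<in>U. 0 < w x) \<and>
     (\<forall>A. bounded_within U A \<longrightarrow> (\<exists>m>0. \<exists>M. \<forall>x\<in>A. m \<le> w x \<and> w x \<le> M))"

definition radial_weight_on :: "'e::complex_banach set \<Rightarrow> ('e \<Rightarrow> real) \<Rightarrow> bool" where
  "radial_weight_on U w \<longleftrightarrow> weight_on U w \<and>
     (\<forall>x\<in>U. \<forall>t. cmod t = 1 \<longrightarrow> w (scaleC t x) = w x)"

text \<open>
  Maps on \<open>U\<close> are represented by total functions; no condition and no seminorm below depends on
  their values outside \<open>U\<close>.  As \<open>F\<close> is closed, the derivatives of an \<open>F\<close>-valued map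
  are again \<open>F\<close>-valued, and relative compactness in \<open>F\<close> is relative compactness in the ambient
  space.
\<close>

definition holomorphic_maps ::
    "'e::complex_banach set \<Rightarrow> 'b::complex_banach set \<Rightarrow> ('e \<Rightarrow> 'b) set" where
  "holomorphic_maps U F =
     {f. f ` U \<subseteq> F \<and> (\<forall>x\<in>U. \<exists>D. clinear D \<and> (f has_derivative D) (at x))}"

definition Hw ::
    "'e::complex_banach set \<Rightarrow> ('e \<Rightarrow> real) \<Rightarrow> 'b::complex_banach set \<Rightarrow> ('e \<Rightarrow> 'b) set" where
  "Hw U w F = {f \<in> holomorphic_maps U F. bdd_above ((\<lambda>x. w x * norm (f x)) ` U)}"

definition Hwc ::
    "'e::complex_banach set \<Rightarrow> ('e \<Rightarrow> real) \<Rightarrow> 'b::complex_banach set \<Rightarrow> ('e \<Rightarrow> 'b) set" where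
  "Hwc U w F = {f \<in> Hw U w F. compact (closure ((\<lambda>x. w x *\<^sub>R f x) ` U))}"


section \<open>Topologies\<close>

definition seminorm_topology ::
    "('e \<Rightarrow> 'b::real_normed_vector) set \<Rightarrow> (('e \<Rightarrow> 'b) \<Rightarrow> real) set \<Rightarrow> ('e \<Rightarrow> 'b) topology" where
  "seminorm_topology X \<P> = topology_generated_by
     {{g \<in> X. p (\<lambda>x. g x - f x) < \<epsilon>} | p f \<epsilon>. p \<in> \<P> \<and> f \<in> X \<and> 0 < \<epsilon>}"

definition tau_c ::
    "'e::complex_banach set \<Rightarrow> 'b::complex_banach set \<Rightarrow> ('e \<Rightarrow> 'b) topology" where
  "tau_c U F = seminorm_topology (holomorphic_maps U F)
     {\<lambda>f. SUP x\<in>K. norm (f x) | K. compact K \<and> K \<noteq> {} \<and> K \<subseteq> U}"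

definition seminorm_M ::
    "('e \<Rightarrow> real) \<Rightarrow> (nat \<Rightarrow> real) \<Rightarrow> (nat \<Rightarrow> 'e set) \<Rightarrow> ('e \<Rightarrow> 'b::real_normed_vector) \<Rightarrow> real" where
  "seminorm_M w \<alpha> A f = (SUP j. \<alpha> j * (INF x\<in>A j. w x) * (SUP y\<in>A j. norm (f y)))"

definition tau_M ::
    "'e::complex_banach set \<Rightarrow> ('e \<Rightarrow> real) \<Rightarrow> 'b::complex_banach set \<Rightarrow> ('e \<Rightarrow> 'b) topology" where
  "tau_M U w F = seminorm_topology (Hw U w F)
     {seminorm_M w \<alpha> A | \<alpha> A.
        (\<forall>j. 0 \<le> \<alpha> j) \<and> \<alpha> \<longlonglongrightarrow> 0 \<and> (\<forall>j. finite (A j) \<and> A j \<noteq> {} \<and> A j \<subseteq> U)}"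

end

theory Submission
  imports Defs "HOL-Complex_Analysis.Complex_Analysis"
begin

text \<open>
  (a) implies (b): as \<open>w\<close> is radial, the Fejer means of the Taylor series of \<open>f\<close> satisfy
  \<open>w(x) |S_n f(x)| \<le> sup w|f|\<close>, and they converge pointwise to \<open>f\<close>; since the \<open>\<alpha>_j\<close> tend to \<open>0\<close>, this
  is approximation in \<open>\<tau>_M\<close>.  The homogeneous Taylor terms \<open>P_k\<close> are then replaced by \<open>P_k \<circ> T\<close>
  with a compact operator \<open>T\<close>.  By homogeneity \<open>w(x) P_k(T x) = P_k(T(w(x)^{1/k} x))\<close>, and
  \<open>{w(x)^{1/k} x}\<close> is weakly bounded (all powers of functionals are in the weighted space), hence
  bounded, so that \<open>P_k \<circ> T\<close> has relatively compact weighted range.  For the same reason the points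
  \<open>(\<alpha>_j w(y))^{1/k} y\<close> with \<open>y \<in> A_j\<close> form a null sequence, and \<open>T\<close> has to be close to the identity
  only on a compact set.

  (b) implies (c): a compact set is enlarged step by step to compact sets \<open>L_i\<close>, of which finite nets
  \<open>A_i\<close> are chosen so fine that \<open>sup |h|\<close> over \<open>L_i\<close> is at most its maximum over \<open>A_i\<close> plus a quarter of
  \<open>sup |h|\<close> over \<open>L_{i+1}\<close>; iterating bounds \<open>|h|\<close> on \<open>L_0\<close> by a seminorm of \<open>\<tau>_M\<close>.

  (c) implies (a): if \<open>g\<close> approximates the identity uniformly on compact sets, so does its derivative
  \<open>g'(0)\<close> by the Cauchy formula, which also places the values of \<open>g'(0)\<close> on a small ball in the closed
  convex hull of a compact set.
\<close>

section \<open>The Hahn-Banach theorem and its consequences\<close>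

text \<open>Taylor polynomials cannot replace the Fejer means: the seminorms of \<open>tau_M\<close>
  see infinitely many points, so the approximants need one weighted bound valid for all degrees, and
  Taylor sections admit none (Landau), whereas a Fejer mean averages over a circle. The operator
  cannot be composed with \<open>f\<close> itself, because \<open>T x\<close> may leave
  \<open>U\<close> and \<open>w (T x)\<close> is unrelated to \<open>w x\<close>; the Taylor terms
  extend to the whole space, and their homogeneity lets the k-th root of a scalar weight pass into
  the argument. Degree 0 admits no root and rests on the boundedness of \<open>w\<close>. In (b)
  implies (c) the quarter has to beat a loss: since \<alpha> must tend to 0, the seminorm controls
  \<open>h\<close> on the i-th net up to a factor growing like 2^i, so a step up costs a factor 2
  and gains a factor 4. Function theory for vector values is reduced to scalar functions on complex
  lines by functionals of norm at most 1, with bounds independent of the functional.\<close>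

definition sublinear :: "('a::real_vector \<Rightarrow> real) \<Rightarrow> bool" where
  "sublinear p \<longleftrightarrow> (\<forall>x y. p (x + y) \<le> p x + p y) \<and> (\<forall>x. \<forall>t\<ge>0. p (t *\<^sub>R x) = t * p x)"

lemma sublinear_add: "sublinear p \<Longrightarrow> p (x + y) \<le> p x + p y"
  and sublinear_scaleR: "sublinear p \<Longrightarrow> 0 \<le> t \<Longrightarrow> p (t *\<^sub>R x) = t * p x"
  by (auto simp: sublinear_def)

lemma sublinear_zero: "sublinear p \<Longrightarrow> p 0 = 0"
  using sublinear_scaleR[of p 0 0] by simp

lemma sublinear_minus: "sublinear p \<Longrightarrow> - p (- x) \<le> p x"
  using sublinear_add[of p x "- x"] by (simp add: sublinear_zero)

text \<open>The largest sublinear minorant of \<open>p\<close> with value at most \<open>- p z\<close> at \<open>- z\<close>.\<close>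

definition sublinear_shift :: "('a::real_vector \<Rightarrow> real) \<Rightarrow> 'a \<Rightarrow> 'a \<Rightarrow> real" where
  "sublinear_shift p z x = (INF t\<in>{0..}. p (x + t *\<^sub>R z) - t * p z)"

lemma bdd_below_sublinear_shift:
  assumes "sublinear p"
  shows "bdd_below ((\<lambda>t. p (x + t *\<^sub>R z) - t * p z) ` {0..})"
proof (rule bdd_belowI2)
  fix t :: real assume "t \<in> {0..}"
  then show "- p (- x) \<le> p (x + t *\<^sub>R z) - t * p z"
    using sublinear_add[OF assms, of "x + t *\<^sub>R z" "- x"] sublinear_scaleR[OF assms, of t z]
    by simp
qed

lemma sublinear_shift_le:
  "sublinear p \<Longrightarrow> 0 \<le> t \<Longrightarrow> sublinear_shift p z x \<le> p (x + t *\<^sub>R z) - t * p z"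
  unfolding sublinear_shift_def by (rule cINF_lower[OF bdd_below_sublinear_shift]) auto

lemma sublinear_shift_greatest:
  "(\<And>t. 0 \<le> t \<Longrightarrow> b \<le> p (x + t *\<^sub>R z) - t * p z) \<Longrightarrow> b \<le> sublinear_shift p z x"
  unfolding sublinear_shift_def by (rule cINF_greatest) auto

lemma sublinear_sublinear_shift:
  assumes p: "sublinear p"
  shows "sublinear (sublinear_shift p z)"
  unfolding sublinear_def
proof (intro conjI allI impI)
  fix x y
  \<comment> \<open>Parameters \<open>t\<close> for \<open>x\<close> and \<open>s\<close> for
    \<open>y\<close> add up to the parameter \<open>s + t\<close> for \<open>x + y\<close>; the two
    infima are then taken one after the other.\<close>
  have "sublinear_shift p z (x + y) - (p (y + s *\<^sub>R z) - s * p z) \<le> p (x + t *\<^sub>R z) - t * p z"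
    if "0 \<le> s" "0 \<le> t" for s t
    using sublinear_shift_le[OF p, of "s + t" z "x + y"] that
      sublinear_add[OF p, of "x + t *\<^sub>R z" "y + s *\<^sub>R z"]
    by (simp add: algebra_simps)
  then have "sublinear_shift p z (x + y) - (p (y + s *\<^sub>R z) - s * p z) \<le> sublinear_shift p z x"
    if "0 \<le> s" for s
    using that by (blast intro: sublinear_shift_greatest)
  then have "sublinear_shift p z (x + y) - sublinear_shift p z x \<le> p (y + s *\<^sub>R z) - s * p z"
    if "0 \<le> s" for s
    using that by (simp add: algebra_simps)
  then have "sublinear_shift p z (x + y) - sublinear_shift p z x \<le> sublinear_shift p z y"
    by (blast intro: sublinear_shift_greatest)
  then show "sublinear_shift p z (x + y) \<le> sublinear_shift p z x + sublinear_shift p z y"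
    by simp
next
  \<comment> \<open>One inequality for positive factors suffices: applied to \<open>1 / r\<close>
    and \<open>r *\<^sub>R x\<close> it gives the reverse one.\<close>
  have le: "r * sublinear_shift p z x \<le> sublinear_shift p z (r *\<^sub>R x)" if "0 < r" for r x
  proof (rule sublinear_shift_greatest)
    fix t :: real assume t: "0 \<le> t"
    have "sublinear_shift p z x \<le> p (x + (t / r) *\<^sub>R z) - (t / r) * p z"
      using t that by (intro sublinear_shift_le[OF p]) simp
    then have "r * sublinear_shift p z x \<le> r * p (x + (t / r) *\<^sub>R z) - t * p z"
      using mult_left_mono[of _ _ r] that by (fastforce simp: algebra_simps)
    also have "r * p (x + (t / r) *\<^sub>R z) = p (r *\<^sub>R x + t *\<^sub>R z)"
      using sublinear_scaleR[OF p, of r "x + (t / r) *\<^sub>R z"] that by (simp add: algebra_simps)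
    finally show "r * sublinear_shift p z x \<le> p (r *\<^sub>R x + t *\<^sub>R z) - t * p z" .
  qed
  fix x :: 'a and r :: real assume "0 \<le> r"
  show "sublinear_shift p z (r *\<^sub>R x) = r * sublinear_shift p z x"
  proof (cases "r = 0")
    case True
    have "sublinear_shift p z 0 = 0"
      using sublinear_shift_le[OF p, of 0 z 0] sublinear_zero[OF p] sublinear_scaleR[OF p, of _ z]
      by (intro antisym sublinear_shift_greatest) auto
    with True show ?thesis by simp
  next
    case False
    with \<open>0 \<le> r\<close> have r: "0 < r" by simp
    have "sublinear_shift p z (r *\<^sub>R x) \<le> r * sublinear_shift p z x"
      using le[of "1 / r" "r *\<^sub>R x"] r by (simp add: field_simps)
    with le[OF r, of x] show ?thesis by simp
  qed
qed

text \<open>Every shift of \<open>q\<close> lies below \<open>q\<close>, so minimality makes it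
  equal to \<open>q\<close>; the parameter \<open>t = 1\<close> in the infimum then reads
  \<open>q x + q y \<le> q (x + y)\<close>, and additivity with positive homogeneity gives
  linearity.\<close>

lemma minimal_sublinear_is_linear:
  assumes q: "sublinear q" and min: "\<And>p. sublinear p \<Longrightarrow> p \<le> q \<Longrightarrow> p = q"
  shows "linear q"
proof -
  have "sublinear_shift q y = q" for y
    using sublinear_shift_le[OF q, of 0 y] by (intro min sublinear_sublinear_shift q le_funI) simp
  then have "q x \<le> q (x + y) - q y" for x y
    using sublinear_shift_le[OF q, of 1 y x] by simp
  with sublinear_add[OF q] have add: "q (x + y) = q x + q y" for x y
    by (simp add: antisym le_diff_eq)
  have neg: "q (- x) = - q x" for x
    using add[of x "- x"] sublinear_zero[OF q] by simp
  have "q (r *\<^sub>R x) = r * q x" for r x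
  proof (cases "0 \<le> r")
    case False
    then show ?thesis
      using sublinear_scaleR[OF q, of "- r" x] neg[of "r *\<^sub>R x"] by simp
  qed (simp add: sublinear_scaleR[OF q])
  with add show ?thesis
    by (auto intro: linearI)
qed

text \<open>Zorn's lemma, ordered downwards, on the sublinear functionals below \<open>p\<close>:
  the pointwise infimum of a nonempty chain is again sublinear, and a minimal element is
  linear.\<close>

lemma sublinear_dominates_linear:
  assumes p: "sublinear p"
  obtains q where "linear q" "\<And>x. q x \<le> p x"
proof -
  define A where "A = {q. sublinear q \<and> q \<le> p}"
  have "\<exists>m\<in>A. \<forall>a\<in>A. a \<le> m \<longrightarrow> a = m"
  proof (rule predicate_Zorn)
    show "partial_order_on A (relation_of (\<lambda>a b. b \<le> a) A)"
      by (rule partial_order_on_relation_ofI) auto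
    fix C assume "C \<in> Chains (relation_of (\<lambda>a b. b \<le> a) A)"
    then have CA: "C \<subseteq> A" and chain: "\<And>f g. f \<in> C \<Longrightarrow> g \<in> C \<Longrightarrow> f \<le> g \<or> g \<le> f"
      by (auto simp: Chains_def relation_of_def)
    show "\<exists>u\<in>A. \<forall>a\<in>C. u \<le> a"
    proof (cases "C = {}")
      case True
      with p show ?thesis by (auto simp: A_def)
    next
      case ne: False
      define u where "u x = (INF f\<in>C. f x)" for x
      have sub: "sublinear f" and fp: "f x \<le> p x" if "f \<in> C" for f x
        using that CA by (auto simp: A_def le_fun_def)
      have "- p (- x) \<le> f x" if "f \<in> C" for f x
        using sublinear_minus[OF sub[OF that], of x] fp[OF that, of "- x"] by simp
      then have bdd: "bdd_below ((\<lambda>f. f x) ` C)" for x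
        by (rule bdd_belowI2)
      have ule: "u x \<le> f x" if "f \<in> C" for f x
        unfolding u_def using that by (intro cINF_lower bdd)
      have ugr: "b \<le> u x" if "\<And>f. f \<in> C \<Longrightarrow> b \<le> f x" for b x
        unfolding u_def using that ne by (intro cINF_greatest)
      have "sublinear u"
        unfolding sublinear_def
      proof (intro conjI allI impI)
        fix x y
        \<comment> \<open>The infima at \<open>x\<close> and at \<open>y\<close> may be nearly
          attained at different members \<open>f\<close> and \<open>g\<close>; the chain property
          supplies one member below both.\<close>
        have "u (x + y) \<le> f x + g y" if "f \<in> C" "g \<in> C" for f g
        proof -
          from chain[OF that] that obtain h where "h \<in> C" "h \<le> f" "h \<le> g"
            by (metis order_refl)
          then show ?thesis
            using ule[of h "x + y"] sublinear_add[OF sub, of h x y] le_funD[of h f x] le_funD[of h g y]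
            by linarith
        qed
        then have "u (x + y) - f x \<le> g y" if "f \<in> C" "g \<in> C" for f g
          using that by (simp add: le_diff_eq diff_le_eq add.commute)
        then have "u (x + y) - f x \<le> u y" if "f \<in> C" for f
          using that by (intro ugr)
        then have "u (x + y) - u y \<le> u x"
          by (intro ugr) (simp add: algebra_simps)
        then show "u (x + y) \<le> u x + u y" by simp
      next
        have le: "r * u x \<le> u (r *\<^sub>R x)" if "0 < r" for r x
        proof (rule ugr)
          fix f assume f: "f \<in> C"
          show "r * u x \<le> f (r *\<^sub>R x)"
            using sublinear_scaleR[OF sub[OF f], of r x] ule[OF f, of x] that by simp
        qed
        fix x :: 'a and r :: real assume "0 \<le> r"
        show "u (r *\<^sub>R x) = r * u x"
        proof (cases "r = 0")
          case True
          from ne obtain f where "f \<in> C" by blast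
          then have "u 0 \<le> 0"
            using ule[of f 0] sublinear_zero[OF sub[of f]] by simp
          moreover have "0 \<le> f 0" if "f \<in> C" for f
            using sublinear_zero[OF sub[OF that]] by simp
          then have "0 \<le> u 0" by (rule ugr)
          ultimately have "u 0 = 0" by simp
          with True show ?thesis by simp
        next
          case False
          with \<open>0 \<le> r\<close> have r: "0 < r" by simp
          have "u (r *\<^sub>R x) \<le> r * u x"
            using le[of "1 / r" "r *\<^sub>R x"] r by (simp add: field_simps)
          with le[OF r, of x] show ?thesis by simp
        qed
      qed
      moreover from ne obtain f where "f \<in> C" by blast
      then have "u x \<le> p x" for x
        using order_trans[OF ule[of f x] fp[of f x]] by simp
      then have "u \<le> p" by (rule le_funI)
      ultimately show ?thesis
        using ule by (auto simp: A_def le_fun_def)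
    qed
  qed
  then obtain q where q: "q \<in> A" and min: "\<And>a. a \<in> A \<Longrightarrow> a \<le> q \<Longrightarrow> a = q"
    by blast
  have "linear q"
  proof (rule minimal_sublinear_is_linear)
    show "sublinear q" using q by (simp add: A_def)
    show "r = q" if "sublinear r" "r \<le> q" for r
      using that q order_trans[of r q p] by (intro min) (auto simp: A_def)
  qed
  moreover have "q x \<le> p x" for x
    using q by (simp add: A_def le_fun_def)
  ultimately show ?thesis by (rule that)
qed

text \<open>The required value is built into the dominating functional instead of being extended
  from a line: the shift of the norm at \<open>z\<close> is at most \<open>- norm z\<close> at
  \<open>- z\<close> (take \<open>t = 1\<close>), so a linear minorant satisfies
  \<open>q z \<ge> norm z\<close>.\<close>

theorem Hahn_Banach_norming:
  fixes z :: "'a::real_normed_vector"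
  obtains q where "linear q" "\<And>x. \<bar>q x\<bar> \<le> norm x" "q z = norm z"
proof -
  have n: "sublinear (norm :: 'a \<Rightarrow> real)"
    by (auto simp: sublinear_def norm_triangle_ineq)
  obtain q where q: "linear q" and le: "\<And>x. q x \<le> sublinear_shift norm z x"
    using sublinear_dominates_linear[OF sublinear_sublinear_shift[OF n]] by blast
  have qn: "q x \<le> norm x" for x
    using le[of x] sublinear_shift_le[OF n, of 0 z x] by simp
  have "- q z \<le> - norm z"
    using le[of "- z"] sublinear_shift_le[OF n, of 1 z "- z"] linear_neg[OF q, of z] by simp
  moreover have "\<bar>q x\<bar> \<le> norm x" for x
    using qn[of x] qn[of "- x"] linear_neg[OF q, of x] by simp
  ultimately show ?thesis
    using q qn[of z] by (intro that) auto
qed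

section \<open>Complex functionals and duality\<close>

lemma scaleC_i_i: "scaleC \<i> (scaleC \<i> x) = - (x :: 'a::complex_banach)"
  using complex_vs.scale_minus_left[of 1 x] by (simp add: complex_vs.scale_scale)

lemma scaleC_complex_of_real: "scaleC (complex_of_real r) x = r *\<^sub>R x"
  by (simp add: scaleR_scaleC)

lemma clinear_imp_linear:
  assumes "clinear f"
  shows "linear f"
proof -
  interpret f: Vector_Spaces.linear scaleC scaleC f by fact
  show ?thesis
    by (rule linearI) (simp_all add: f.add f.scale scaleR_scaleC)
qed

lemma clinear_iff:
  "clinear f \<longleftrightarrow> (\<forall>x y. f (x + y) = f x + f y) \<and> (\<forall>c x. f (scaleC c x) = scaleC c (f x))"
  by (simp add: Vector_Spaces.linear_iff complex_vs.vector_space_axioms)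

text \<open>A complex functional is determined by its real part: homogeneity with respect to the
  imaginary unit forces the imaginary part to be \<open>- q (scaleC \<i> x)\<close>.\<close>

lemma complexification_clinear:
  fixes q :: "'a::complex_banach \<Rightarrow> real"
  assumes "linear q"
  shows "clinear (\<lambda>x. Complex (q x) (- q (scaleC \<i> x)))"
proof -
  have re: "q (r *\<^sub>R x) = r * q x" for r x
    using linear_cmul[OF assms] by simp
  have split: "scaleC c x = Re c *\<^sub>R x + Im c *\<^sub>R scaleC \<i> x" for c and x :: 'a
  proof -
    have "scaleC c x = scaleC (complex_of_real (Re c) + complex_of_real (Im c) * \<i>) x"
      by (simp add: complex_eq mult.commute)
    then show ?thesis
      by (simp add: complex_vs.scale_left_distrib scaleC_complex_of_real flip: complex_vs.scale_scale)
  qed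
  define \<phi> where "\<phi> x = Complex (q x) (- q (scaleC \<i> x))" for x
  have "\<phi> (x + y) = \<phi> x + \<phi> y" for x y
    by (simp add: \<phi>_def scaleC_add_right linear_add[OF assms] complex_eq_iff)
  moreover have "\<phi> (scaleC c x) = scaleC c (\<phi> x)" for c x
  proof -
    have "q (scaleC c x) = Re c * q x + Im c * q (scaleC \<i> x)"
      by (subst split) (simp add: linear_add[OF assms] re)
    moreover have "scaleC \<i> (scaleC c x) = Re c *\<^sub>R scaleC \<i> x + Im c *\<^sub>R scaleC \<i> (scaleC \<i> x)"
      unfolding complex_vs.scale_left_commute[of \<i> c] by (rule split)
    then have "q (scaleC \<i> (scaleC c x)) = Re c * q (scaleC \<i> x) - Im c * q x"
      by (simp add: scaleC_i_i linear_diff[OF assms] re)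
    ultimately show ?thesis
      by (simp add: \<phi>_def scaleC_complex_def complex_eq_iff)
  qed
  ultimately show ?thesis
    unfolding clinear_iff \<phi>_def[abs_def, symmetric] by blast
qed

definition norm_le_one_functional :: "('a::complex_banach \<Rightarrow> complex) \<Rightarrow> bool" where
  "norm_le_one_functional \<phi> \<longleftrightarrow> clinear \<phi> \<and> (\<forall>x. cmod (\<phi> x) \<le> norm x)"

lemma functional_scaleC: "norm_le_one_functional \<phi> \<Longrightarrow> \<phi> (scaleC c x) = c * \<phi> x"
  and functional_le: "norm_le_one_functional \<phi> \<Longrightarrow> cmod (\<phi> x) \<le> norm x"
  by (auto simp: norm_le_one_functional_def clinear_iff scaleC_complex_def)

lemma functional_bounded_linear: "norm_le_one_functional \<phi> \<Longrightarrow> bounded_linear \<phi>"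
  unfolding norm_le_one_functional_def
  by (auto intro!: bounded_linear_intro[where K = 1] dest: clinear_imp_linear
      simp: linear_add linear_cmul)

lemma norming_functional:
  fixes z :: "'a::complex_banach"
  obtains \<phi> where "norm_le_one_functional \<phi>" "\<phi> z = norm z"
proof -
  obtain q where q: "linear q" "\<And>x. \<bar>q x\<bar> \<le> norm x" "q z = norm z"
    using Hahn_Banach_norming[of z] by blast
  define \<phi> where "\<phi> x = Complex (q x) (- q (scaleC \<i> x))" for x
  have cl: "clinear \<phi>"
    unfolding \<phi>_def by (rule complexification_clinear[OF q(1)])
  have le: "cmod (\<phi> x) \<le> norm x" for x
  proof (cases "\<phi> x = 0")
    case False
    \<comment> \<open>A unimodular factor that rotates \<open>\<phi> x\<close> to its modulus, which
      is then a value of the real functional \<open>q\<close>.\<close>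
    define u where "u = cnj (\<phi> x) / cmod (\<phi> x)"
    have "cmod u = 1" using False by (simp add: u_def norm_divide)
    have "\<phi> (scaleC u x) = u * \<phi> x"
      using cl by (simp add: clinear_iff scaleC_complex_def)
    also have "\<dots> = cmod (\<phi> x)"
      using False complex_norm_square[of "\<phi> x"] by (simp add: u_def field_simps power2_eq_square)
    finally have "cmod (\<phi> x) = q (scaleC u x)"
      by (simp add: \<phi>_def complex_eq_iff)
    also have "\<dots> \<le> norm x"
      using q(2)[of "scaleC u x"] \<open>cmod u = 1\<close> by (simp add: norm_scaleC)
    finally show ?thesis .
  qed simp
  \<comment> \<open>A number of modulus at most \<open>norm z\<close> with real part
    \<open>norm z\<close> has imaginary part 0.\<close>
  have "Re (\<phi> z) = norm z" by (simp add: \<phi>_def q(3))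
  then have "\<phi> z = norm z"
    using le[of z] cmod_power2[of "\<phi> z"]
    by (smt (verit, best) Re_complex_of_real complex_eq_iff Im_complex_of_real norm_ge_zero
        power_mono zero_eq_power2 zero_le_power2)
  then show ?thesis
    using cl le by (intro that[of \<phi>]) (auto simp: norm_le_one_functional_def)
qed

text \<open>The reduction by which the Cauchy and Fejer estimates for vector values become scalar
  ones, provided the bound does not depend on the functional.\<close>

lemma norm_le_if_functionals_le:
  fixes z :: "'a::complex_banach"
  assumes "\<And>\<phi>. norm_le_one_functional \<phi> \<Longrightarrow> cmod (\<phi> z) \<le> B"
  shows "norm z \<le> B"
proof -
  obtain \<phi> where \<phi>: "norm_le_one_functional \<phi>" "\<phi> z = norm z"
    by (rule norming_functional[of z])
  have "norm z = cmod (\<phi> z)" by (simp add: \<phi>(2))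
  then show ?thesis using assms[OF \<phi>(1)] by simp
qed

lemma eq_if_functionals_eq:
  fixes y z :: "'a::complex_banach"
  assumes "\<And>\<phi>. norm_le_one_functional \<phi> \<Longrightarrow> \<phi> y = \<phi> z"
  shows "y = z"
proof -
  have "norm (y - z) \<le> 0"
  proof (rule norm_le_if_functionals_le)
    fix \<phi> :: "'a \<Rightarrow> complex" assume \<phi>: "norm_le_one_functional \<phi>"
    show "cmod (\<phi> (y - z)) \<le> 0"
      using assms[OF \<phi>] linear_diff[OF bounded_linear.linear[OF functional_bounded_linear[OF \<phi>]], of y z] by simp
  qed
  then show ?thesis by simp
qed

text \<open>The uniform boundedness principle for \<open>Z\<close> regarded as a family of functions
  on the real dual: the closed sets \<open>C n\<close> cover that complete space, so by Baire one of
  them contains a ball, and a norming functional of \<open>z\<close>, scaled into the ball, converts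
  this into a bound of \<open>norm z\<close>.\<close>

lemma weakly_bounded_imp_bounded:
  fixes Z :: "'a::complex_banach set"
  assumes weak: "\<And>\<phi>. clinear \<phi> \<Longrightarrow> bounded_linear \<phi> \<Longrightarrow> \<exists>B. \<forall>z\<in>Z. cmod (\<phi> z) \<le> B"
  shows "bounded Z"
proof -
  define C where "C n = {\<psi> :: 'a \<Rightarrow>\<^sub>L real. \<forall>z\<in>Z. \<bar>blinfun_apply \<psi> z\<bar> \<le> real n}" for n
  have closed: "closed (C n)" for n
  proof -
    have "closed {\<psi> :: 'a \<Rightarrow>\<^sub>L real. \<bar>blinfun_apply \<psi> z\<bar> \<le> real n}" for z
      by (intro closed_Collect_le continuous_intros)
    moreover have "C n = (\<Inter>z\<in>Z. {\<psi>. \<bar>blinfun_apply \<psi> z\<bar> \<le> real n})"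
      by (auto simp: C_def)
    ultimately show ?thesis by auto
  qed
  have cover: "\<psi> \<in> (\<Union>n. C n)" for \<psi>
  proof -
    \<comment> \<open>The hypothesis speaks of complex functionals, so a real one is first completed
      to a complex one; the crude bound \<open>2 * norm \<psi>\<close> shows that this stays
      continuous.\<close>
    have "linear (blinfun_apply \<psi>)"
      using blinfun.bounded_linear_right bounded_linear.linear by blast
    then have cl: "clinear (\<lambda>x. Complex (\<psi> x) (- \<psi> (scaleC \<i> x)))"
      by (rule complexification_clinear)
    have "cmod (Complex (\<psi> x) (- \<psi> (scaleC \<i> x))) \<le> norm x * (2 * norm \<psi>)" for x
    proof -
      have "cmod (Complex (\<psi> x) (- \<psi> (scaleC \<i> x))) \<le> \<bar>\<psi> x\<bar> + \<bar>\<psi> (scaleC \<i> x)\<bar>"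
        using cmod_le[of "Complex (\<psi> x) (- \<psi> (scaleC \<i> x))"] by simp
      also have "\<dots> \<le> norm x * (2 * norm \<psi>)"
        using norm_blinfun[of \<psi> x] norm_blinfun[of \<psi> "scaleC \<i> x"]
          by (simp add: norm_scaleC mult.commute)
      finally show ?thesis .
    qed
    then have "bounded_linear (\<lambda>x. Complex (\<psi> x) (- \<psi> (scaleC \<i> x)))"
      using linear_add[OF clinear_imp_linear[OF cl]] linear_cmul[OF clinear_imp_linear[OF cl]]
      by (intro bounded_linear_intro)
    from weak[OF cl this] obtain B where B: "\<And>z. z \<in> Z \<Longrightarrow> cmod (Complex (\<psi> z) (- \<psi> (scaleC \<i> z))) \<le> B"
      by blast
    obtain n where "B \<le> real n" using real_arch_simple by blast
    then have "\<bar>\<psi> z\<bar> \<le> real n" if "z \<in> Z" for z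
      using B[OF that] abs_Re_le_cmod[of "Complex (\<psi> z) (- \<psi> (scaleC \<i> z))"] by simp
    then show ?thesis by (auto simp: C_def)
  qed
  have "\<exists>n. interior (C n) \<noteq> {}"
  proof (rule ccontr)
    assume "\<nexists>n. interior (C n) \<noteq> {}"
    then have "euclidean interior_of \<Union>(range C) = {}"
      using closed by (intro Baire_category_alt) (auto simp: completely_metrizable_space_euclidean)
    moreover have "\<Union>(range C) = UNIV" using cover by blast
    ultimately show False by simp
  qed
  then obtain n \<psi>\<^sub>0 r where r: "0 < r" "cball \<psi>\<^sub>0 r \<subseteq> C n"
    using mem_interior_cball by blast
  have "norm z \<le> 2 * real n / r" if z: "z \<in> Z" for z
  proof -
    obtain q where q: "linear q" "\<And>x. \<bar>q x\<bar> \<le> norm x" "q z = norm z"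
      using Hahn_Banach_norming[of z] by blast
    then have bq: "bounded_linear q"
      by (intro bounded_linear_intro[where K = 1]) (auto simp: linear_add linear_cmul)
    define \<psi> where "\<psi> = Blinfun q"
    have ap: "blinfun_apply \<psi> = q" by (simp add: \<psi>_def bounded_linear_Blinfun_apply bq)
    have "norm \<psi> \<le> 1" using q(2) by (intro norm_blinfun_bound) (auto simp: ap)
    \<comment> \<open>Both the centre and the shifted point lie in \<open>C n\<close>, so their
      difference \<open>r *\<^sub>R \<psi>\<close> is bounded by \<open>2 * real n\<close> at
      \<open>z\<close>.\<close>
    then have "\<psi>\<^sub>0 + r *\<^sub>R \<psi> \<in> cball \<psi>\<^sub>0 r" "\<psi>\<^sub>0 \<in> cball \<psi>\<^sub>0 r"
      using r(1) by (auto simp: dist_norm)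
    then have "\<psi>\<^sub>0 + r *\<^sub>R \<psi> \<in> C n" "\<psi>\<^sub>0 \<in> C n"
      using r(2) by blast+
    with z have "\<bar>blinfun_apply (\<psi>\<^sub>0 + r *\<^sub>R \<psi>) z\<bar> \<le> real n" "\<bar>blinfun_apply \<psi>\<^sub>0 z\<bar> \<le> real n"
      by (auto simp: C_def)
    then have "r * norm z \<le> 2 * real n"
      by (simp add: blinfun.add_left blinfun.scaleR_left ap q(3))
    then show ?thesis using r(1) by (simp add: field_simps)
  qed
  then show ?thesis by (auto simp: bounded_iff)
qed

section \<open>Closed convex hulls\<close>

text \<open>The interval has length 1, so the Riemann sum of a tagged division is a convex
  combination of values of \<open>h\<close>; the integral is a limit of such sums.\<close>

lemma integral_in_closed_convex:
  fixes h :: "real \<Rightarrow> 'a::banach"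
  assumes h: "h integrable_on {0..1}" and C: "convex C" "closed C"
    and hC: "\<And>t. t \<in> {0..1} \<Longrightarrow> h t \<in> C"
  shows "integral {0..1} h \<in> C"
proof -
  have "\<exists>y\<in>C. dist y (integral {0..1} h) < e" if "0 < e" for e
  proof -
    have hi: "(h has_integral integral {0..1} h) (cbox 0 1)"
      using h by (simp add: integrable_integral)
    obtain \<gamma> where \<gamma>: "gauge \<gamma>"
      "\<And>p. p tagged_division_of cbox 0 1 \<Longrightarrow> \<gamma> fine p \<Longrightarrow>
         norm ((\<Sum>(x,k)\<in>p. measure lborel k *\<^sub>R h x) - integral {0..1} h) < e"
      by (rule has_integralD[OF hi \<open>0 < e\<close>]) (rule that)
    obtain p where p: "p tagged_division_of cbox 0 1" "\<gamma> fine p"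
      using fine_division_exists[OF \<gamma>(1)] by blast
    have "(\<Sum>(x,k)\<in>p. measure lborel k *\<^sub>R h x) \<in> C"
      unfolding case_prod_unfold
    proof (rule convex_sum)
      show "finite p" using p(1) by (rule tagged_division_of_finite)
      have "(\<Sum>(x,k)\<in>p. measure lborel k) = measure lborel (cbox (0::real) 1)"
        using additive_content_tagged_division[OF p(1)] .
      then show "(\<Sum>i\<in>p. measure lborel (snd i)) = 1"
        by (simp add: case_prod_unfold)
      show "h (fst i) \<in> C" if "i \<in> p" for i
        using tag_in_interval[OF p(1), of "fst i" "snd i"] that by (intro hC) simp
    qed (use C in auto)
    with \<gamma>(2)[OF p] show ?thesis by (auto simp: dist_norm)
  qed
  then have "integral {0..1} h \<in> closure C" by (simp add: closure_approachable)
  with C(2) show ?thesis by simp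
qed

text \<open>Mazur's theorem. A finite \<open>e/4\<close>-net \<open>k\<close> of \<open>S\<close>
  puts the convex hull of \<open>S\<close> within \<open>e/4\<close> of the convex hull of
  \<open>k\<close>, which is compact and has a finite \<open>e/4\<close>-net \<open>l\<close>;
  passing to the closure costs one more \<open>e/4\<close>.\<close>

theorem compact_closed_convex_hull:
  fixes S :: "'a::banach set"
  assumes "compact S"
  shows "compact (closure (convex hull S))"
  unfolding compact_eq_totally_bounded
proof (intro conjI allI impI)
  show "complete (closure (convex hull S))"
    by (simp add: complete_eq_closed)
  fix e :: real assume e: "0 < e"
  obtain k where k: "finite k" "S \<subseteq> (\<Union>x\<in>k. ball x (e/4))"
    using assms e unfolding compact_eq_totally_bounded by (meson divide_pos_pos zero_less_numeral)
  have "compact (convex hull k)" using k(1) by (rule finite_imp_compact_convex_hull)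
  then obtain l where l: "finite l" "convex hull k \<subseteq> (\<Union>x\<in>l. ball x (e/4))"
    using e unfolding compact_eq_totally_bounded by (meson divide_pos_pos zero_less_numeral)
  have "convex hull S \<subseteq> (\<Union>x\<in>convex hull k. \<Union>y\<in>ball 0 (e/4). {x + y})"
  proof (rule hull_minimal)
    show "convex (\<Union>x\<in>convex hull k. \<Union>y\<in>ball 0 (e/4). {x + y})"
      by (intro convex_sums convex_convex_hull convex_ball)
    show "S \<subseteq> (\<Union>x\<in>convex hull k. \<Union>y\<in>ball 0 (e/4). {x + y})"
    proof
      fix s assume "s \<in> S"
      then obtain c where "c \<in> k" "dist c s < e/4" using k(2) by auto
      then have "s = c + (s - c) \<and> c \<in> convex hull k \<and> s - c \<in> ball 0 (e/4)"
        by (simp add: hull_inc dist_norm norm_minus_commute)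
      then show "s \<in> (\<Union>x\<in>convex hull k. \<Union>y\<in>ball 0 (e/4). {x + y})" by blast
    qed
  qed
  have "closure (convex hull S) \<subseteq> (\<Union>x\<in>l. ball x e)"
  proof
    fix z assume "z \<in> closure (convex hull S)"
    then obtain s where s: "s \<in> convex hull S" "dist s z < e/4"
      using e closure_approachable by (metis divide_pos_pos zero_less_numeral)
    then obtain x y where xy: "s = x + y" "x \<in> convex hull k" "norm y < e/4"
      using \<open>convex hull S \<subseteq> _\<close> by auto
    obtain c where c: "c \<in> l" "dist c x < e/4" using xy(2) l(2) by auto
    have "dist c z \<le> dist c x + dist x s + dist s z"
      using dist_triangle[of c z x] dist_triangle[of x z s] by simp
    also have "\<dots> < e" using c s xy e by (simp add: dist_norm)
    finally show "z \<in> (\<Union>x\<in>l. ball x e)" using c(1) by auto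
  qed
  with l(1) show "\<exists>k. finite k \<and> closure (convex hull S) \<subseteq> (\<Union>x\<in>k. ball x e)" by blast
qed

section \<open>Holomorphic maps along complex lines\<close>

lemma scaleC_bounded_bilinear: "bounded_bilinear (scaleC :: complex \<Rightarrow> 'a::complex_banach \<Rightarrow> 'a)"
proof (rule bounded_bilinear.intro)
  show "scaleC (r *\<^sub>R c) x = r *\<^sub>R scaleC c x" for r c and x :: 'a
    by (simp add: scaleR_scaleC[of r "scaleC c x"] scaleR_conv_of_real complex_vs.scale_scale)
  show "scaleC c (r *\<^sub>R x) = r *\<^sub>R scaleC c x" for r c and x :: 'a
    by (simp add: scaleR_scaleC complex_vs.scale_scale mult.commute)
  show "\<exists>K. \<forall>c (x :: 'a). norm (scaleC c x) \<le> cmod c * norm x * K"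
    by (rule exI[of _ 1]) (simp add: norm_scaleC)
qed (simp_all add: scaleC_add_left scaleC_add_right)

lemmas continuous_on_scaleC [continuous_intros] =
  bounded_bilinear.continuous_on[OF scaleC_bounded_bilinear]
lemmas bounded_linear_scaleC_left = bounded_bilinear.bounded_linear_left[OF scaleC_bounded_bilinear]
lemmas bounded_linear_scaleC_right = bounded_bilinear.bounded_linear_right[OF scaleC_bounded_bilinear]

lemma scaleC_scaleR: "scaleC c (r *\<^sub>R x) = r *\<^sub>R scaleC c x"
  by (simp add: scaleR_scaleC complex_vs.scale_scale mult.commute)

lemma holomorphic_mapsD:
  assumes "f \<in> holomorphic_maps U F" "x \<in> U"
  obtains D where "clinear D" "(f has_derivative D) (at x)"
  using assms by (auto simp: holomorphic_maps_def)

lemma holomorphic_maps_continuous_on: "f \<in> holomorphic_maps U F \<Longrightarrow> continuous_on U f"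
  unfolding holomorphic_maps_def
  by (auto intro!: continuous_at_imp_continuous_on dest: has_derivative_continuous)

lemma open_line_preimage:
  assumes "open U"
  shows "open {\<zeta>. a + scaleC \<zeta> h \<in> U}"
proof -
  have "open ((\<lambda>\<zeta>. a + scaleC \<zeta> h) -` U)"
    by (intro open_vimage assms continuous_intros)
  then show ?thesis by (simp add: vimage_def)
qed

text \<open>The derivative in \<open>holomorphic_maps\<close> is a real Frechet derivative; complex
  linearity of \<open>D\<close> turns its restriction to the line into multiplication by a complex
  number.\<close>

lemma has_field_derivative_along_line:
  assumes D: "clinear D" "(f has_derivative D) (at (a + scaleC \<zeta> h))"
    and \<phi>: "norm_le_one_functional \<phi>"
  shows "((\<lambda>\<zeta>. \<phi> (f (a + scaleC \<zeta> h))) has_field_derivative \<phi> (D h)) (at \<zeta>)"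
proof -
  have "((\<lambda>\<zeta>. a + scaleC \<zeta> h) has_derivative (\<lambda>t. 0 + scaleC t h)) (at \<zeta>)"
    by (intro has_derivative_add has_derivative_const bounded_linear_imp_has_derivative
        bounded_linear_scaleC_left)
  from has_derivative_compose[OF this D(2)]
  have "((\<lambda>\<zeta>. f (a + scaleC \<zeta> h)) has_derivative (\<lambda>t. D (scaleC t h))) (at \<zeta>)" by simp
  from bounded_linear.has_derivative[OF functional_bounded_linear[OF \<phi>] this]
  have "((\<lambda>\<zeta>. \<phi> (f (a + scaleC \<zeta> h))) has_derivative (\<lambda>t. \<phi> (D (scaleC t h)))) (at \<zeta>)" .
  moreover have "(\<lambda>t. \<phi> (D (scaleC t h))) = (*) (\<phi> (D h))"
    using D(1) by (auto simp: clinear_iff functional_scaleC[OF \<phi>] mult.commute)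
  ultimately show ?thesis by (simp add: has_field_derivative_def)
qed

lemma holomorphic_along_line:
  assumes "f \<in> holomorphic_maps U F" "norm_le_one_functional \<phi>"
  shows "(\<lambda>\<zeta>. \<phi> (f (a + scaleC \<zeta> h))) holomorphic_on {\<zeta>. a + scaleC \<zeta> h \<in> U}"
  unfolding holomorphic_on_def
proof
  fix \<zeta> assume "\<zeta> \<in> {\<zeta>. a + scaleC \<zeta> h \<in> U}"
  then obtain D where "clinear D" "(f has_derivative D) (at (a + scaleC \<zeta> h))"
    using holomorphic_mapsD[OF assms(1)] by blast
  from has_field_derivative_along_line[OF this assms(2)]
  show "(\<lambda>\<zeta>. \<phi> (f (a + scaleC \<zeta> h))) field_differentiable at \<zeta> within {\<zeta>. a + scaleC \<zeta> h \<in> U}"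
    using field_differentiable_at_within field_differentiable_def by blast
qed

section \<open>Taylor coefficients of scalar functions\<close>

text \<open>Cauchy's formula on the unit circle, parametrised over \<open>{0..1}\<close> so that no
  factor \<open>2 * pi\<close> remains: Taylor coefficients become Fourier coefficients.\<close>

lemma has_integral_taylor_coefficient:
  assumes g: "g holomorphic_on S" and S: "cball 0 1 \<subseteq> S"
  shows "((\<lambda>t. cis (- (2 * pi * t)) ^ k * g (cis (2 * pi * t))) has_integral
           (deriv ^^ k) g 0 / fact k) {0..1}"
proof -
  have "((\<lambda>u. g u / (u - 0) ^ Suc k) has_contour_integral
      (2 * pi * \<i>) / fact k * (deriv ^^ k) g 0) (circlepath 0 1)"
    using g S by (intro Cauchy_has_contour_integral_higher_derivative_circlepath)
      (auto intro: holomorphic_on_imp_continuous_on holomorphic_on_subset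
        holomorphic_on_subset[OF _ order_trans[OF ball_subset_cball]])
  then have *: "((\<lambda>t. g (circlepath 0 1 t) / (circlepath 0 1 t) ^ Suc k *
      vector_derivative (circlepath 0 1) (at t within {0..1})) has_integral
      (2 * pi * \<i>) / fact k * (deriv ^^ k) g 0) {0..1}"
    by (simp add: has_contour_integral_def)
  have cp: "circlepath 0 1 t = cis (2 * pi * t)" for t
    by (simp add: circlepath cis_conv_exp mult_ac)
  have vd: "vector_derivative (circlepath 0 1) (at t within {0..1}) = 2 * pi * \<i> * cis (2 * pi * t)"
    if "t \<in> {0..1}" for t
    using that by (simp add: vector_derivative_circlepath01 cis_conv_exp mult_ac)
  \<comment> \<open>The derivative of the path contributes one factor
    \<open>cis (2 * pi * t)\<close>, which lowers the exponent \<open>Suc k\<close> to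
    \<open>k\<close>.\<close>
  have "((\<lambda>t. (2 * pi * \<i>) * (cis (- (2 * pi * t)) ^ k * g (cis (2 * pi * t)))) has_integral
      (2 * pi * \<i>) * ((deriv ^^ k) g 0 / fact k)) {0..1}"
  proof (rule has_integral_eq[rotated])
    show "((\<lambda>t. g (circlepath 0 1 t) / (circlepath 0 1 t) ^ Suc k *
      vector_derivative (circlepath 0 1) (at t within {0..1})) has_integral
      (2 * pi * \<i>) * ((deriv ^^ k) g 0 / fact k)) {0..1}"
      using * by simp
    fix t :: real assume t: "t \<in> {0..1}"
    have inv: "cis (- (2 * pi * t)) ^ k = inverse (cis (2 * pi * t) ^ k)"
      unfolding cis_inverse[symmetric] power_inverse ..
    show "g (circlepath 0 1 t) / (circlepath 0 1 t) ^ Suc k *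
        vector_derivative (circlepath 0 1) (at t within {0..1}) =
        (2 * pi * \<i>) * (cis (- (2 * pi * t)) ^ k * g (cis (2 * pi * t)))"
      unfolding vd[OF t] cp inv by (simp add: divide_inverse cis_mult)
  qed
  from has_integral_mult_right[OF this, of "1 / (2 * pi * \<i>)"] show ?thesis by simp
qed

lemma taylor_coefficient_le:
  assumes g: "g holomorphic_on S" and S: "cball 0 R \<subseteq> S" and R: "0 < R"
    and M: "\<And>\<zeta>. \<zeta> \<in> cball 0 R \<Longrightarrow> cmod (g \<zeta>) \<le> M"
  shows "cmod ((deriv ^^ k) g 0 / fact k) \<le> M / R ^ k"
proof -
  have "norm ((deriv ^^ k) g 0) \<le> fact k * M / R ^ k"
  proof (rule Cauchy_inequality[OF _ _ R])
    show "g holomorphic_on ball 0 R" "continuous_on (cball 0 R) g"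
      using g S by (auto intro: holomorphic_on_imp_continuous_on holomorphic_on_subset
          holomorphic_on_subset[OF _ order_trans[OF ball_subset_cball]])
  qed (use M in auto)
  then show ?thesis by (simp add: norm_divide field_simps)
qed

text \<open>Cauchy's inequalities on a radius above 1 make the Taylor tail at the point 1 geometric.
  The case \<open>n = 1\<close> will give a Schwarz estimate, \<open>n = 2\<close> a quadratic
  remainder, and general \<open>n\<close> the convergence of the Fejer means.\<close>

lemma taylor_remainder_le:
  assumes g: "g holomorphic_on S" and S: "cball 0 R \<subseteq> S" and R: "1 < R"
    and M: "\<And>\<zeta>. \<zeta> \<in> cball 0 R \<Longrightarrow> cmod (g \<zeta>) \<le> M"
  shows "cmod (g 1 - (\<Sum>k<n. (deriv ^^ k) g 0 / fact k)) \<le> M / R ^ n * (R / (R - 1))"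
proof -
  define a where "a k = (deriv ^^ k) g 0 / fact k" for k
  have "(\<lambda>k. a k * (1 - 0) ^ k) sums g 1"
    unfolding a_def using R g S
    by (intro holomorphic_power_series[where r = R])
      (auto intro: holomorphic_on_subset simp: subset_eq)
  then have "a sums g 1" by simp
  then have s: "(\<lambda>k. a (k + n)) sums (g 1 - (\<Sum>k<n. a k))"
    by (rule sums_split_initial_segment)
  have le: "norm (a (k + n)) \<le> M / R ^ n * (1 / R) ^ k" for k
    using taylor_coefficient_le[OF g S _ M, of "k + n"] R
    by (simp add: a_def power_add power_one_over field_simps)
  have geo: "(\<lambda>k. M / R ^ n * (1 / R) ^ k) sums (M / R ^ n * (1 / (1 - 1 / R)))"
    using R by (intro sums_mult geometric_sums) simp
  have "cmod (g 1 - (\<Sum>k<n. a k)) \<le> M / R ^ n * (1 / (1 - 1 / R))"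
    using norm_suminf_le[OF le sums_summable[OF geo]] sums_unique[OF s] sums_unique[OF geo] by simp
  also have "1 / (1 - 1 / R) = R / (R - 1)" using R by (simp add: field_simps)
  finally show ?thesis by (simp add: a_def)
qed

text \<open>\<open>a k\<close> occurs in the partial sums with \<open>k \<le> l \<le> n\<close>,
  hence \<open>Suc n - k\<close> times; these are the Fejer weights up to the factor
  \<open>1 / Suc n\<close>.\<close>

lemma sum_of_partial_sums:
  fixes a :: "nat \<Rightarrow> 'a::real_vector"
  shows "(\<Sum>l\<le>n. \<Sum>k\<le>l. a k) = (\<Sum>k\<le>n. real (Suc n - k) *\<^sub>R a k)"
proof (induction n)
  case (Suc n)
  have "(\<Sum>k\<le>Suc n. real (Suc (Suc n) - k) *\<^sub>R a k) =
      (\<Sum>k\<le>Suc n. real (Suc n - k) *\<^sub>R a k) + (\<Sum>k\<le>Suc n. a k)"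
    unfolding sum.distrib[symmetric]
    by (intro sum.cong refl) (simp add: Suc_diff_le scaleR_left_distrib scaleR_2 algebra_simps)
  with Suc show ?case by simp
qed simp

text \<open>With \<open>D\<close> the sum of the powers of \<open>e t\<close> up to
  \<open>n\<close>, its squared modulus is \<open>Suc n\<close> times the Fejer kernel: it is
  nonnegative, has integral \<open>Suc n\<close>, and integrating \<open>g\<close> against it
  produces the weighted Taylor sum, which is therefore an average of \<open>g\<close> over the unit
  circle.\<close>

lemma fejer_sum_le:
  assumes g: "g holomorphic_on S" and S: "cball 0 1 \<subseteq> S"
    and M: "\<And>\<zeta>. cmod \<zeta> = 1 \<Longrightarrow> cmod (g \<zeta>) \<le> M"
  shows "cmod (\<Sum>k\<le>n. (real (Suc n - k) / real (Suc n)) *\<^sub>R ((deriv ^^ k) g 0 / fact k)) \<le> M"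
proof -
  define e where "e t = cis (2 * pi * t)" for t
  define D where "D t = (\<Sum>j\<le>n. e t ^ j)" for t
  have ecnj: "cnj (e t) = cis (- (2 * pi * t))" for t
    by (simp add: e_def cis_cnj)
  have e1: "e t * cnj (e t) = 1" for t
    by (simp add: e_def cis_cnj cis_mult)
  have nonneg: "e t ^ j * cnj (e t) ^ (j + i) = cnj (e t) ^ i" for t i j
  proof -
    have "e t ^ j * cnj (e t) ^ (j + i) = (e t * cnj (e t)) ^ j * cnj (e t) ^ i"
      by (simp only: power_add power_mult_distrib mult.assoc)
    then show ?thesis by (simp only: e1) simp
  qed
  have neg: "e t ^ (l + i) * cnj (e t) ^ l = e t ^ i" for t i l
  proof -
    have "e t ^ (l + i) * cnj (e t) ^ l = (e t * cnj (e t)) ^ l * e t ^ i"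
      by (simp only: power_add power_mult_distrib mult_ac)
    then show ?thesis by (simp only: e1) simp
  qed
  have main: "((\<lambda>t. D t * cnj (D t) * h (e t)) has_integral
      (\<Sum>k\<le>n. real (Suc n - k) *\<^sub>R ((deriv ^^ k) h 0 / fact k))) {0..1}"
    if h: "h holomorphic_on S" for h
  proof -
    define a where "a k = (deriv ^^ k) h 0 / fact k" for k
    have coeff: "((\<lambda>t. e t ^ j * cnj (e t) ^ l * h (e t)) has_integral
        (if j \<le> l then a (l - j) else 0)) {0..1}" for j l
    proof (cases "j \<le> l")
      case True
      then obtain i where l: "l = j + i" using le_Suc_ex by blast
      show ?thesis
        using has_integral_taylor_coefficient[OF h S, of i] nonneg[of _ j i]
        by (simp add: l a_def ecnj flip: e_def)
    next
      case False
      then obtain i where j: "j = l + Suc i" using less_imp_Suc_add by (metis add_Suc_right not_le)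
      \<comment> \<open>For \<open>j > l\<close> the integral is the value at 0 of
        \<open>z ^ Suc i * h z\<close>, which vanishes; holomorphy thus removes all negative
        frequencies.\<close>
      have "(\<lambda>z. z ^ Suc i * h z) holomorphic_on S"
        using h by (intro holomorphic_intros)
      from has_integral_taylor_coefficient[OF this S, of 0]
      have "((\<lambda>t. e t ^ Suc i * h (e t)) has_integral 0) {0..1}"
        by (simp flip: e_def)
      with False show ?thesis unfolding j neg by simp
    qed
    have inner: "(\<Sum>j\<le>n. if j \<le> l then a (l - j) else 0) = (\<Sum>k\<le>l. a k)" if "l \<le> n" for l
    proof -
      have "(\<Sum>j\<le>n. if j \<le> l then a (l - j) else 0) = (\<Sum>j\<le>l. a (l - j))"
        using that by (intro sum.mono_neutral_cong_right) auto
      also have "\<dots> = (\<Sum>k\<le>l. a k)"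
        by (rule sum.reindex_bij_witness[of _ "\<lambda>k. l - k" "\<lambda>k. l - k"]) auto
      finally show ?thesis .
    qed
    have total: "(\<Sum>l\<le>n. \<Sum>j\<le>n. if j \<le> l then a (l - j) else 0) =
        (\<Sum>k\<le>n. real (Suc n - k) *\<^sub>R a k)"
      using inner by (simp add: sum_of_partial_sums)
    have "((\<lambda>t. \<Sum>l\<le>n. \<Sum>j\<le>n. e t ^ j * cnj (e t) ^ l * h (e t)) has_integral
        (\<Sum>l\<le>n. \<Sum>j\<le>n. if j \<le> l then a (l - j) else 0)) {0..1}"
      by (intro has_integral_sum coeff) auto
    moreover have "(\<Sum>l\<le>n. \<Sum>j\<le>n. e t ^ j * cnj (e t) ^ l * h (e t)) = D t * cnj (D t) * h (e t)" for t
      by (simp add: D_def sum_distrib_left sum_distrib_right mult_ac)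
    ultimately show ?thesis by (simp add: total a_def)
  qed
  \<comment> \<open>The constant function 1 in \<open>main\<close> evaluates the total mass of the
    kernel.\<close>
  have "(\<Sum>k\<le>n. real (Suc n - k) *\<^sub>R ((deriv ^^ k) (\<lambda>_. 1) 0 / fact k)) = (of_nat (Suc n) :: complex)"
    by (subst sum.remove[of _ 0]) (auto simp: scaleR_conv_of_real intro!: sum.neutral)
  then have "((\<lambda>t. D t * cnj (D t)) has_integral of_nat (Suc n)) {0..1}"
    using main[of "\<lambda>_. 1"] by simp
  from has_integral_linear[OF this bounded_linear_Re]
  have D2: "((\<lambda>t. (cmod (D t))\<^sup>2) has_integral real (Suc n)) {0..1}"
    by (simp add: o_def flip: complex_norm_square)
  define s where "s = (\<Sum>k\<le>n. real (Suc n - k) *\<^sub>R ((deriv ^^ k) g 0 / fact k))"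
  have Mint: "((\<lambda>t. (cmod (D t))\<^sup>2 * M) has_integral real (Suc n) * M) {0..1}"
    by (rule has_integral_mult_left[OF D2])
  have "cmod (D t * cnj (D t) * g (e t)) \<le> (cmod (D t))\<^sup>2 * M" for t
    using M[of "e t"] by (simp add: norm_mult power2_eq_square mult_left_mono e_def)
  then have "cmod s \<le> real (Suc n) * M"
    using integral_norm_bound_integral[OF has_integral_integrable[OF main[OF g]]
        has_integral_integrable[OF Mint]]
    unfolding integral_unique[OF main[OF g]] integral_unique[OF Mint] s_def by blast
  moreover have "(\<Sum>k\<le>n. (real (Suc n - k) / real (Suc n)) *\<^sub>R ((deriv ^^ k) g 0 / fact k)) =
      (1 / real (Suc n)) *\<^sub>R s"
    unfolding s_def scaleR_sum_right by (intro sum.cong) simp_all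
  ultimately show ?thesis
    by (simp only: norm_scaleR) (simp add: divide_le_eq mult.commute)
qed

section \<open>Taylor terms and Fejer means of vector-valued maps\<close>

text \<open>The Cauchy integral for the k-th homogeneous term of the Taylor expansion at 0. It
  involves \<open>f\<close> only on the circle through \<open>x\<close> and makes sense for vector
  values without any power series.\<close>

definition taylor_term :: "('e::complex_banach \<Rightarrow> 'b::complex_banach) \<Rightarrow> nat \<Rightarrow> 'e \<Rightarrow> 'b" where
  "taylor_term f k x =
     integral {0..1} (\<lambda>t. scaleC (cis (- (2 * pi * t)) ^ k) (f (scaleC (cis (2 * pi * t)) x)))"

lemma continuous_on_cis_composed [continuous_intros]:
  "continuous_on S g \<Longrightarrow> continuous_on S (\<lambda>t. cis (g t))"
  unfolding cis_conv_exp by (intro continuous_intros)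

lemma continuous_on_circle:
  assumes f: "continuous_on U f" and U: "\<And>\<zeta>. cmod \<zeta> = 1 \<Longrightarrow> scaleC \<zeta> x \<in> U"
  shows "continuous_on S (\<lambda>t. scaleC (cis (- (2 * pi * t)) ^ k) (f (scaleC (cis (2 * pi * t)) x)))"
  by (intro continuous_intros continuous_on_compose2[OF f]) (auto simp: U)

lemma taylor_term_integrable:
  assumes f: "f \<in> holomorphic_maps U F" and U: "\<And>\<zeta>. cmod \<zeta> = 1 \<Longrightarrow> scaleC \<zeta> x \<in> U"
  shows "(\<lambda>t. scaleC (cis (- (2 * pi * t)) ^ k) (f (scaleC (cis (2 * pi * t)) x))) integrable_on {0..1}"
  by (intro integrable_continuous_real continuous_on_circle[OF holomorphic_maps_continuous_on[OF f] U])

text \<open>A bounded functional passes through the integral, which links the vector-valued term to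
  the scalar coefficient of \<open>\<phi> \<circ> f\<close> on the complex line through
  \<open>x\<close>.\<close>

lemma functional_taylor_term:
  assumes f: "f \<in> holomorphic_maps U F" and U: "\<And>\<zeta>. cmod \<zeta> \<le> 1 \<Longrightarrow> scaleC \<zeta> x \<in> U"
    and \<phi>: "norm_le_one_functional \<phi>"
  shows "\<phi> (taylor_term f k x) = (deriv ^^ k) (\<lambda>\<zeta>. \<phi> (f (scaleC \<zeta> x))) 0 / fact k"
proof -
  have "(\<lambda>\<zeta>. \<phi> (f (scaleC \<zeta> x))) holomorphic_on {\<zeta>. scaleC \<zeta> x \<in> U}"
    using holomorphic_along_line[OF f \<phi>, of 0 x] by simp
  from has_integral_taylor_coefficient[OF this]
  have "((\<lambda>t. cis (- (2 * pi * t)) ^ k * \<phi> (f (scaleC (cis (2 * pi * t)) x))) has_integral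
      (deriv ^^ k) (\<lambda>\<zeta>. \<phi> (f (scaleC \<zeta> x))) 0 / fact k) {0..1}"
    using U by (auto simp: subset_eq)
  moreover have "integral {0..1} (\<phi> \<circ> (\<lambda>t. scaleC (cis (- (2 * pi * t)) ^ k)
      (f (scaleC (cis (2 * pi * t)) x)))) = \<phi> (taylor_term f k x)"
    unfolding taylor_term_def
    by (intro integral_linear taylor_term_integrable[OF f] functional_bounded_linear[OF \<phi>] U) simp
  ultimately show ?thesis
    by (simp add: o_def functional_scaleC[OF \<phi>] integral_unique)
qed

lemma norm_taylor_term_le:
  assumes f: "f \<in> holomorphic_maps U F" and U: "\<And>\<zeta>. cmod \<zeta> = 1 \<Longrightarrow> scaleC \<zeta> x \<in> U"
    and M: "\<And>\<zeta>. cmod \<zeta> = 1 \<Longrightarrow> norm (f (scaleC \<zeta> x)) \<le> M"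
  shows "norm (taylor_term f k x) \<le> M"
  using integral_bound[of 0 1 _ M,
      OF _ continuous_on_circle[OF holomorphic_maps_continuous_on[OF f] U]] M
  by (simp add: taylor_term_def norm_scaleC norm_power)

lemma taylor_term_in_subspace:
  assumes f: "f \<in> holomorphic_maps U F" and F: "banach_subspace F"
    and U: "\<And>\<zeta>. cmod \<zeta> = 1 \<Longrightarrow> scaleC \<zeta> x \<in> U"
  shows "taylor_term f k x \<in> F"
  unfolding taylor_term_def
proof (rule integral_in_closed_convex)
  show "convex F"
    using F unfolding banach_subspace_def complex_vs.subspace_def convex_def
    by (simp add: scaleR_scaleC)
  show "closed F" using F by (simp add: banach_subspace_def)
  show "scaleC (cis (- (2 * pi * t)) ^ k) (f (scaleC (cis (2 * pi * t)) x)) \<in> F" for t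
    using f F U[of "cis (2 * pi * t)"]
    by (auto simp: holomorphic_maps_def banach_subspace_def complex_vs.subspace_def)
qed (rule taylor_term_integrable[OF f U])

text \<open>Tested on functionals: the k-th derivative at 0 of \<open>g (c * \<zeta>)\<close> is
  \<open>c ^ k\<close> times that of \<open>g\<close>; \<open>cmod c \<le> 1\<close> keeps the
  multiplied disc in the domain.\<close>

lemma taylor_term_scaleC:
  assumes f: "f \<in> holomorphic_maps U F" and "open U"
    and U: "\<And>\<zeta>. cmod \<zeta> \<le> 1 \<Longrightarrow> scaleC \<zeta> x \<in> U" and c: "cmod c \<le> 1"
  shows "taylor_term f k (scaleC c x) = scaleC (c ^ k) (taylor_term f k x)"
proof (rule eq_if_functionals_eq)
  fix \<phi> :: "'b \<Rightarrow> complex" assume \<phi>: "norm_le_one_functional \<phi>"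
  define g where "g \<zeta> = \<phi> (f (scaleC \<zeta> x))" for \<zeta>
  define T where "T = {\<zeta>. scaleC \<zeta> x \<in> U}"
  have g: "g holomorphic_on T"
    using holomorphic_along_line[OF f \<phi>, of 0 x] by (simp add: g_def[abs_def] T_def)
  have T: "open T"
    using open_line_preimage[OF \<open>open U\<close>, of 0 x] by (simp add: T_def)
  have "open ((\<lambda>\<zeta>. c * \<zeta>) -` T)"
    by (intro open_vimage T continuous_intros)
  then have "(deriv ^^ k) (\<lambda>\<zeta>. g (c * \<zeta>)) 0 = c ^ k * (deriv ^^ k) g (c * 0)"
    by (intro higher_deriv_compose_linear[OF g _ T]) (use U[of 0] in \<open>auto simp: T_def\<close>)
  moreover have "\<phi> (taylor_term f k (scaleC c x)) = (deriv ^^ k) (\<lambda>\<zeta>. g (c * \<zeta>)) 0 / fact k"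
  proof -
    have "scaleC \<zeta> (scaleC c x) \<in> U" if "cmod \<zeta> \<le> 1" for \<zeta>
      using U[of "\<zeta> * c"] that c by (simp add: norm_mult mult_le_one)
    from functional_taylor_term[OF f this \<phi>] show ?thesis
      by (simp add: g_def mult.commute)
  qed
  ultimately show "\<phi> (taylor_term f k (scaleC c x)) = \<phi> (scaleC (c ^ k) (taylor_term f k x))"
    using functional_taylor_term[OF f U \<phi>] by (simp add: functional_scaleC[OF \<phi>] g_def[abs_def])
qed

lemma taylor_term_remainder:
  assumes f: "f \<in> holomorphic_maps U F" and R: "1 < R"
    and U: "\<And>\<zeta>. cmod \<zeta> \<le> R \<Longrightarrow> scaleC \<zeta> x \<in> U \<and> norm (f (scaleC \<zeta> x)) \<le> M"
  shows "norm (f x - (\<Sum>k<n. taylor_term f k x)) \<le> M / R ^ n * (R / (R - 1))"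
proof (rule norm_le_if_functionals_le)
  fix \<phi> :: "'b \<Rightarrow> complex" assume \<phi>: "norm_le_one_functional \<phi>"
  define g where "g \<zeta> = \<phi> (f (scaleC \<zeta> x))" for \<zeta>
  have g: "g holomorphic_on {\<zeta>. scaleC \<zeta> x \<in> U}"
    using holomorphic_along_line[OF f \<phi>, of 0 x] by (simp add: g_def[abs_def])
  have "cmod (g 1 - (\<Sum>k<n. (deriv ^^ k) g 0 / fact k)) \<le> M / R ^ n * (R / (R - 1))"
    using U functional_le[OF \<phi>]
    by (intro taylor_remainder_le[OF g _ R]) (auto simp: g_def intro: order_trans)
  moreover have "\<phi> (taylor_term f k x) = (deriv ^^ k) g 0 / fact k" for k
    using functional_taylor_term[OF f _ \<phi>, of x k] U R by (simp add: g_def[abs_def])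
  moreover note linear = bounded_linear.linear[OF functional_bounded_linear[OF \<phi>]]
  ultimately show "cmod (\<phi> (f x - (\<Sum>k<n. taylor_term f k x))) \<le> M / R ^ n * (R / (R - 1))"
    by (simp add: linear_diff[OF linear] linear_sum[OF linear] g_def)
qed

text \<open>Openness yields one real factor \<open>R > 1\<close> that keeps \<open>x\<close> in the
  set, and balancedness fills the disc. The radius above 1 is the source of geometric convergence at
  each single point.\<close>

lemma balanced_dilation:
  assumes "open U" "balanced U" "x \<in> U"
  obtains R where "1 < R" "\<And>\<zeta>. cmod \<zeta> \<le> R \<Longrightarrow> scaleC \<zeta> x \<in> U"
proof -
  have "open ((\<lambda>\<zeta>. scaleC \<zeta> x) -` U)"
    by (intro open_vimage assms(1) continuous_intros)
  moreover have "1 \<in> (\<lambda>\<zeta>. scaleC \<zeta> x) -` U" using assms(3) by simp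
  ultimately obtain e where e: "0 < e" "cball 1 e \<subseteq> (\<lambda>\<zeta>. scaleC \<zeta> x) -` U"
    using open_contains_cball by blast
  define R where "R = 1 + e"
  have R: "1 < R" using e(1) by (simp add: R_def)
  have "complex_of_real R \<in> cball 1 e" using e(1) by (simp add: dist_norm R_def)
  with e(2) have y: "scaleC (complex_of_real R) x \<in> U" by blast
  have "scaleC \<zeta> x \<in> U" if "cmod \<zeta> \<le> R" for \<zeta>
  proof -
    have "cmod (\<zeta> / complex_of_real R) \<le> 1" using that R by (simp add: norm_divide)
    with y assms(2) have "scaleC (\<zeta> / complex_of_real R) (scaleC (complex_of_real R) x) \<in> U"
      unfolding balanced_def by blast
    then show ?thesis using R by (simp add: complex_vs.scale_scale)
  qed
  with R show ?thesis by (rule that)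
qed

definition fejer_mean :: "('e::complex_banach \<Rightarrow> 'b::complex_banach) \<Rightarrow> nat \<Rightarrow> 'e \<Rightarrow> 'b" where
  "fejer_mean f n x = (\<Sum>k\<le>n. (real (Suc n - k) / real (Suc n)) *\<^sub>R taylor_term f k x)"

text \<open>The bound looks at \<open>f\<close> on the unimodular multiples of \<open>x\<close>,
  where a radial weight does not change; a weighted bound of \<open>f\<close> will therefore be
  inherited by its Fejer means.\<close>

lemma norm_fejer_mean_le:
  assumes f: "f \<in> holomorphic_maps U F" and U: "\<And>\<zeta>. cmod \<zeta> \<le> 1 \<Longrightarrow> scaleC \<zeta> x \<in> U"
    and M: "\<And>\<zeta>. cmod \<zeta> = 1 \<Longrightarrow> norm (f (scaleC \<zeta> x)) \<le> M"
  shows "norm (fejer_mean f n x) \<le> M"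
proof (rule norm_le_if_functionals_le)
  fix \<phi> :: "'b \<Rightarrow> complex" assume \<phi>: "norm_le_one_functional \<phi>"
  define g where "g \<zeta> = \<phi> (f (scaleC \<zeta> x))" for \<zeta>
  have g: "g holomorphic_on {\<zeta>. scaleC \<zeta> x \<in> U}"
    using holomorphic_along_line[OF f \<phi>, of 0 x] by (simp add: g_def[abs_def])
  have "cmod (g \<zeta>) \<le> M" if "cmod \<zeta> = 1" for \<zeta>
    using order_trans[OF functional_le[OF \<phi>] M[OF that]] by (simp add: g_def)
  then have "cmod (\<Sum>k\<le>n. (real (Suc n - k) / real (Suc n)) *\<^sub>R ((deriv ^^ k) g 0 / fact k)) \<le> M"
    using U by (intro fejer_sum_le[OF g]) auto
  moreover have "\<phi> (taylor_term f k x) = (deriv ^^ k) g 0 / fact k" for k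
    unfolding g_def by (rule functional_taylor_term[OF f U \<phi>])
  moreover note linear = bounded_linear.linear[OF functional_bounded_linear[OF \<phi>]]
  ultimately show "cmod (\<phi> (fejer_mean f n x)) \<le> M"
    by (simp add: fejer_mean_def linear_sum[OF linear] linear_cmul[OF linear])
qed

lemma fejer_mean_eq_mean_of_partial_sums:
  "fejer_mean f n x = (1 / real (Suc n)) *\<^sub>R (\<Sum>l\<le>n. \<Sum>k<Suc l. taylor_term f k x)"
  unfolding lessThan_Suc_atMost sum_of_partial_sums by (simp add: fejer_mean_def scaleR_sum_right)

text \<open>The remainders of the partial sums at \<open>x\<close> are dominated by a convergent
  geometric series with sum \<open>K\<close>, so their arithmetic mean is at most
  \<open>K / Suc n\<close>.\<close>

lemma fejer_mean_tendsto:
  assumes f: "f \<in> holomorphic_maps U F" and U: "open U" "balanced U" "x \<in> U"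
  shows "(\<lambda>n. fejer_mean f n x) \<longlonglongrightarrow> f x"
proof -
  obtain R where R: "1 < R" "\<And>\<zeta>. cmod \<zeta> \<le> R \<Longrightarrow> scaleC \<zeta> x \<in> U"
    using balanced_dilation[OF U] by blast
  have "compact ((\<lambda>\<zeta>. f (scaleC \<zeta> x)) ` cball 0 R)"
    using R(2) by (intro compact_continuous_image continuous_intros
        continuous_on_compose2[OF holomorphic_maps_continuous_on[OF f]]) auto
  then have "bounded ((\<lambda>\<zeta>. f (scaleC \<zeta> x)) ` cball 0 R)"
    by (rule compact_imp_bounded)
  then obtain M where M: "\<And>\<zeta>. cmod \<zeta> \<le> R \<Longrightarrow> norm (f (scaleC \<zeta> x)) \<le> M"
    unfolding bounded_iff by (metis image_eqI mem_cball_0)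
  have "0 \<le> M" using order_trans[OF norm_ge_zero M[of 0]] R(1) by simp
  define C where "C = M * (R / (R - 1))"
  have C: "0 \<le> C" using \<open>0 \<le> M\<close> R(1) by (simp add: C_def)
  have rem: "norm ((\<Sum>k<l. taylor_term f k x) - f x) \<le> C * (1 / R) ^ l" for l
  proof -
    have "norm (f x - (\<Sum>k<l. taylor_term f k x)) \<le> M / R ^ l * (R / (R - 1))"
      using R(2) M by (intro taylor_term_remainder[OF f R(1)]) blast
    then show ?thesis by (simp add: C_def norm_minus_commute power_one_over mult.commute)
  qed
  have geo: "(\<lambda>l. C * (1 / R) ^ Suc l) sums (C * (1 / R) * (1 / (1 - 1 / R)))"
    using sums_mult[OF geometric_sums[of "1 / R"], of "C * (1 / R)"] R(1) by (simp add: mult_ac)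
  define K where "K = C * (1 / R) * (1 / (1 - 1 / R))"
  have le: "norm (fejer_mean f n x - f x) \<le> K * (1 / real (Suc n))" for n
  proof -
    have "fejer_mean f n x - f x = (1 / real (Suc n)) *\<^sub>R (\<Sum>l\<le>n. (\<Sum>k<Suc l. taylor_term f k x) - f x)"
      by (simp add: fejer_mean_eq_mean_of_partial_sums sum_subtractf scaleR_diff_right del: sum.lessThan_Suc)
        (simp add: sum_constant_scaleR)
    also have "norm \<dots> \<le> (1 / real (Suc n)) * (\<Sum>l\<le>n. C * (1 / R) ^ Suc l)"
      unfolding norm_scaleR by (intro mult_mono sum_norm_le rem) auto
    also have "\<dots> \<le> (1 / real (Suc n)) * (\<Sum>l. C * (1 / R) ^ Suc l)"
      using C R(1) by (intro mult_left_mono sum_le_suminf sums_summable[OF geo]) auto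
    also have "\<dots> = K * (1 / real (Suc n))"
      unfolding K_def sums_unique[OF geo] by (rule mult.commute)
    finally show ?thesis .
  qed
  have "(\<lambda>n. K * (1 / real (Suc n))) \<longlonglongrightarrow> K * 0"
    by (intro tendsto_mult tendsto_const LIMSEQ_Suc[OF lim_1_over_n])
  then have "(\<lambda>n. K * (1 / real (Suc n))) \<longlonglongrightarrow> 0"
    unfolding mult_zero_right .
  with always_eventually[OF allI[OF le]] have "(\<lambda>n. fejer_mean f n x - f x) \<longlonglongrightarrow> 0"
    by (rule Lim_null_comparison)
  then show ?thesis by (rule LIM_zero_cancel)
qed

section \<open>Taylor terms are entire\<close>

lemma has_derivative_quadratic:
  fixes f :: "'a::real_normed_vector \<Rightarrow> 'b::real_normed_vector"
  assumes D: "bounded_linear D" and d: "0 < d"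
    and le: "\<And>h. norm h < d \<Longrightarrow> norm (f (x + h) - f x - D h) \<le> C * (norm h)\<^sup>2"
  shows "(f has_derivative D) (at x)"
  unfolding has_derivative_at
proof
  have "((\<lambda>h. C * norm h) \<longlongrightarrow> C * norm (0 :: 'a)) (at (0 :: 'a))"
    by (intro tendsto_mult_left) (rule tendsto_norm[OF tendsto_ident_at])
  then have "((\<lambda>h. C * norm h) \<longlongrightarrow> 0) (at (0 :: 'a))" by simp
  moreover have "\<forall>\<^sub>F h in at 0. norm (norm (f (x + h) - f x - D h) / norm h) \<le> C * norm h"
    unfolding eventually_at
    using d le by (auto simp: dist_norm divide_le_eq power2_eq_square mult.assoc intro!: exI[of _ d])
  ultimately show "(\<lambda>h. norm (f (x + h) - f x - D h) / norm h) \<midarrow>0\<rightarrow> 0"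
    by (rule Lim_null_comparison[rotated])
qed (rule D)

context
  fixes f :: "'e::complex_banach \<Rightarrow> 'b::complex_banach" and U F and y :: 'e and r M :: real and D
  assumes f: "f \<in> holomorphic_maps U F" and r: "0 < r"
    and bound: "\<And>z. norm (z - y) \<le> r \<Longrightarrow> z \<in> U \<and> norm (f z) \<le> M"
    and D: "clinear D" "(f has_derivative D) (at y)"
begin

text \<open>On the complex line through \<open>y\<close> in direction \<open>h\<close> the map is
  bounded by \<open>M\<close> on the disc of radius \<open>R = r / norm h\<close>. The first
  coefficient bounds \<open>D h\<close>, the tail after two coefficients bounds the remainder;
  \<open>2 * norm h \<le> r\<close> means \<open>R \<ge> 2\<close>, whence
  \<open>R / (R - 1) \<le> 2\<close>, the factor 2 in the estimate.\<close>

lemma derivative_and_remainder_le: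
  shows norm_derivative_le: "norm (D h) \<le> M / r * norm h"
    and norm_second_order_remainder_le:
      "2 * norm h \<le> r \<Longrightarrow> norm (f (y + h) - f y - D h) \<le> 2 * M / r\<^sup>2 * (norm h)\<^sup>2"
proof -
  have "norm (D h) \<le> M / r * norm h \<and>
    (2 * norm h \<le> r \<longrightarrow> norm (f (y + h) - f y - D h) \<le> 2 * M / r\<^sup>2 * (norm h)\<^sup>2)"
  proof (cases "h = 0")
    case True
    then show ?thesis using linear_0[OF clinear_imp_linear[OF D(1)]] by simp
  next
    case False
    define R where "R = r / norm h"
    have R: "0 < R" using r False by (simp add: R_def)
    have M: "0 \<le> M" using bound[of y] r order_trans[OF norm_ge_zero, of "f y" M] by simp
    have in_U: "y + scaleC \<zeta> h \<in> U \<and> norm (f (y + scaleC \<zeta> h)) \<le> M" if "\<zeta> \<in> cball 0 R" for \<zeta>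
      using that False by (intro bound) (simp add: norm_scaleC R_def field_simps)
    have both: "cmod (\<phi> (D h)) \<le> M / R"
      "2 \<le> R \<Longrightarrow> cmod (\<phi> (f (y + h) - f y - D h)) \<le> 2 * M / R\<^sup>2"
      if \<phi>: "norm_le_one_functional \<phi>" for \<phi> :: "'b \<Rightarrow> complex"
    proof -
      define g where "g \<zeta> = \<phi> (f (y + scaleC \<zeta> h))" for \<zeta>
      have g: "g holomorphic_on {\<zeta>. y + scaleC \<zeta> h \<in> U}"
        using holomorphic_along_line[OF f \<phi>] by (simp add: g_def[abs_def])
      have S: "cball 0 R \<subseteq> {\<zeta>. y + scaleC \<zeta> h \<in> U}" using in_U by blast
      have gM: "cmod (g \<zeta>) \<le> M" if "\<zeta> \<in> cball 0 R" for \<zeta>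
        using order_trans[OF functional_le[OF \<phi>]] in_U[OF that] by (simp add: g_def)
      have "deriv g 0 = \<phi> (D h)"
        using has_field_derivative_along_line[OF D(1) _ \<phi>, of f y 0 h] D(2)
        by (simp add: g_def[abs_def] DERIV_imp_deriv)
      moreover have "cmod ((deriv ^^ 1) g 0 / fact 1) \<le> M / R ^ 1"
        by (rule taylor_coefficient_le[OF g S R gM])
      ultimately show "cmod (\<phi> (D h)) \<le> M / R" by simp
      assume R2: "2 \<le> R"
      have "cmod (g 1 - (\<Sum>k<2. (deriv ^^ k) g 0 / fact k)) \<le> M / R ^ 2 * (R / (R - 1))"
        using R2 by (intro taylor_remainder_le[OF g S _ gM]) auto
      also have "\<dots> \<le> M / R ^ 2 * 2"
        using M R2 by (intro mult_left_mono) (auto simp: field_simps)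
      also have "g 1 - (\<Sum>k<2. (deriv ^^ k) g 0 / fact k) = \<phi> (f (y + h) - f y - D h)"
        using \<open>deriv g 0 = \<phi> (D h)\<close> linear_diff[OF bounded_linear.linear[OF functional_bounded_linear[OF \<phi>]]]
        by (simp add: numeral_2_eq_2 g_def)
      finally show "cmod (\<phi> (f (y + h) - f y - D h)) \<le> 2 * M / R\<^sup>2" by (simp add: mult.commute)
    qed
    have "norm (D h) \<le> M / R" by (rule norm_le_if_functionals_le) (rule both(1))
    moreover have "norm (f (y + h) - f y - D h) \<le> 2 * M / R\<^sup>2" if "2 * norm h \<le> r"
    proof (rule norm_le_if_functionals_le)
      show "cmod (\<phi> (f (y + h) - f y - D h)) \<le> 2 * M / R\<^sup>2"
        if "norm_le_one_functional \<phi>" for \<phi> :: "'b \<Rightarrow> complex"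
        using that \<open>2 * norm h \<le> r\<close> False by (intro both(2)) (auto simp: R_def le_divide_eq)
    qed
    ultimately show ?thesis
      using False by (simp add: R_def power_divide)
  qed
  then show "norm (D h) \<le> M / r * norm h"
    "2 * norm h \<le> r \<Longrightarrow> norm (f (y + h) - f y - D h) \<le> 2 * M / r\<^sup>2 * (norm h)\<^sup>2" by blast+
qed

end

context
  fixes f :: "'e::complex_banach \<Rightarrow> 'b::complex_banach" and U F and \<rho> M :: real and D
  assumes f: "f \<in> holomorphic_maps U F" and \<rho>: "0 < \<rho>"
    and bound: "\<And>z. norm z \<le> 2 * \<rho> \<Longrightarrow> z \<in> U \<and> norm (f z) \<le> M"
    and D: "\<And>y. norm y \<le> \<rho> \<Longrightarrow> clinear (D y) \<and> (f has_derivative D y) (at y)"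
begin

text \<open>The reason for a bound on radius \<open>2 * \<rho>\<close>: it leaves a ball of radius
  \<open>\<rho>\<close> about every centre \<open>y\<close> of norm at most \<open>\<rho>\<close>,
  so the Cauchy estimates are uniform in \<open>y\<close>.\<close>

lemma bound_near: "norm y \<le> \<rho> \<Longrightarrow> norm (z - y) \<le> \<rho> \<Longrightarrow> z \<in> U \<and> norm (f z) \<le> M"
  using norm_triangle_sub[of z y] by (intro bound) simp

lemma norm_directional_derivative_le: "norm y \<le> \<rho> \<Longrightarrow> norm (D y h) \<le> M / \<rho> * norm h"
  using D[of y] by (intro norm_derivative_le[OF f \<rho>, where y = y] bound_near) auto

lemma directional_remainder_le:
  "norm y \<le> \<rho> \<Longrightarrow> 2 * norm h \<le> \<rho> \<Longrightarrow>
    norm (f (y + h) - f y - D y h) \<le> 2 * M / \<rho>\<^sup>2 * (norm h)\<^sup>2"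
  using D[of y] by (intro norm_second_order_remainder_le[OF f \<rho>, where y = y] bound_near) auto

text \<open>Holomorphy is assumed point by point, but integrating derivatives over a circle needs
  continuity of \<open>D y h\<close> in \<open>y\<close>. It holds because the quadratic remainder
  makes the difference quotients converge uniformly.\<close>

lemma continuous_on_directional_derivative: "continuous_on (cball 0 \<rho>) (\<lambda>y. D y h)"
proof (rule uniform_limit_theorem)
  define s where "s n = 1 / real (Suc n)" for n
  have s: "s \<longlonglongrightarrow> 0" unfolding s_def[abs_def] by (rule LIMSEQ_Suc[OF lim_1_over_n])
  have s0: "0 < s n" for n by (simp add: s_def)
  have "(\<lambda>n. 2 * norm (s n *\<^sub>R h)) \<longlonglongrightarrow> 2 * norm (0 *\<^sub>R h)"
    by (intro tendsto_intros s)
  then have small: "\<forall>\<^sub>F n in sequentially. 2 * norm (s n *\<^sub>R h) < \<rho>"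
    using \<rho> by (intro order_tendstoD(2)) auto
  show "\<forall>\<^sub>F n in sequentially. continuous_on (cball 0 \<rho>)
      (\<lambda>y. (1 / s n) *\<^sub>R (f (y + s n *\<^sub>R h) - f y))"
    using small
  proof eventually_elim
    case (elim n)
    have "norm (y + s n *\<^sub>R h) \<le> 2 * \<rho>" if "norm y \<le> \<rho>" for y
      using norm_triangle_ineq[of y "s n *\<^sub>R h"] elim that \<rho> by simp
    then show ?case
      using bound \<rho> by (intro continuous_intros
          continuous_on_compose2[OF holomorphic_maps_continuous_on[OF f]]) auto
  qed
  show "uniform_limit (cball 0 \<rho>) (\<lambda>n y. (1 / s n) *\<^sub>R (f (y + s n *\<^sub>R h) - f y)) (\<lambda>y. D y h) sequentially"
    unfolding uniform_limit_iff
  proof (intro allI impI)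
    fix e :: real assume "0 < e"
    have "(\<lambda>n. 2 * M / \<rho>\<^sup>2 * (norm h)\<^sup>2 * s n) \<longlonglongrightarrow> 2 * M / \<rho>\<^sup>2 * (norm h)\<^sup>2 * 0"
      by (intro tendsto_intros s)
    then have "\<forall>\<^sub>F n in sequentially. 2 * M / \<rho>\<^sup>2 * (norm h)\<^sup>2 * s n < e"
      using \<open>0 < e\<close> by (intro order_tendstoD(2)) auto
    with small show "\<forall>\<^sub>F n in sequentially. \<forall>y\<in>cball 0 \<rho>.
        dist ((1 / s n) *\<^sub>R (f (y + s n *\<^sub>R h) - f y)) (D y h) < e"
    proof eventually_elim
      case (elim n)
      show ?case
      proof
        fix y :: 'e assume "y \<in> cball 0 \<rho>"
        then have y: "norm y \<le> \<rho>" by simp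
        have "D y (s n *\<^sub>R h) = s n *\<^sub>R D y h"
          using D[OF y] by (simp add: linear_cmul clinear_imp_linear)
        then have "(1 / s n) *\<^sub>R (f (y + s n *\<^sub>R h) - f y) - D y h =
            (1 / s n) *\<^sub>R (f (y + s n *\<^sub>R h) - f y - D y (s n *\<^sub>R h))"
          using s0[of n] by (simp add: scaleR_diff_right)
        also have "norm \<dots> \<le> (1 / s n) * (2 * M / \<rho>\<^sup>2 * (norm (s n *\<^sub>R h))\<^sup>2)"
          unfolding norm_scaleR[of "1 / s n"]
          using directional_remainder_le[OF y, of "s n *\<^sub>R h"] elim(1) s0[of n]
          by (intro mult_mono) auto
        also have "\<dots> = 2 * M / \<rho>\<^sup>2 * (norm h)\<^sup>2 * s n"
          using s0[of n] by (simp add: power2_eq_square field_simps)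
        finally show "dist ((1 / s n) *\<^sub>R (f (y + s n *\<^sub>R h) - f y)) (D y h) < e"
          using elim(2) by (simp add: dist_norm)
      qed
    qed
  qed
qed simp

text \<open>Differentiation under the integral: the uniform quadratic remainder of \<open>f\<close>
  on the circle integrates to one for \<open>taylor_term f k\<close>, with the integral
  \<open>D'\<close> of the derivatives as candidate.\<close>

lemma taylor_term_has_derivative:
  assumes x: "norm x \<le> \<rho>"
  shows "\<exists>D'. clinear D' \<and> (taylor_term f k has_derivative D') (at x)"
proof -
  define e where "e t = cis (2 * pi * t)" for t
  define c where "c t = cis (- (2 * pi * t)) ^ k" for t
  define D' where "D' h = integral {0..1} (\<lambda>t. scaleC (c t) (D (scaleC (e t) x) (scaleC (e t) h)))" for h
  have e1: "cmod (e t) = 1" and c1: "cmod (c t) = 1" for t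
    by (simp_all add: e_def c_def norm_power)
  have ex: "norm (scaleC (e t) x) \<le> \<rho>" for t using x by (simp add: norm_scaleC e1)
  note Dex = D[OF ex, THEN conjunct1]
  \<comment> \<open>Taking the scalar out leaves the fixed direction \<open>h\<close>, for which
    continuity in the base point is known.\<close>
  have De: "D (scaleC (e t) x) (scaleC (e t) h) = scaleC (e t) (D (scaleC (e t) x) h)" for t h
    using Dex[of t] by (simp add: clinear_iff)
  have cont: "continuous_on {0..1} (\<lambda>t. scaleC (c t) (D (scaleC (e t) x) (scaleC (e t) h)))" for h
    unfolding De unfolding c_def e_def using ex
    by (intro continuous_intros continuous_on_compose2[OF continuous_on_directional_derivative])
      (auto simp: e_def)
  then have int: "(\<lambda>t. scaleC (c t) (D (scaleC (e t) x) (scaleC (e t) h))) integrable_on {0..1}" for h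
    by (rule integrable_continuous_real)
  have "clinear D'"
    unfolding clinear_iff
  proof (intro conjI allI)
    show "D' (h + k) = D' h + D' k" for h k
      unfolding D'_def integral_add[OF int int, symmetric]
      using Dex by (intro integral_cong) (simp add: clinear_iff scaleC_add_right)
    show "D' (scaleC a h) = scaleC a (D' h)" for a h
    proof -
      have "scaleC (c t) (D (scaleC (e t) x) (scaleC (e t) (scaleC a h))) =
          scaleC a (scaleC (c t) (D (scaleC (e t) x) (scaleC (e t) h)))" for t
        unfolding De using Dex[of t]
        by (simp add: clinear_iff complex_vs.scale_scale mult_ac)
      then have "D' (scaleC a h) = integral {0..1}
          (scaleC a \<circ> (\<lambda>t. scaleC (c t) (D (scaleC (e t) x) (scaleC (e t) h))))"
        by (simp add: D'_def o_def)
      also have "\<dots> = scaleC a (D' h)"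
        unfolding D'_def by (rule integral_linear[OF int bounded_linear_scaleC_right])
      finally show ?thesis .
    qed
  qed
  have "norm (D' h) \<le> norm h * (M / \<rho>)" for h
  proof -
    have "norm (D (scaleC (e t) x) (scaleC (e t) h)) \<le> M / \<rho> * norm h" for t
      using norm_directional_derivative_le[OF ex, of t "scaleC (e t) h"] by (simp add: norm_scaleC e1)
    then have "norm (D' h) \<le> M / \<rho> * norm h * (1 - 0)"
      unfolding D'_def by (intro integral_bound cont) (simp_all add: norm_scaleC c1)
    then show ?thesis by (simp add: mult.commute)
  qed
  then have "bounded_linear D'"
    using linear_add[OF clinear_imp_linear[OF \<open>clinear D'\<close>]]
      linear_cmul[OF clinear_imp_linear[OF \<open>clinear D'\<close>]]
    by (intro bounded_linear_intro)
  moreover have "norm (taylor_term f k (x + h) - taylor_term f k x - D' h) \<le> 2 * M / \<rho>\<^sup>2 * (norm h)\<^sup>2"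
    if h: "norm h < \<rho> / 2" for h
  proof -
    have U: "scaleC \<zeta> (x + h) \<in> U" "scaleC \<zeta> x \<in> U" if "cmod \<zeta> = 1" for \<zeta>
      using that x h \<rho> norm_triangle_ineq[of x h] bound[of "scaleC \<zeta> (x + h)"] bound[of "scaleC \<zeta> x"]
      by (simp_all add: norm_scaleC)
    have rem: "norm (f (scaleC (e t) (x + h)) - f (scaleC (e t) x) - D (scaleC (e t) x) (scaleC (e t) h))
        \<le> 2 * M / \<rho>\<^sup>2 * (norm h)\<^sup>2" for t
      using directional_remainder_le[OF ex, of "scaleC (e t) h"] h
      by (simp add: norm_scaleC e1 scaleC_add_right)
    note contf = continuous_on_circle[OF holomorphic_maps_continuous_on[OF f], where k = k, folded c_def e_def]
    note intf = taylor_term_integrable[OF f, where k = k, folded c_def e_def]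
    have int1: "(\<lambda>t. scaleC (c t) (f (scaleC (e t) (x + h)))) integrable_on {0..1}"
      by (rule intf) (rule U(1))
    have int2: "(\<lambda>t. scaleC (c t) (f (scaleC (e t) x))) integrable_on {0..1}"
      by (rule intf) (rule U(2))
    have "taylor_term f k (x + h) - taylor_term f k x - D' h = integral {0..1} (\<lambda>t.
        scaleC (c t) (f (scaleC (e t) (x + h))) - scaleC (c t) (f (scaleC (e t) x)) -
        scaleC (c t) (D (scaleC (e t) x) (scaleC (e t) h)))"
      unfolding taylor_term_def D'_def c_def[symmetric] e_def[symmetric]
      by (simp add: integral_diff int1 int2 int integrable_diff)
    also have "norm \<dots> \<le> 2 * M / \<rho>\<^sup>2 * (norm h)\<^sup>2 * (1 - 0)"
    proof (rule integral_bound)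
      show "continuous_on {0..1} (\<lambda>t.
        scaleC (c t) (f (scaleC (e t) (x + h))) - scaleC (c t) (f (scaleC (e t) x)) -
        scaleC (c t) (D (scaleC (e t) x) (scaleC (e t) h)))"
        using U by (intro continuous_on_diff contf cont)
      show "norm (scaleC (c t) (f (scaleC (e t) (x + h))) - scaleC (c t) (f (scaleC (e t) x)) -
        scaleC (c t) (D (scaleC (e t) x) (scaleC (e t) h))) \<le> 2 * M / \<rho>\<^sup>2 * (norm h)\<^sup>2" for t
        using rem[of t]
        by (simp add: norm_scaleC c1 flip: complex_vs.scale_right_diff_distrib)
    qed simp
    finally show ?thesis by simp
  qed
  ultimately have "(taylor_term f k has_derivative D') (at x)"
    using \<rho> by (intro has_derivative_quadratic[where d = "\<rho> / 2" and C = "2 * M / \<rho>\<^sup>2"]) auto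
  with \<open>clinear D'\<close> show ?thesis by blast
qed

end

text \<open>The Taylor terms of a map on \<open>U\<close> are restrictions of homogeneous polynomials on the whole
  space; all that matters later is that these are entire and positively homogeneous.\<close>

lemma taylor_term_extension:
  fixes U :: "'e::complex_banach set"
  assumes f: "f \<in> holomorphic_maps U F" and F: "banach_subspace F"
    and U: "open U" "balanced U" "U \<noteq> {}"
  obtains P where "P \<in> holomorphic_maps UNIV F" "\<And>x. x \<in> U \<Longrightarrow> P x = taylor_term f k x"
    "\<And>c x. 0 \<le> c \<Longrightarrow> P (c *\<^sub>R x) = c ^ k *\<^sub>R P x"
proof -
  have U1: "scaleC \<zeta> x \<in> U" if "x \<in> U" "cmod \<zeta> \<le> 1" for x \<zeta>
    using U(2) that by (auto simp: balanced_def)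
  have hom: "taylor_term f k (s *\<^sub>R x) = s ^ k *\<^sub>R taylor_term f k x" if "x \<in> U" "0 \<le> s" "s \<le> 1" for x s
    using taylor_term_scaleC[OF f U(1) U1, of x "complex_of_real s" k] that
    by (simp add: scaleC_complex_of_real flip: of_real_power)
  have 0: "0 \<in> U" using U(3) U1[of _ 0] by auto
  have "isCont f 0"
    using holomorphic_mapsD[OF f 0] has_derivative_continuous by metis
  then obtain d where d: "0 < d" "\<And>z. norm z < d \<Longrightarrow> norm (f z - f 0) < 1"
    unfolding continuous_at_eps_delta by (metis dist_norm diff_zero zero_less_one)
  obtain u where u: "0 < u" "ball 0 u \<subseteq> U" using U(1) 0 by (meson openE)
  \<comment> \<open>Chosen so that \<open>2 * \<rho>\<close> stays below both \<open>d\<close> and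
    \<open>u\<close>.\<close>
  define \<rho> where "\<rho> = min d u / 4"
  have \<rho>: "0 < \<rho>" using d(1) u(1) by (simp add: \<rho>_def)
  have bound: "z \<in> U \<and> norm (f z) \<le> norm (f 0) + 1" if "norm z \<le> 2 * \<rho>" for z
  proof
    have z: "norm z < d" "norm z < u" using that \<rho> by (auto simp: \<rho>_def)
    show "z \<in> U" using z(2) u(2) by auto
    show "norm (f z) \<le> norm (f 0) + 1"
      using d(2)[OF z(1)] norm_triangle_sub[of "f z" "f 0"] by simp
  qed
  have "\<exists>D. clinear D \<and> (f has_derivative D) (at y)" if "norm y \<le> \<rho>" for y
    using f bound[of y] that \<rho> by (auto simp: holomorphic_maps_def)
  then obtain D where D: "\<And>y. norm y \<le> \<rho> \<Longrightarrow> clinear (D y) \<and> (f has_derivative D y) (at y)"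
    by metis
  have deriv: "\<exists>D'. clinear D' \<and> (taylor_term f k has_derivative D') (at x)" if "norm x \<le> \<rho>" for x
    by (rule taylor_term_has_derivative[OF f \<rho> _ _ that]) (fact bound, fact D)
  \<comment> \<open>With \<open>norm x + 1\<close> in place of \<open>norm x\<close> the scale is
    positive at 0 too, and it sends all points within distance 1 of \<open>x\<close> into the small
    ball, so that one scale serves a whole neighbourhood.\<close>
  define s where "s x = \<rho> / (norm x + 1)" for x :: 'e
  have s0: "0 < s x" for x using \<rho> by (simp add: s_def add_nonneg_pos)
  have small: "norm (s x *\<^sub>R y) \<le> \<rho>" if "norm y \<le> norm x + 1" for x y
  proof -
    have "norm y / (norm x + 1) \<le> 1" using that by (simp add: divide_le_eq add_nonneg_pos)
    then have "\<rho> * (norm y / (norm x + 1)) \<le> \<rho> * 1" using \<rho> by (intro mult_left_mono) auto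
    then show ?thesis using \<rho> by (simp add: s_def)
  qed
  have small_U: "norm z \<le> \<rho> \<Longrightarrow> z \<in> U" for z using bound[of z] \<rho> by simp
  define P where "P x = (1 / s x) ^ k *\<^sub>R taylor_term f k (s x *\<^sub>R x)" for x
  have P_eq: "P x = (1 / c) ^ k *\<^sub>R taylor_term f k (c *\<^sub>R x)" if "0 < c" "c *\<^sub>R x \<in> U" for c x
  proof -
    have cmp: "(1 / a) ^ k *\<^sub>R taylor_term f k (a *\<^sub>R x) = (1 / b) ^ k *\<^sub>R taylor_term f k (b *\<^sub>R x)"
      if "0 < a" "a \<le> b" "b *\<^sub>R x \<in> U" for a b
      using hom[OF that(3), of "a / b"] that by (simp add: power_divide)
    show ?thesis
    proof (cases "s x \<le> c")
      case True
      from cmp[OF s0 this that(2)] show ?thesis by (simp only: P_def)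
    next
      case False
      then have "c \<le> s x" by simp
      from cmp[OF that(1) this] small_U[OF small[of x x]] show ?thesis by (simp only: P_def)
    qed
  qed
  show ?thesis
  proof
    show "P x = taylor_term f k x" if "x \<in> U" for x
      using P_eq[of 1 x] that by simp
    show "P (c *\<^sub>R x) = c ^ k *\<^sub>R P x" if "0 \<le> c" for c x
    proof (cases "c = 0")
      case True
      \<comment> \<open>Scaling by 0 inside \<open>U\<close>: for \<open>k = 0\<close> this says
        that \<open>P\<close> is constant, for \<open>k > 0\<close> that it vanishes at 0.\<close>
      have "P 0 = (1 / s 0) ^ k *\<^sub>R 0 ^ k *\<^sub>R taylor_term f k (s x *\<^sub>R x)"
        using hom[OF small_U[OF small[of x x]], of 0] by (simp add: P_def)
      with True show ?thesis by (cases k) (simp_all add: P_def)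
    next
      case False
      with that have c: "0 < c" by simp
      have "P (c *\<^sub>R x) = (1 / (s x / c)) ^ k *\<^sub>R taylor_term f k ((s x / c) *\<^sub>R c *\<^sub>R x)"
        using small_U[OF small[of x x]] s0[of x] c by (intro P_eq) auto
      then show ?thesis using c by (simp add: P_def power_divide)
    qed
    show "P \<in> holomorphic_maps UNIV F"
      unfolding holomorphic_maps_def
    proof (intro CollectI conjI ballI)
      have "taylor_term f k (s x *\<^sub>R x) \<in> F" for x
        using U1[OF small_U[OF small[of x x]]] by (intro taylor_term_in_subspace[OF f F]) auto
      then show "P ` UNIV \<subseteq> F"
        using F by (auto simp: P_def banach_subspace_def complex_vs.subspace_def scaleR_scaleC)
      fix x
      obtain D' where D': "clinear D'" "(taylor_term f k has_derivative D') (at (s x *\<^sub>R x))"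
        using deriv[OF small[of x x]] by auto
      have "((\<lambda>y. s x *\<^sub>R y) has_derivative (\<lambda>h. s x *\<^sub>R h)) (at x)"
        by (rule has_derivative_scaleR_right[OF has_derivative_ident])
      then have "((\<lambda>y. taylor_term f k (s x *\<^sub>R y)) has_derivative (\<lambda>h. D' (s x *\<^sub>R h))) (at x)"
        by (rule has_derivative_compose[where g = "taylor_term f k"]) (rule D'(2))
      then have "((\<lambda>y. (1 / s x) ^ k *\<^sub>R taylor_term f k (s x *\<^sub>R y)) has_derivative
          (\<lambda>h. (1 / s x) ^ k *\<^sub>R D' (s x *\<^sub>R h))) (at x)"
        by (rule has_derivative_scaleR_right)
      \<comment> \<open>Near \<open>x\<close> the scale \<open>s x\<close> may be kept fixed, so
        \<open>P\<close> is locally a multiple of a differentiable map composed with a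
        dilation.\<close>
      moreover have "\<forall>\<^sub>F y in at x. (1 / s x) ^ k *\<^sub>R taylor_term f k (s x *\<^sub>R y) = P y"
      proof -
        have "norm y \<le> norm x + 1" if "dist y x < 1" for y
          using that norm_triangle_sub[of y x] by (simp add: dist_norm)
        then have "(1 / s x) ^ k *\<^sub>R taylor_term f k (s x *\<^sub>R y) = P y" if "dist y x < 1" for y
          using P_eq[OF s0[of x] small_U[OF small[of y x]]] that by simp
        then show ?thesis
          unfolding eventually_at using zero_less_one by blast
      qed
      ultimately have "(P has_derivative (\<lambda>h. (1 / s x) ^ k *\<^sub>R D' (s x *\<^sub>R h))) (at x)"
        by (rule has_derivative_transform_eventually) (simp_all add: P_def)
      moreover have "clinear (\<lambda>h. (1 / s x) ^ k *\<^sub>R D' (s x *\<^sub>R h))"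
        using D'(1) linear_cmul[OF clinear_imp_linear[OF D'(1)]]
        by (simp add: clinear_iff scaleC_scaleR scaleR_add_right scaleC_add_right)
      ultimately show "\<exists>D. clinear D \<and> (P has_derivative D) (at x)" by blast
    qed
  qed
qed

section \<open>Closures in the seminorm topologies\<close>

text \<open>The balls that generate the topology have arbitrary centres and form only a subbasis.
  \<open>triangle\<close> moves a centre to \<open>f\<close> and \<open>directed\<close> merges two
  seminorms, so single balls about \<open>f\<close> suffice. Apart from \<open>zero\<close>, the
  hypotheses on seminorms concern differences of members of \<open>X\<close>, where the suprema in
  the applications are finite.\<close>

lemma in_closure_of_seminorm_topology:
  assumes "S \<subseteq> X" and f: "f \<in> X" and "\<P> \<noteq> {}"
    and zero: "\<And>p. p \<in> \<P> \<Longrightarrow> p (\<lambda>_. 0) = 0"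
    and triangle: "\<And>p g h. p \<in> \<P> \<Longrightarrow> g \<in> X \<Longrightarrow> h \<in> X \<Longrightarrow>
      p (\<lambda>x. g x - h x) \<le> p (\<lambda>x. g x - f x) + p (\<lambda>x. f x - h x)"
    and directed: "\<And>p q. p \<in> \<P> \<Longrightarrow> q \<in> \<P> \<Longrightarrow>
      \<exists>r\<in>\<P>. \<forall>g\<in>X. p (\<lambda>x. g x - f x) \<le> r (\<lambda>x. g x - f x) \<and> q (\<lambda>x. g x - f x) \<le> r (\<lambda>x. g x - f x)"
  shows "f \<in> seminorm_topology X \<P> closure_of S \<longleftrightarrow>
    (\<forall>p\<in>\<P>. \<forall>\<epsilon>>0. \<exists>g\<in>S. p (\<lambda>x. g x - f x) < \<epsilon>)"
proof
  define \<B> where "\<B> = {{g \<in> X. p (\<lambda>x. g x - h x) < \<epsilon>} | p h \<epsilon>. p \<in> \<P> \<and> h \<in> X \<and> 0 < \<epsilon>}"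
  have top: "seminorm_topology X \<P> = topology_generated_by \<B>"
    by (simp add: seminorm_topology_def \<B>_def)
  have nbhd: "{g \<in> X. p (\<lambda>x. g x - f x) < \<epsilon>} \<in> \<B>" "f \<in> {g \<in> X. p (\<lambda>x. g x - f x) < \<epsilon>}"
    if "p \<in> \<P>" "0 < \<epsilon>" for p \<epsilon>
    using that f zero[OF that(1)] by (auto simp: \<B>_def)
  {
    assume cl: "f \<in> seminorm_topology X \<P> closure_of S"
    show "\<forall>p\<in>\<P>. \<forall>\<epsilon>>0. \<exists>g\<in>S. p (\<lambda>x. g x - f x) < \<epsilon>"
    proof (intro ballI allI impI)
      fix p and \<epsilon> :: real assume p: "p \<in> \<P>" "0 < \<epsilon>"
      have "openin (topology_generated_by \<B>) {g \<in> X. p (\<lambda>x. g x - f x) < \<epsilon>}"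
        by (rule topology_generated_by_Basis[OF nbhd(1)[OF p]])
      with nbhd(2)[OF p] have "\<exists>g. g \<in> S \<and> g \<in> {g \<in> X. p (\<lambda>x. g x - f x) < \<epsilon>}"
        using cl unfolding top in_closure_of
        by (elim conjE allE[of _ "{g \<in> X. p (\<lambda>x. g x - f x) < \<epsilon>}"]) (erule mp, intro conjI)
      then show "\<exists>g\<in>S. p (\<lambda>x. g x - f x) < \<epsilon>" by auto
    qed
  next
    assume approx: "\<forall>p\<in>\<P>. \<forall>\<epsilon>>0. \<exists>g\<in>S. p (\<lambda>x. g x - f x) < \<epsilon>"
    obtain p\<^sub>0 where p\<^sub>0: "p\<^sub>0 \<in> \<P>" using \<open>\<P> \<noteq> {}\<close> by blast
    \<comment> \<open>Induction on the generation of open sets: each one containing \<open>f\<close>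
      contains a single ball about \<open>f\<close>.\<close>
    have base: "f \<in> T \<Longrightarrow> \<exists>p\<in>\<P>. \<exists>\<epsilon>>0. \<forall>g\<in>X. p (\<lambda>x. g x - f x) < \<epsilon> \<longrightarrow> g \<in> T"
      if "generate_topology_on \<B> T" for T
      using that
    proof induction
      case (Int a b)
      then have "f \<in> a" "f \<in> b" by auto
      from Int.IH(1)[OF this(1)] obtain p d where
        p: "p \<in> \<P>" "0 < d" "\<forall>g\<in>X. p (\<lambda>x. g x - f x) < d \<longrightarrow> g \<in> a"
        by (elim bexE exE conjE)
      from Int.IH(2)[OF \<open>f \<in> b\<close>] obtain q e where
        q: "q \<in> \<P>" "0 < e" "\<forall>g\<in>X. q (\<lambda>x. g x - f x) < e \<longrightarrow> g \<in> b"
        by (elim bexE exE conjE)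
      obtain r where r: "r \<in> \<P>" "\<forall>g\<in>X. p (\<lambda>x. g x - f x) \<le> r (\<lambda>x. g x - f x) \<and>
          q (\<lambda>x. g x - f x) \<le> r (\<lambda>x. g x - f x)"
        using directed[OF p(1) q(1)] by (rule bexE)
      have "g \<in> a \<inter> b" if "g \<in> X" "r (\<lambda>x. g x - f x) < min d e" for g
      proof -
        have "p (\<lambda>x. g x - f x) < d" "q (\<lambda>x. g x - f x) < e"
          using bspec[OF r(2) that(1)] that(2) by linarith+
        then show ?thesis using p(3) q(3) that(1) by simp
      qed
      with r(1) p(2) q(2) show ?case by (intro bexI[of _ r] exI[of _ "min d e"]) auto
    next
      case (UN K)
      then obtain k where k: "k \<in> K" "f \<in> k" by blast
      from UN.IH[OF k] obtain p e where
        "p \<in> \<P>" "0 < e" "\<forall>g\<in>X. p (\<lambda>x. g x - f x) < e \<longrightarrow> g \<in> k"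
        by (elim bexE exE conjE)
      then show ?case using k(1) by (intro bexI[of _ p] exI[of _ e]) auto
    next
      case (Basis T)
      then obtain p h \<epsilon> where T: "T = {g \<in> X. p (\<lambda>x. g x - h x) < \<epsilon>}" "p \<in> \<P>" "h \<in> X"
        by (auto simp: \<B>_def)
      have "g \<in> T" if "g \<in> X" "p (\<lambda>x. g x - f x) < \<epsilon> - p (\<lambda>x. f x - h x)" for g
        using triangle[OF T(2) that(1) T(3)] that by (simp add: T(1))
      moreover have "0 < \<epsilon> - p (\<lambda>x. f x - h x)" using Basis(2) by (simp add: T(1))
      ultimately show ?case
        using T(2) by (intro bexI[of _ p] exI[of _ "\<epsilon> - p (\<lambda>x. f x - h x)"]) auto
    qed simp
    show "f \<in> seminorm_topology X \<P> closure_of S"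
      unfolding in_closure_of top
    proof (intro conjI allI impI)
      show "f \<in> topspace (topology_generated_by \<B>)"
        unfolding topology_generated_by_topspace
        by (rule UnionI[OF nbhd(1)[OF p\<^sub>0 zero_less_one] nbhd(2)[OF p\<^sub>0 zero_less_one]])
      fix T assume T: "f \<in> T \<and> openin (topology_generated_by \<B>) T"
      from base[OF openin_topology_generated_by[OF conjunct2[OF T]] conjunct1[OF T]]
      obtain p where p: "p \<in> \<P>" and "\<exists>\<epsilon>>0. \<forall>g\<in>X. p (\<lambda>x. g x - f x) < \<epsilon> \<longrightarrow> g \<in> T"
        by (rule bexE)
      then obtain \<epsilon> where \<epsilon>: "0 < \<epsilon>" "\<forall>g\<in>X. p (\<lambda>x. g x - f x) < \<epsilon> \<longrightarrow> g \<in> T"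
        by (elim exE conjE)
      obtain g where g: "g \<in> S" "p (\<lambda>x. g x - f x) < \<epsilon>"
        using approx p \<epsilon>(1) by auto
      have "g \<in> T" using \<epsilon>(2) g \<open>S \<subseteq> X\<close> by auto
      with g(1) show "\<exists>y. y \<in> S \<and> y \<in> T" by blast
    qed
  }
qed

section \<open>Linear structure of the weighted spaces\<close>

lemma holomorphic_maps_add:
  assumes "banach_subspace F" "f \<in> holomorphic_maps U F" "g \<in> holomorphic_maps U F"
  shows "(\<lambda>x. f x + g x) \<in> holomorphic_maps U F"
  unfolding holomorphic_maps_def
proof (intro CollectI conjI ballI)
  show "(\<lambda>x. f x + g x) ` U \<subseteq> F"
    using assms
    by (simp add: holomorphic_maps_def banach_subspace_def complex_vs.subspace_def image_subset_iff)
  fix x assume x: "x \<in> U"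
  obtain D where D: "clinear D" "(f has_derivative D) (at x)" by (rule holomorphic_mapsD[OF assms(2) x])
  obtain D' where D': "clinear D'" "(g has_derivative D') (at x)" by (rule holomorphic_mapsD[OF assms(3) x])
  have "clinear (\<lambda>h. D h + D' h)"
    using D(1) D'(1) by (simp add: clinear_iff scaleC_add_right)
  moreover have "((\<lambda>x. f x + g x) has_derivative (\<lambda>h. D h + D' h)) (at x)"
    by (rule has_derivative_add[OF D(2) D'(2)])
  ultimately show "\<exists>D. clinear D \<and> ((\<lambda>x. f x + g x) has_derivative D) (at x)" by blast
qed

lemma holomorphic_maps_scaleR:
  assumes "banach_subspace F" "f \<in> holomorphic_maps U F"
  shows "(\<lambda>x. c *\<^sub>R f x) \<in> holomorphic_maps U F"
  unfolding holomorphic_maps_def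
proof (intro CollectI conjI ballI)
  show "(\<lambda>x. c *\<^sub>R f x) ` U \<subseteq> F"
    using assms by (auto simp: holomorphic_maps_def banach_subspace_def complex_vs.subspace_def scaleR_scaleC)
  fix x assume x: "x \<in> U"
  obtain D where D: "clinear D" "(f has_derivative D) (at x)" by (rule holomorphic_mapsD[OF assms(2) x])
  have "clinear (\<lambda>h. c *\<^sub>R D h)"
    using D(1) by (simp add: clinear_iff scaleC_scaleR scaleR_add_right)
  moreover have "((\<lambda>x. c *\<^sub>R f x) has_derivative (\<lambda>h. c *\<^sub>R D h)) (at x)"
    by (rule has_derivative_scaleR_right[OF D(2)])
  ultimately show "\<exists>D. clinear D \<and> ((\<lambda>x. c *\<^sub>R f x) has_derivative D) (at x)" by blast
qed

lemma holomorphic_maps_diff: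
  assumes "banach_subspace F" "f \<in> holomorphic_maps U F" "g \<in> holomorphic_maps U F"
  shows "(\<lambda>x. f x - g x) \<in> holomorphic_maps U F"
  using holomorphic_maps_add[OF assms(1,2) holomorphic_maps_scaleR[OF assms(1,3), of "-1"]]
  unfolding scaleR_minus1_left add_uminus_conv_diff .

lemma weight_on_pos: "weight_on U w \<Longrightarrow> x \<in> U \<Longrightarrow> 0 < w x"
  by (simp add: weight_on_def)

lemma HwE:
  assumes "f \<in> Hw U w F"
  obtains B where "f \<in> holomorphic_maps U F" "\<And>x. x \<in> U \<Longrightarrow> w x * norm (f x) \<le> B"
proof -
  obtain B where B: "\<forall>y\<in>(\<lambda>x. w x * norm (f x)) ` U. y \<le> B"
    using assms unfolding Hw_def bdd_above_def by blast
  show ?thesis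
  proof
    show "f \<in> holomorphic_maps U F" using assms by (simp add: Hw_def)
    show "w x * norm (f x) \<le> B" if "x \<in> U" for x using B that by simp
  qed
qed

lemma HwI:
  assumes "f \<in> holomorphic_maps U F" "\<And>x. x \<in> U \<Longrightarrow> w x * norm (f x) \<le> B"
  shows "f \<in> Hw U w F"
proof -
  have "bdd_above ((\<lambda>x. w x * norm (f x)) ` U)"
    by (rule bdd_aboveI2) (rule assms(2))
  with assms(1) show ?thesis by (simp add: Hw_def)
qed

lemma Hw_diff:
  assumes F: "banach_subspace F" and w: "weight_on U w" and f: "f \<in> Hw U w F" and g: "g \<in> Hw U w F"
  shows "(\<lambda>x. f x - g x) \<in> Hw U w F"
proof -
  obtain B where B: "f \<in> holomorphic_maps U F" "\<And>x. x \<in> U \<Longrightarrow> w x * norm (f x) \<le> B"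
    by (rule HwE[OF f]) blast
  obtain C where C: "g \<in> holomorphic_maps U F" "\<And>x. x \<in> U \<Longrightarrow> w x * norm (g x) \<le> C"
    by (rule HwE[OF g]) blast
  show ?thesis
  proof (rule HwI[OF holomorphic_maps_diff[OF F B(1) C(1)]])
    fix x assume x: "x \<in> U"
    have "w x * norm (f x - g x) \<le> w x * (norm (f x) + norm (g x))"
      using weight_on_pos[OF w x] by (intro mult_left_mono norm_triangle_ineq4) simp
    also have "\<dots> \<le> B + C" using B(2)[OF x] C(2)[OF x] by (simp add: distrib_left)
    finally show "w x * norm (f x - g x) \<le> B + C" .
  qed
qed

lemma HwcI:
  assumes f: "f \<in> holomorphic_maps U F" and w: "weight_on U w"
    and C: "compact C" "\<And>x. x \<in> U \<Longrightarrow> w x *\<^sub>R f x \<in> C"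
  shows "f \<in> Hwc U w F"
proof -
  obtain B where B: "\<And>y. y \<in> C \<Longrightarrow> norm y \<le> B"
    using compact_imp_bounded[OF C(1)] by (auto simp: bounded_iff)
  have "f \<in> Hw U w F"
    using f
  proof (rule HwI)
    fix x assume x: "x \<in> U"
    then show "w x * norm (f x) \<le> B"
      using B[OF C(2)[OF x]] weight_on_pos[OF w x] by simp
  qed
  moreover have "closure ((\<lambda>x. w x *\<^sub>R f x) ` U) \<subseteq> C"
    using C by (intro closure_minimal compact_imp_closed) auto
  then have "compact (closure ((\<lambda>x. w x *\<^sub>R f x) ` U))"
    using compact_Int_closed[OF C(1) closed_closure, of "(\<lambda>x. w x *\<^sub>R f x) ` U"]
    by (simp add: Int_absorb1)
  ultimately show ?thesis by (simp add: Hwc_def)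
qed

lemma HwcE:
  assumes "f \<in> Hwc U w F"
  obtains C where "f \<in> holomorphic_maps U F" "compact C" "\<And>x. x \<in> U \<Longrightarrow> w x *\<^sub>R f x \<in> C"
proof
  show "f \<in> holomorphic_maps U F" "compact (closure ((\<lambda>x. w x *\<^sub>R f x) ` U))"
    using assms by (simp_all add: Hwc_def Hw_def)
  show "w x *\<^sub>R f x \<in> closure ((\<lambda>x. w x *\<^sub>R f x) ` U)" if "x \<in> U" for x
    by (rule subsetD[OF closure_subset imageI[OF that]])
qed

lemma Hwc_add:
  assumes F: "banach_subspace F" and w: "weight_on U w" and f: "f \<in> Hwc U w F" and g: "g \<in> Hwc U w F"
  shows "(\<lambda>x. f x + g x) \<in> Hwc U w F"
proof -
  obtain B where B: "f \<in> holomorphic_maps U F" "compact B" "\<And>x. x \<in> U \<Longrightarrow> w x *\<^sub>R f x \<in> B"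
    by (rule HwcE[OF f]) blast
  obtain C where C: "g \<in> holomorphic_maps U F" "compact C" "\<And>x. x \<in> U \<Longrightarrow> w x *\<^sub>R g x \<in> C"
    by (rule HwcE[OF g]) blast
  show ?thesis
    using B C by (intro HwcI[OF holomorphic_maps_add[OF F] w compact_sums[of B C]])
      (auto simp: scaleR_add_right)
qed

lemma Hwc_scaleR:
  assumes F: "banach_subspace F" and w: "weight_on U w" and f: "f \<in> Hwc U w F"
  shows "(\<lambda>x. c *\<^sub>R f x) \<in> Hwc U w F"
proof -
  obtain B where B: "f \<in> holomorphic_maps U F" "compact B" "\<And>x. x \<in> U \<Longrightarrow> w x *\<^sub>R f x \<in> B"
    by (rule HwcE[OF f]) blast
  have "w x *\<^sub>R c *\<^sub>R f x \<in> (*\<^sub>R) c ` B" if "x \<in> U" for x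
    by (rule image_eqI[OF _ B(3)[OF that]]) (simp add: mult.commute)
  then show ?thesis
    by (rule HwcI[OF holomorphic_maps_scaleR[OF F B(1)] w compact_scaling[OF B(2)]])
qed

lemma Hwc_sum:
  assumes F: "banach_subspace F" and w: "weight_on U w"
    and f: "\<And>k. k \<in> I \<Longrightarrow> f k \<in> Hwc U w F"
  shows "(\<lambda>x. \<Sum>k\<in>I. f k x) \<in> Hwc U w F"
  using f
proof (induction I rule: infinite_finite_induct)
  case (insert i I)
  then show ?case using Hwc_add[OF F w, of "f i" "\<lambda>x. \<Sum>k\<in>I. f k x"] by simp
next
  have "(\<lambda>x. 0) \<in> Hwc U w F"
  proof (rule HwcI[OF _ w compact_sing[of 0]])
    show "(\<lambda>x. 0) \<in> holomorphic_maps U F"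
      using F has_derivative_const[of 0]
      by (auto simp: holomorphic_maps_def banach_subspace_def complex_vs.subspace_def clinear_iff
          intro!: exI[of _ "\<lambda>_. 0"])
  qed auto
  { case empty then show ?case using \<open>(\<lambda>x. 0) \<in> Hwc U w F\<close> by simp }
  { case (infinite I) then show ?case using \<open>(\<lambda>x. 0) \<in> Hwc U w F\<close> by simp }
qed

section \<open>The seminorms of \<open>tau_M\<close>\<close>

context
  fixes U :: "'e::complex_banach set" and w :: "'e \<Rightarrow> real" and \<alpha> :: "nat \<Rightarrow> real" and A :: "nat \<Rightarrow> 'e set"
  assumes w: "weight_on U w"
    and \<alpha>: "\<And>j. 0 \<le> \<alpha> j" "\<alpha> \<longlonglongrightarrow> 0"
    and A: "\<And>j. finite (A j)" "\<And>j. A j \<noteq> {}" "\<And>j. A j \<subseteq> U"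
begin

lemma norm_le_SUP: "y \<in> A j \<Longrightarrow> norm (h y) \<le> (SUP y\<in>A j. norm (h y :: 'b::real_normed_vector))"
  using A(1) by (intro cSUP_upper) auto

lemma INF_weight_le: "y \<in> A j \<Longrightarrow> (INF x\<in>A j. w x) \<le> w y"
  using A(1) by (intro cINF_lower) auto

lemma INF_weight_nonneg: "0 \<le> (INF x\<in>A j. w x)"
  using A(3)[of j] by (intro cINF_greatest A(2) less_imp_le weight_on_pos[OF w]) blast

lemma SUP_attained:
  obtains y where "y \<in> A j" "(SUP y\<in>A j. norm (h y :: 'b::real_normed_vector)) = norm (h y)"
proof -
  have "Max ((\<lambda>y. norm (h y)) ` A j) \<in> (\<lambda>y. norm (h y)) ` A j"
    using A by (intro Max_in) auto
  moreover have "(SUP y\<in>A j. norm (h y)) = Max ((\<lambda>y. norm (h y)) ` A j)"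
    using A by (intro cSup_eq_Max) auto
  ultimately show ?thesis using that by auto
qed

text \<open>The supremum of \<open>norm (h y)\<close> over the finite set is attained at some
  \<open>y\<close>, and the infimum of the weight is at most \<open>w y\<close>; pointwise weighted
  estimates are hence enough.\<close>

lemma seminorm_M_le:
  assumes "\<And>j y. y \<in> A j \<Longrightarrow> \<alpha> j * w y * norm (h y) \<le> c"
  shows "seminorm_M w \<alpha> A h \<le> c"
  unfolding seminorm_M_def
proof (rule cSUP_least)
  fix j
  obtain y where y: "y \<in> A j" "(SUP y\<in>A j. norm (h y)) = norm (h y)"
    by (rule SUP_attained)
  have "\<alpha> j * (INF x\<in>A j. w x) * norm (h y) \<le> \<alpha> j * w y * norm (h y)"
    using INF_weight_le[OF y(1)] \<alpha>(1)[of j] by (intro mult_right_mono mult_left_mono) auto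
  with assms[OF y(1)] show "\<alpha> j * (INF x\<in>A j. w x) * (SUP y\<in>A j. norm (h y)) \<le> c"
    unfolding y(2) by simp
qed simp

text \<open>Membership of \<open>h\<close> in the weighted space, together with the boundedness of
  \<open>\<alpha>\<close>, makes the supremum over \<open>j\<close> finite.\<close>

lemma le_seminorm_M:
  assumes h: "h \<in> Hw U w F"
  shows "\<alpha> j * (INF x\<in>A j. w x) * (SUP y\<in>A j. norm (h y)) \<le> seminorm_M w \<alpha> A h"
  unfolding seminorm_M_def
proof (rule cSUP_upper)
  obtain B where B: "\<And>x. x \<in> U \<Longrightarrow> w x * norm (h x) \<le> B" by (rule HwE[OF h]) blast
  obtain a where a: "\<And>j. \<alpha> j \<le> a"
    using convergent_imp_Bseq[OF convergentI[OF \<alpha>(2)]] \<alpha>(1) unfolding Bseq_def by auto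
  show "bdd_above (range (\<lambda>j. \<alpha> j * (INF x\<in>A j. w x) * (SUP y\<in>A j. norm (h y))))"
  proof (rule bdd_aboveI2)
    fix j
    obtain y where y: "y \<in> A j" "(SUP y\<in>A j. norm (h y)) = norm (h y)"
      by (rule SUP_attained)
    have "(INF x\<in>A j. w x) * norm (h y) \<le> w y * norm (h y)"
      using INF_weight_le[OF y(1)] by (intro mult_right_mono) auto
    also have "\<dots> \<le> B" using B[of y] y(1) A(3) by blast
    finally have le: "(INF x\<in>A j. w x) * norm (h y) \<le> B" .
    have "0 \<le> a" using order_trans[OF \<alpha>(1) a] .
    have "\<alpha> j * ((INF x\<in>A j. w x) * norm (h y)) \<le> a * B"
      using \<alpha>(1)[of j] a[of j] \<open>0 \<le> a\<close> INF_weight_nonneg[of j] le by (intro mult_mono) auto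
    then show "\<alpha> j * (INF x\<in>A j. w x) * (SUP y\<in>A j. norm (h y)) \<le> a * B"
      unfolding y(2) by (simp add: mult.assoc)
  qed
qed simp

lemma seminorm_M_zero: "seminorm_M w \<alpha> A (\<lambda>_. 0 :: 'b::real_normed_vector) = 0"
  using A by (simp add: seminorm_M_def)

lemma seminorm_M_triangle:
  assumes h: "h \<in> Hw U w F" "k \<in> Hw U w F"
  shows "seminorm_M w \<alpha> A (\<lambda>x. h x + k x) \<le> seminorm_M w \<alpha> A h + seminorm_M w \<alpha> A k"
  unfolding seminorm_M_def[of _ _ _ "\<lambda>x. h x + k x"]
proof (rule cSUP_least)
  fix j
  obtain y where y: "y \<in> A j" "(SUP y\<in>A j. norm (h y + k y)) = norm (h y + k y)"
    by (rule SUP_attained)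
  have "norm (h y + k y) \<le> (SUP y\<in>A j. norm (h y)) + (SUP y\<in>A j. norm (k y))"
    using norm_triangle_ineq[of "h y" "k y"] norm_le_SUP[OF y(1), of h] norm_le_SUP[OF y(1), of k]
    by simp
  then have "\<alpha> j * (INF x\<in>A j. w x) * norm (h y + k y) \<le>
      \<alpha> j * (INF x\<in>A j. w x) * ((SUP y\<in>A j. norm (h y)) + (SUP y\<in>A j. norm (k y)))"
    using \<alpha>(1)[of j] INF_weight_nonneg[of j] by (intro mult_left_mono) auto
  then show "\<alpha> j * (INF x\<in>A j. w x) * (SUP y\<in>A j. norm (h y + k y)) \<le>
      seminorm_M w \<alpha> A h + seminorm_M w \<alpha> A k"
    using le_seminorm_M[OF h(1), of j] le_seminorm_M[OF h(2), of j]
    unfolding y(2) by (simp add: distrib_left)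
qed simp

end

definition null_seq_finite_sets :: "'e set \<Rightarrow> (nat \<Rightarrow> real) \<Rightarrow> (nat \<Rightarrow> 'e set) \<Rightarrow> bool" where
  "null_seq_finite_sets U \<alpha> A \<longleftrightarrow> (\<forall>j. 0 \<le> \<alpha> j) \<and> \<alpha> \<longlonglongrightarrow> 0 \<and>
     (\<forall>j. finite (A j) \<and> A j \<noteq> {} \<and> A j \<subseteq> U)"

text \<open>The two families are interleaved, one on the even and one on the odd indices; the
  interleaved coefficients still tend to 0.\<close>

lemma seminorm_M_directed:
  assumes w: "weight_on U w" and "null_seq_finite_sets U \<alpha> A" "null_seq_finite_sets U \<beta> B"
  obtains \<gamma> C where "null_seq_finite_sets U \<gamma> C"
    "\<And>h F. h \<in> Hw U w F \<Longrightarrow> seminorm_M w \<alpha> A h \<le> seminorm_M w \<gamma> C h"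
    "\<And>h F. h \<in> Hw U w F \<Longrightarrow> seminorm_M w \<beta> B h \<le> seminorm_M w \<gamma> C h"
proof -
  define \<gamma> where "\<gamma> j = (if even j then \<alpha> (j div 2) else \<beta> (j div 2))" for j
  define C where "C j = (if even j then A (j div 2) else B (j div 2))" for j
  have "\<gamma> \<longlonglongrightarrow> 0"
  proof (rule LIMSEQ_I)
    fix e :: real assume "0 < e"
    obtain m where m: "\<And>j. m \<le> j \<Longrightarrow> norm (\<alpha> j) < e"
      using LIMSEQ_D[of \<alpha> 0 e] assms(2) \<open>0 < e\<close> by (auto simp: null_seq_finite_sets_def)
    obtain n where n: "\<And>j. n \<le> j \<Longrightarrow> norm (\<beta> j) < e"
      using LIMSEQ_D[of \<beta> 0 e] assms(3) \<open>0 < e\<close> by (auto simp: null_seq_finite_sets_def)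
    have "norm (\<gamma> j - 0) < e" if "2 * max m n \<le> j" for j
      using m[of "j div 2"] n[of "j div 2"] that by (auto simp: \<gamma>_def)
    then show "\<exists>no. \<forall>j\<ge>no. norm (\<gamma> j - 0) < e" by blast
  qed
  then have \<gamma>C: "null_seq_finite_sets U \<gamma> C"
    using assms(2,3) by (auto simp: null_seq_finite_sets_def \<gamma>_def C_def)
  then have *: "\<And>j. 0 \<le> \<gamma> j" "\<gamma> \<longlonglongrightarrow> 0" "\<And>j. finite (C j)" "\<And>j. C j \<noteq> {}" "\<And>j. C j \<subseteq> U"
    by (auto simp: null_seq_finite_sets_def)
  have le: "\<gamma> j * (INF x\<in>C j. w x) * (SUP y\<in>C j. norm (h y)) \<le> seminorm_M w \<gamma> C h"
    if "h \<in> Hw U w F" for h F j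
    by (rule le_seminorm_M[OF w * that])
  show ?thesis
  proof
    show "seminorm_M w \<alpha> A h \<le> seminorm_M w \<gamma> C h" if "h \<in> Hw U w F" for h F
      unfolding seminorm_M_def[of _ \<alpha>]
    proof (rule cSUP_least)
      show "\<alpha> j * (INF x\<in>A j. w x) * (SUP y\<in>A j. norm (h y)) \<le> seminorm_M w \<gamma> C h" for j
        using le[OF that, of "2 * j"] by (simp add: \<gamma>_def C_def)
    qed simp
    show "seminorm_M w \<beta> B h \<le> seminorm_M w \<gamma> C h" if "h \<in> Hw U w F" for h F
      unfolding seminorm_M_def[of _ \<beta>]
    proof (rule cSUP_least)
      show "\<beta> j * (INF x\<in>B j. w x) * (SUP y\<in>B j. norm (h y)) \<le> seminorm_M w \<gamma> C h" for j
        using le[OF that, of "2 * j + 1"] by (simp add: \<gamma>_def C_def)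
    qed simp
  qed (rule \<gamma>C)
qed

lemma in_closure_of_tau_M:
  fixes U :: "'e::complex_banach set" and f :: "'e \<Rightarrow> 'b::complex_banach"
  assumes U: "U \<noteq> {}" and w: "weight_on U w" and F: "banach_subspace F" and f: "f \<in> Hw U w F"
  shows "f \<in> tau_M U w F closure_of Hwc U w F \<longleftrightarrow>
    (\<forall>\<alpha> A. null_seq_finite_sets U \<alpha> A \<longrightarrow>
      (\<forall>\<epsilon>>0. \<exists>g\<in>Hwc U w F. seminorm_M w \<alpha> A (\<lambda>x. g x - f x) < \<epsilon>))"
proof -
  define \<P> :: "(('e \<Rightarrow> 'b) \<Rightarrow> real) set" where
    "\<P> = {seminorm_M w \<alpha> A | \<alpha> A. null_seq_finite_sets U \<alpha> A}"
  have "tau_M U w F = seminorm_topology (Hw U w F) \<P>"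
    by (simp add: tau_M_def \<P>_def null_seq_finite_sets_def)
  moreover have "f \<in> seminorm_topology (Hw U w F) \<P> closure_of Hwc U w F \<longleftrightarrow>
    (\<forall>p\<in>\<P>. \<forall>\<epsilon>>0. \<exists>g\<in>Hwc U w F. p (\<lambda>x. g x - f x) < \<epsilon>)"
  proof (rule in_closure_of_seminorm_topology[OF _ f])
    show "Hwc U w F \<subseteq> Hw U w F" by (auto simp: Hwc_def)
    obtain u where "u \<in> U" using U by blast
    then have "null_seq_finite_sets U (\<lambda>_. 0) (\<lambda>_. {u})" by (simp add: null_seq_finite_sets_def)
    then show "\<P> \<noteq> {}" by (auto simp: \<P>_def)
    show "p (\<lambda>_. 0) = 0" if pP: "p \<in> \<P>" for p
    proof -
      obtain \<alpha> A where "p = seminorm_M w \<alpha> A" "null_seq_finite_sets U \<alpha> A"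
        using pP by (auto simp: \<P>_def)
      then show ?thesis
        using seminorm_M_zero[OF w, of \<alpha> A] by (simp add: null_seq_finite_sets_def)
    qed
    show "p (\<lambda>x. g x - h x) \<le> p (\<lambda>x. g x - f x) + p (\<lambda>x. f x - h x)"
      if pP: "p \<in> \<P>" and g: "g \<in> Hw U w F" and h: "h \<in> Hw U w F" for p g h
    proof -
      obtain \<alpha> A where p: "p = seminorm_M w \<alpha> A" and "null_seq_finite_sets U \<alpha> A"
        using pP by (auto simp: \<P>_def)
      then show ?thesis
        using seminorm_M_triangle[OF w _ _ _ _ _ Hw_diff[OF F w g f] Hw_diff[OF F w f h], of \<alpha> A]
        by (simp add: null_seq_finite_sets_def)
    qed
    show "\<exists>r\<in>\<P>. \<forall>g\<in>Hw U w F. p (\<lambda>x. g x - f x) \<le> r (\<lambda>x. g x - f x) \<and> q (\<lambda>x. g x - f x) \<le> r (\<lambda>x. g x - f x)"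
      if pq: "p \<in> \<P>" "q \<in> \<P>" for p q
    proof -
      obtain \<alpha> A \<beta> B where p: "p = seminorm_M w \<alpha> A" "null_seq_finite_sets U \<alpha> A"
        and q: "q = seminorm_M w \<beta> B" "null_seq_finite_sets U \<beta> B"
        using pq by (auto simp: \<P>_def)
      from seminorm_M_directed[OF w p(2) q(2)] obtain \<gamma> C where \<gamma>C: "null_seq_finite_sets U \<gamma> C"
        "\<And>h. h \<in> Hw U w F \<Longrightarrow> p h \<le> seminorm_M w \<gamma> C h"
        "\<And>h. h \<in> Hw U w F \<Longrightarrow> q h \<le> seminorm_M w \<gamma> C h"
        unfolding p(1) q(1) by metis
      then show ?thesis
        using Hw_diff[OF F w _ f] by (intro bexI[of _ "seminorm_M w \<gamma> C"]) (auto simp: \<P>_def)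
    qed
  qed
  moreover have "(\<forall>p\<in>\<P>. Q p) \<longleftrightarrow> (\<forall>\<alpha> A. null_seq_finite_sets U \<alpha> A \<longrightarrow> Q (seminorm_M w \<alpha> A))" for Q
    by (auto simp: \<P>_def)
  ultimately show ?thesis by simp
qed

lemma norm_le_SUP_compact:
  assumes f: "f \<in> holomorphic_maps U F" and K: "compact K" "K \<subseteq> U" and x: "x \<in> K"
  shows "norm (f x) \<le> (SUP x\<in>K. norm (f x))"
proof (rule cSUP_upper[OF x])
  have "compact (f ` K)"
    using compact_continuous_image[OF continuous_on_subset[OF holomorphic_maps_continuous_on[OF f] K(2)] K(1)] .
  from compact_imp_bounded[OF this] show "bdd_above ((\<lambda>x. norm (f x)) ` K)"
    by (simp add: bdd_above_norm image_image flip: bdd_above_norm)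
qed

lemma in_closure_of_tau_c:
  fixes U :: "'e::complex_banach set" and f :: "'e \<Rightarrow> 'b::complex_banach"
  assumes U: "U \<noteq> {}" and F: "banach_subspace F" and f: "f \<in> holomorphic_maps U F"
  shows "f \<in> tau_c U F closure_of Hwc U w F \<longleftrightarrow>
    (\<forall>K. compact K \<and> K \<noteq> {} \<and> K \<subseteq> U \<longrightarrow>
      (\<forall>\<epsilon>>0. \<exists>g\<in>Hwc U w F. (SUP x\<in>K. norm (g x - f x)) < \<epsilon>))"
proof -
  define \<P> :: "(('e \<Rightarrow> 'b) \<Rightarrow> real) set" where
    "\<P> = {\<lambda>f. SUP x\<in>K. norm (f x) | K. compact K \<and> K \<noteq> {} \<and> K \<subseteq> U}"
  have "tau_c U F = seminorm_topology (holomorphic_maps U F) \<P>"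
    by (simp add: tau_c_def \<P>_def)
  moreover have "f \<in> seminorm_topology (holomorphic_maps U F) \<P> closure_of Hwc U w F \<longleftrightarrow>
    (\<forall>p\<in>\<P>. \<forall>\<epsilon>>0. \<exists>g\<in>Hwc U w F. p (\<lambda>x. g x - f x) < \<epsilon>)"
  proof (rule in_closure_of_seminorm_topology[OF _ f])
    show "Hwc U w F \<subseteq> holomorphic_maps U F" by (auto simp: Hwc_def Hw_def)
    obtain u where "u \<in> U" using U by blast
    then show "\<P> \<noteq> {}" by (auto simp: \<P>_def intro!: exI[of _ "{u}"])
    show "p (\<lambda>_. 0) = 0" if pP: "p \<in> \<P>" for p
    proof -
      obtain K where "p = (\<lambda>f. SUP x\<in>K. norm (f x))" "K \<noteq> {}"
        using pP by (auto simp: \<P>_def)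
      then show ?thesis by (simp del: SUP_bot_conv)
    qed
    show "p (\<lambda>x. g x - h x) \<le> p (\<lambda>x. g x - f x) + p (\<lambda>x. f x - h x)"
      if pP: "p \<in> \<P>" and g: "g \<in> holomorphic_maps U F" and h: "h \<in> holomorphic_maps U F" for p g h
    proof -
      obtain K where p: "p = (\<lambda>f. SUP x\<in>K. norm (f x))" and K: "compact K" "K \<noteq> {}" "K \<subseteq> U"
        using pP by (auto simp: \<P>_def)
      show ?thesis
        unfolding p
      proof (rule cSUP_least[OF K(2)])
        fix x assume x: "x \<in> K"
        show "norm (g x - h x) \<le> (SUP x\<in>K. norm (g x - f x)) + (SUP x\<in>K. norm (f x - h x))"
          using norm_le_SUP_compact[OF holomorphic_maps_diff[OF F g f] K(1,3) x]
            norm_le_SUP_compact[OF holomorphic_maps_diff[OF F f h] K(1,3) x]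
            norm_triangle_ineq[of "g x - f x" "f x - h x"] by simp
      qed
    qed
    show "\<exists>r\<in>\<P>. \<forall>g\<in>holomorphic_maps U F.
        p (\<lambda>x. g x - f x) \<le> r (\<lambda>x. g x - f x) \<and> q (\<lambda>x. g x - f x) \<le> r (\<lambda>x. g x - f x)"
      if pq: "p \<in> \<P>" "q \<in> \<P>" for p q
    proof -
      obtain K L where p: "p = (\<lambda>f. SUP x\<in>K. norm (f x))" "compact K" "K \<noteq> {}" "K \<subseteq> U"
        and q: "q = (\<lambda>f. SUP x\<in>L. norm (f x))" "compact L" "L \<noteq> {}" "L \<subseteq> U"
        using pq by (auto simp: \<P>_def)
      have KL: "compact (K \<union> L)" "K \<union> L \<subseteq> U" using p q by auto
      have "p (\<lambda>x. g x - f x) \<le> (SUP x\<in>K \<union> L. norm (g x - f x)) \<and>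
          q (\<lambda>x. g x - f x) \<le> (SUP x\<in>K \<union> L. norm (g x - f x))" if "g \<in> holomorphic_maps U F" for g
        unfolding p(1) q(1)
        using norm_le_SUP_compact[OF holomorphic_maps_diff[OF F that f] KL] p(3) q(3)
        by (intro conjI cSUP_least) auto
      moreover have "(\<lambda>f. SUP x\<in>K \<union> L. norm (f x)) \<in> \<P>"
        using KL p(3) by (auto simp: \<P>_def intro!: exI[of _ "K \<union> L"])
      ultimately show ?thesis by (intro bexI[of _ "\<lambda>f. SUP x\<in>K \<union> L. norm (f x)"]) auto
    qed
  qed
  ultimately show ?thesis by (auto simp: \<P>_def)
qed

section \<open>Homogeneous maps composed with compact operators\<close>

text \<open>Here \<open>z\<close> may lie outside \<open>K\<close>, as it must: it will be the image
  of \<open>x\<close> under a compact operator. The number \<open>\<delta>\<close> is a Lebesgue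
  number of a cover by open sets on which \<open>P\<close> oscillates by less than
  \<open>e\<close>.\<close>

lemma compact_uniform_nbhd:
  fixes P :: "'a::metric_space \<Rightarrow> 'b::metric_space"
  assumes P: "continuous_on UNIV P" and K: "compact K" and e: "0 < e"
  obtains \<delta> where "0 < \<delta>" "\<And>x z. x \<in> K \<Longrightarrow> dist z x < \<delta> \<Longrightarrow> dist (P z) (P x) < e"
proof -
  define \<G> where "\<G> = {G. open G \<and> (\<forall>x\<in>G. \<forall>z\<in>G. dist (P z) (P x) < e)}"
  have "x \<in> \<Union>\<G>" for x
  proof -
    define G where "G = P -` ball (P x) (e/2)"
    have "open G" unfolding G_def by (rule open_vimage[OF open_ball P])
    moreover have "dist (P z) (P y) < e" if "y \<in> G" "z \<in> G" for y z
      using that dist_triangle_half_r[of "P x" "P z" e "P y"] by (simp add: G_def)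
    moreover have "x \<in> G" using e by (simp add: G_def)
    ultimately show ?thesis by (auto simp: \<G>_def)
  qed
  then have "K \<subseteq> \<Union>\<G>" by blast
  moreover have op: "open B" if "B \<in> \<G>" for B using that by (simp add: \<G>_def)
  ultimately obtain \<delta> where \<delta>: "0 < \<delta>" "\<And>x. x \<in> K \<Longrightarrow> \<exists>G\<in>\<G>. ball x \<delta> \<subseteq> G"
    by (rule Heine_Borel_lemma[OF K]) (assumption, rule that)
  show ?thesis
  proof (rule that[OF \<delta>(1)])
    fix x z assume "x \<in> K" "dist z x < \<delta>"
    obtain G where "G \<in> \<G>" "ball x \<delta> \<subseteq> G" using \<delta>(2)[OF \<open>x \<in> K\<close>] by (rule bexE)
    moreover have "x \<in> ball x \<delta>" "z \<in> ball x \<delta>"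
      using \<delta>(1) \<open>dist z x < \<delta>\<close> by (simp_all add: dist_commute)
    ultimately have "x \<in> G" "z \<in> G" by blast+
    with \<open>G \<in> \<G>\<close> show "dist (P z) (P x) < e" by (auto simp: \<G>_def)
  qed
qed

text \<open>A member of the cover containing 0 swallows all but finitely many of the finite
  sets.\<close>

lemma compact_null_finite_sets:
  fixes B :: "nat \<Rightarrow> 'a::real_normed_vector set"
  assumes fin: "\<And>j. finite (B j)" and null: "\<And>e. 0 < e \<Longrightarrow> \<exists>J. \<forall>j\<ge>J. \<forall>b\<in>B j. norm b < e"
  shows "compact (insert 0 (\<Union>j. B j))"
proof (rule compactI)
  fix \<C> assume \<C>: "\<forall>t\<in>\<C>. open t" "insert 0 (\<Union>j. B j) \<subseteq> \<Union>\<C>"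
  then obtain c\<^sub>0 where c\<^sub>0: "c\<^sub>0 \<in> \<C>" "0 \<in> c\<^sub>0" by blast
  then obtain e where e: "0 < e" "ball 0 e \<subseteq> c\<^sub>0" using \<C>(1) openE by blast
  obtain J where J: "\<And>j b. J \<le> j \<Longrightarrow> b \<in> B j \<Longrightarrow> norm b < e" using null[OF e(1)] by blast
  have "\<forall>b\<in>(\<Union>j<J. B j). \<exists>c\<in>\<C>. b \<in> c" using \<C>(2) by blast
  then obtain c where c: "\<And>b. b \<in> (\<Union>j<J. B j) \<Longrightarrow> c b \<in> \<C> \<and> b \<in> c b" by metis
  have "insert 0 (\<Union>j. B j) \<subseteq> \<Union>(insert c\<^sub>0 (c ` (\<Union>j<J. B j)))"
  proof
    fix b assume "b \<in> insert 0 (\<Union>j. B j)"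
    then consider "b = 0" | j where "b \<in> B j" "j < J" | j where "b \<in> B j" "J \<le> j"
      by (auto simp: not_less[symmetric])
    then show "b \<in> \<Union>(insert c\<^sub>0 (c ` (\<Union>j<J. B j)))"
    proof cases
      case 2
      then show ?thesis using c[of b] by auto
    next
      case 3
      then have "b \<in> c\<^sub>0" using J[of j b] e(2) by auto
      then show ?thesis by blast
    qed (use c\<^sub>0 in auto)
  qed
  moreover have "finite (insert c\<^sub>0 (c ` (\<Union>j<J. B j)))" using fin by simp
  moreover have "insert c\<^sub>0 (c ` (\<Union>j<J. B j)) \<subseteq> \<C>" using c\<^sub>0(1) c by blast
  ultimately show "\<exists>\<C>'\<subseteq>\<C>. finite \<C>' \<and> insert 0 (\<Union>j. B j) \<subseteq> \<Union>\<C>'" by blast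
qed

lemma compact_operator_bounded_linear:
  assumes "compact_operator T"
  shows "bounded_linear T"
proof -
  have lin: "linear T" using assms clinear_imp_linear by (auto simp: compact_operator_def)
  have "compact (closure (T ` cball 0 1))"
    using assms bounded_cball by (auto simp: compact_operator_def)
  then have "bounded (T ` cball 0 1)"
    using compact_imp_bounded bounded_subset closure_subset by blast
  then obtain B where B: "\<And>x. norm x \<le> 1 \<Longrightarrow> norm (T x) \<le> B"
    unfolding bounded_iff by (metis image_eqI mem_cball_0)
  have "norm (T x) \<le> norm x * B" for x
  proof (cases "x = 0")
    case True
    then show ?thesis using linear_0[OF lin] by simp
  next
    case False
    then have "norm (T ((1 / norm x) *\<^sub>R x)) \<le> B" by (intro B) simp
    then show ?thesis using False by (simp add: linear_cmul[OF lin] field_simps)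
  qed
  then show ?thesis
    using linear_add[OF lin] linear_cmul[OF lin] by (intro bounded_linear_intro)
qed

section \<open>Powers of functionals and their weighted bounds\<close>

lemma homogeneous_polynomial_functional_power:
  fixes \<phi> :: "'e::complex_banach \<Rightarrow> complex"
  assumes \<phi>: "clinear \<phi>" "bounded_linear \<phi>"
  shows "homogeneous_polynomial k (\<lambda>x. \<phi> x ^ k)"
  unfolding homogeneous_polynomial_def
proof (intro exI conjI)
  show "(\<lambda>x. \<phi> x ^ k) = (\<lambda>x. (\<lambda>v. \<Prod>i<k. \<phi> (v i)) (\<lambda>_. x))" by simp
  show "continuous_multilinear_form k (\<lambda>v. \<Prod>i<k. \<phi> (v i))"
    unfolding continuous_multilinear_form_def
  proof (intro conjI allI impI)
    show "(\<Prod>i<k. \<phi> (v i)) = (\<Prod>i<k. \<phi> (v' i))" if "\<forall>i<k. v i = v' i" for v v'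
      using that by (intro prod.cong) auto
    show "clinear (\<lambda>x. \<Prod>j<k. \<phi> ((v(i := x)) j))" if "i < k" for v i
    proof -
      have "(\<Prod>j<k. \<phi> ((v(i := x)) j)) = \<phi> x * (\<Prod>j\<in>{..<k} - {i}. \<phi> (v j))" for x
        using that by (subst prod.remove[of _ i]) (auto intro!: prod.cong)
      then show ?thesis
        using \<phi>(1) by (simp add: clinear_iff scaleC_complex_def distrib_right)
    qed
    show "continuous_on UNIV (\<lambda>v. \<Prod>i<k. \<phi> (v i))"
      by (intro continuous_on_prod continuous_on_compose2[OF linear_continuous_on[OF \<phi>(2), of UNIV]]
          continuous_on_product_coordinates) auto
  qed
qed

lemma functional_power_in_polynomials:
  fixes \<phi> :: "'e::complex_banach \<Rightarrow> complex"
  assumes \<phi>: "clinear \<phi>" "bounded_linear \<phi>"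
  shows "(\<lambda>x. \<phi> x ^ k) \<in> polynomials"
proof -
  define P where "P m = (if m = k then (\<lambda>x. \<phi> x ^ k) else (\<lambda>_. 0))" for m
  have "homogeneous_polynomial m (\<lambda>_ :: 'e. 0)" for m
    by (auto simp: homogeneous_polynomial_def continuous_multilinear_form_def clinear_iff
        intro!: exI[of _ "\<lambda>_. 0"])
  then have "\<forall>m\<le>k. homogeneous_polynomial m (P m)"
    using homogeneous_polynomial_functional_power[OF \<phi>, of k] by (simp add: P_def)
  moreover have "(\<lambda>x. \<phi> x ^ k) = (\<lambda>x. \<Sum>m\<le>k. P m x)"
  proof
    fix x
    have "(\<Sum>m\<le>k. P m x) = (\<Sum>m\<le>k. if m = k then \<phi> x ^ k else 0)"
      by (intro sum.cong) (auto simp: P_def)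
    then show "\<phi> x ^ k = (\<Sum>m\<le>k. P m x)" by simp
  qed
  ultimately show ?thesis unfolding polynomials_def by blast
qed

locale weighted_domain =
  fixes U :: "'e::complex_banach set" and w :: "'e \<Rightarrow> real"
  assumes U: "open U" "balanced U" "U \<noteq> {}"
    and radial: "radial_weight_on U w"
    and polynomials: "polynomials \<subseteq> Hw U w (UNIV :: complex set)"
begin

lemma weight: "weight_on U w"
  using radial by (simp add: radial_weight_on_def)

lemma weight_pos: "x \<in> U \<Longrightarrow> 0 < w x"
  using weight by (rule weight_on_pos)

lemma scaleC_in_U: "x \<in> U \<Longrightarrow> cmod \<zeta> \<le> 1 \<Longrightarrow> scaleC \<zeta> x \<in> U"
  using U(2) by (auto simp: balanced_def)

lemma zero_in_U: "0 \<in> U"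
  using U(3) scaleC_in_U[of _ 0] by auto

lemma weighted_functional_power_bounded:
  assumes "clinear \<phi>" "bounded_linear \<phi>"
  obtains B where "\<And>x. x \<in> U \<Longrightarrow> w x * cmod (\<phi> x) ^ k \<le> B"
proof -
  have "(\<lambda>x. \<phi> x ^ k) \<in> Hw U w UNIV"
    using functional_power_in_polynomials[OF assms] polynomials by blast
  then obtain B where "\<And>x. x \<in> U \<Longrightarrow> w x * norm (\<phi> x ^ k) \<le> B"
    by (rule HwE) blast
  then show ?thesis by (intro that[of B]) (simp add: norm_power)
qed

text \<open>The exponent 0 gives the constant polynomial 1, since \<open>0 ^ 0 = 1\<close>, and its
  weighted norm bounds the weight.\<close>

lemma weight_bounded: obtains B where "\<And>x. x \<in> U \<Longrightarrow> w x \<le> B"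
proof -
  have "clinear (\<lambda>_ :: 'e. 0 :: complex)" by (simp add: clinear_iff)
  then obtain B where "\<And>x. x \<in> U \<Longrightarrow> w x * cmod 0 ^ 0 \<le> B"
    using weighted_functional_power_bounded[OF _ bounded_linear_zero, of 0] by blast
  then show ?thesis by (intro that[of B]) simp
qed

lemma bounded_root_weight:
  assumes k: "0 < k"
  shows "bounded ((\<lambda>x. root k (w x) *\<^sub>R x) ` U)"
proof (rule weakly_bounded_imp_bounded)
  fix \<phi> :: "'e \<Rightarrow> complex" assume \<phi>: "clinear \<phi>" "bounded_linear \<phi>"
  obtain B where B: "\<And>x. x \<in> U \<Longrightarrow> w x * cmod (\<phi> x) ^ k \<le> B"
    using weighted_functional_power_bounded[OF \<phi>] by blast
  \<comment> \<open>\<open>max 1 B\<close> avoids a root of \<open>B\<close>: for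
    \<open>r > 1\<close> one has \<open>r \<le> r ^ k \<le> B\<close>.\<close>
  have "cmod (\<phi> (root k (w x) *\<^sub>R x)) \<le> max 1 B" if x: "x \<in> U" for x
  proof -
    define r where "r = cmod (\<phi> (root k (w x) *\<^sub>R x))"
    have "r = root k (w x) * cmod (\<phi> x)"
      using weight_pos[OF x] k
      by (simp add: r_def linear_cmul[OF clinear_imp_linear[OF \<phi>(1)]])
    then have "r ^ k = w x * cmod (\<phi> x) ^ k"
      using weight_pos[OF x] k by (simp add: power_mult_distrib)
    then have rk: "r ^ k \<le> B" using B[OF x] by simp
    show ?thesis
    proof (cases "r \<le> 1")
      case False
      then have "r ^ 1 \<le> r ^ k" using k by (intro power_increasing) auto
      with rk show ?thesis by (simp add: r_def)
    qed (simp add: r_def)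
  qed
  then show "\<exists>B. \<forall>z\<in>(\<lambda>x. root k (w x) *\<^sub>R x) ` U. cmod (\<phi> z) \<le> B" by blast
qed

text \<open>Here rotation invariance enters: on the circle through \<open>x\<close> the weight is
  constant, so \<open>f\<close> is bounded there by \<open>B / w x\<close>.\<close>

lemma fejer_mean_weighted_le:
  assumes f: "f \<in> holomorphic_maps U F" and B: "\<And>x. x \<in> U \<Longrightarrow> w x * norm (f x) \<le> B" and x: "x \<in> U"
  shows "w x * norm (fejer_mean f n x) \<le> B"
proof -
  have "norm (f (scaleC \<zeta> x)) \<le> B / w x" if "cmod \<zeta> = 1" for \<zeta>
  proof -
    have "w (scaleC \<zeta> x) = w x" using radial x that by (simp add: radial_weight_on_def)
    then show ?thesis
      using B[OF scaleC_in_U[OF x, of \<zeta>]] that weight_pos[OF x] by (simp add: field_simps)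
  qed
  then have "norm (fejer_mean f n x) \<le> B / w x"
    using scaleC_in_U[OF x] by (intro norm_fejer_mean_le[OF f])
  then show ?thesis using weight_pos[OF x] by (simp add: field_simps)
qed

lemma homogeneous_compose_compact_in_Hwc:
  assumes P: "P \<in> holomorphic_maps UNIV F" and hom: "\<And>c x. 0 \<le> c \<Longrightarrow> P (c *\<^sub>R x) = c ^ k *\<^sub>R P x"
    and T: "compact_operator T"
  shows "(\<lambda>x. P (T x)) \<in> Hwc U w F"
proof -
  have T': "clinear T" "bounded_linear T"
    using T compact_operator_bounded_linear by (auto simp: compact_operator_def)
  have hol: "(\<lambda>x. P (T x)) \<in> holomorphic_maps U F"
    unfolding holomorphic_maps_def
  proof (intro CollectI conjI ballI)
    show "(\<lambda>x. P (T x)) ` U \<subseteq> F" using P by (auto simp: holomorphic_maps_def)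
    fix x
    obtain D where D: "clinear D" "(P has_derivative D) (at (T x))"
      by (rule holomorphic_mapsD[OF P UNIV_I])
    have "((\<lambda>x. P (T x)) has_derivative (\<lambda>h. D (T h))) (at x)"
      by (rule has_derivative_compose[where g = P, OF bounded_linear_imp_has_derivative[OF T'(2)]]) (rule D(2))
    moreover have "clinear (\<lambda>h. D (T h))" using D(1) T'(1) by (simp add: clinear_iff)
    ultimately show "\<exists>D. clinear D \<and> ((\<lambda>x. P (T x)) has_derivative D) (at x)" by blast
  qed
  show ?thesis
  proof (cases "k = 0")
    \<comment> \<open>Degree 0: \<open>P\<close> is constant, and the bounded weight confines the
      weighted range to a segment.\<close>
    case True
    have const: "P x = P 0" for x using hom[of 0 x] True by simp
    obtain B where B: "\<And>x. x \<in> U \<Longrightarrow> w x \<le> B" using weight_bounded by blast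
    show ?thesis
    proof (rule HwcI[OF hol weight])
      show "compact ((\<lambda>s. s *\<^sub>R P 0) ` {0..B})"
        by (intro compact_continuous_image continuous_intros) simp
      show "w x *\<^sub>R P (T x) \<in> (\<lambda>s. s *\<^sub>R P 0) ` {0..B}" if "x \<in> U" for x
        using B[OF that] weight_pos[OF that] const[of "T x"] by auto
    qed
  next
    case False
    then have k: "0 < k" by simp
    define C where "C = closure (T ` (\<lambda>x. root k (w x) *\<^sub>R x) ` U)"
    have C: "compact C"
      using T bounded_root_weight[OF k] by (simp add: C_def compact_operator_def)
    show ?thesis
    proof (rule HwcI[OF hol weight])
      show "compact (P ` C)"
        by (rule compact_continuous_image[OF _ C])
          (rule continuous_on_subset[OF holomorphic_maps_continuous_on[OF P] subset_UNIV])
      fix x assume x: "x \<in> U"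
      have "P (T (root k (w x) *\<^sub>R x)) = w x *\<^sub>R P (T x)"
        using hom[of "root k (w x)" "T x"] weight_pos[OF x] k
        by (simp add: linear_cmul[OF clinear_imp_linear[OF T'(1)]])
      moreover have "T (root k (w x) *\<^sub>R x) \<in> C"
        unfolding C_def using x by (intro subsetD[OF closure_subset] imageI)
      ultimately show "w x *\<^sub>R P (T x) \<in> P ` C" by (metis imageI)
    qed
  qed
qed

lemma compact_root_weighted_points:
  assumes \<alpha>A: "null_seq_finite_sets U \<alpha> A" and k: "0 < k"
  shows "compact (insert 0 (\<Union>j. (\<lambda>y. root k (\<alpha> j * w y) *\<^sub>R y) ` A j))"
proof (rule compact_null_finite_sets)
  show "finite ((\<lambda>y. root k (\<alpha> j * w y) *\<^sub>R y) ` A j)" for j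
    using \<alpha>A by (simp add: null_seq_finite_sets_def)
  fix e :: real assume e: "0 < e"
  obtain C where C: "\<And>x. x \<in> U \<Longrightarrow> norm (root k (w x) *\<^sub>R x) \<le> C"
    using bounded_root_weight[OF k] by (auto simp: bounded_iff)
  have "\<alpha> \<longlonglongrightarrow> 0" using \<alpha>A by (simp add: null_seq_finite_sets_def)
  then have "(\<lambda>j. root k (\<alpha> j) * C) \<longlonglongrightarrow> root k 0 * C"
    by (intro tendsto_intros)
  then have "(\<lambda>j. root k (\<alpha> j) * C) \<longlonglongrightarrow> 0" by simp
  then have "\<forall>\<^sub>F j in sequentially. root k (\<alpha> j) * C < e"
    using e by (rule order_tendstoD(2))
  then obtain J where J: "\<And>j. J \<le> j \<Longrightarrow> root k (\<alpha> j) * C < e"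
    unfolding eventually_sequentially by blast
  have "norm (root k (\<alpha> j * w y) *\<^sub>R y) < e" if "J \<le> j" "y \<in> A j" for j y
  proof -
    have y: "y \<in> U" and \<alpha>j: "0 \<le> \<alpha> j" using \<alpha>A that(2) by (auto simp: null_seq_finite_sets_def)
    have "norm (root k (\<alpha> j * w y) *\<^sub>R y) = root k (\<alpha> j) * norm (root k (w y) *\<^sub>R y)"
      using k \<alpha>j weight_pos[OF y] by (simp add: real_root_mult abs_mult)
    also have "\<dots> \<le> root k (\<alpha> j) * C"
      using C[OF y] k \<alpha>j by (intro mult_left_mono) auto
    also have "\<dots> < e" by (rule J[OF that(1)])
    finally show ?thesis .
  qed
  then show "\<exists>J. \<forall>j\<ge>J. \<forall>b\<in>(\<lambda>y. root k (\<alpha> j * w y) *\<^sub>R y) ` A j. norm b < e" by blast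
qed

text \<open>For large \<open>j\<close> the weighted error is at most \<open>2 * B\<close> times
  \<open>\<alpha> j\<close>, small for all \<open>n\<close> at once; the remaining sets contain
  finitely many points, where pointwise convergence decides \<open>n\<close>.\<close>

lemma fejer_mean_approximates:
  assumes \<alpha>A: "null_seq_finite_sets U \<alpha> A" and f: "f \<in> Hw U w F" and e: "0 < e"
  obtains n where "\<And>j y. y \<in> A j \<Longrightarrow> \<alpha> j * w y * norm (fejer_mean f n y - f y) \<le> e"
proof -
  have A: "finite (A j)" "A j \<subseteq> U" and \<alpha>: "0 \<le> \<alpha> j" "\<alpha> \<longlonglongrightarrow> 0" for j
    using \<alpha>A by (auto simp: null_seq_finite_sets_def)
  obtain B where hol: "f \<in> holomorphic_maps U F" and B: "\<And>x. x \<in> U \<Longrightarrow> w x * norm (f x) \<le> B"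
    by (rule HwE[OF f]) blast
  have "(\<lambda>j. \<alpha> j * (2 * B)) \<longlonglongrightarrow> 0 * (2 * B)" by (intro tendsto_intros \<alpha>(2))
  then have "\<forall>\<^sub>F j in sequentially. \<alpha> j * (2 * B) < e"
    using e by (intro order_tendstoD(2)) auto
  then obtain J where J: "\<And>j. J \<le> j \<Longrightarrow> \<alpha> j * (2 * B) < e"
    unfolding eventually_sequentially by blast
  have "\<forall>\<^sub>F n in sequentially. \<alpha> j * w y * norm (fejer_mean f n y - f y) < e" if "y \<in> A j" for j y
  proof -
    have "(\<lambda>n. \<alpha> j * w y * norm (fejer_mean f n y - f y)) \<longlonglongrightarrow> \<alpha> j * w y * norm (f y - f y)"
      using that A(2) by (intro tendsto_intros fejer_mean_tendsto[OF hol U(1,2)]) blast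
    then show ?thesis using e by (intro order_tendstoD(2)) auto
  qed
  then have "\<forall>\<^sub>F n in sequentially. \<forall>j\<in>{..<J}. \<forall>y\<in>A j. \<alpha> j * w y * norm (fejer_mean f n y - f y) < e"
    using A(1) by (intro eventually_ball_finite ballI) auto
  then obtain n where n: "\<And>j y. j < J \<Longrightarrow> y \<in> A j \<Longrightarrow> \<alpha> j * w y * norm (fejer_mean f n y - f y) < e"
    unfolding eventually_sequentially by blast
  have "\<alpha> j * w y * norm (fejer_mean f n y - f y) \<le> e" if y: "y \<in> A j" for j y
  proof (cases "j < J")
    case True
    then show ?thesis using n[OF True y] by simp
  next
    case False
    have yU: "y \<in> U" using y A(2) by blast
    have "w y * norm (fejer_mean f n y - f y) \<le> w y * (norm (fejer_mean f n y) + norm (f y))"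
      using weight_pos[OF yU] by (intro mult_left_mono norm_triangle_ineq4) simp
    also have "\<dots> \<le> 2 * B"
      using fejer_mean_weighted_le[OF hol B yU, of n] B[OF yU] by (simp add: distrib_left)
    finally have "\<alpha> j * (w y * norm (fejer_mean f n y - f y)) \<le> \<alpha> j * (2 * B)"
      using \<alpha>(1) by (intro mult_left_mono)
    with J[of j] False show ?thesis by (simp add: mult.assoc)
  qed
  then show ?thesis by (rule that)
qed

lemma CAP_imp_tau_M_dense:
  assumes CAP: "compact_approximation_property TYPE('e)"
    and F: "banach_subspace F" and f: "f \<in> Hw U w F"
  shows "f \<in> tau_M U w F closure_of Hwc U w F"
  unfolding in_closure_of_tau_M[OF U(3) weight F f]
proof (intro allI impI)
  fix \<alpha> A and \<epsilon> :: real
  assume \<alpha>A: "null_seq_finite_sets U \<alpha> A" and \<epsilon>: "0 < \<epsilon>"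
  then have A: "\<And>j. finite (A j)" "\<And>j. A j \<noteq> {}" "\<And>j. A j \<subseteq> U"
    and \<alpha>: "\<And>j. 0 \<le> \<alpha> j" "\<alpha> \<longlonglongrightarrow> 0"
    by (auto simp: null_seq_finite_sets_def)
  have hol: "f \<in> holomorphic_maps U F" using f by (simp add: Hw_def)
  obtain n where n: "\<And>j y. y \<in> A j \<Longrightarrow> \<alpha> j * w y * norm (fejer_mean f n y - f y) \<le> \<epsilon> / 4"
    by (rule fejer_mean_approximates[OF \<alpha>A f, of "\<epsilon> / 4"]) (use \<epsilon> in auto)
  have "\<exists>P. P \<in> holomorphic_maps UNIV F \<and> (\<forall>x\<in>U. P x = taylor_term f k x) \<and>
      (\<forall>c\<ge>0. \<forall>x. P (c *\<^sub>R x) = c ^ k *\<^sub>R P x)" for k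
    by (rule taylor_term_extension[OF hol F U, of k]) blast
  then obtain P where P: "\<And>k. P k \<in> holomorphic_maps UNIV F"
    and P_eq: "\<And>k x. x \<in> U \<Longrightarrow> P k x = taylor_term f k x"
    and hom: "\<And>k c x. 0 \<le> c \<Longrightarrow> P k (c *\<^sub>R x) = c ^ k *\<^sub>R P k x"
    by metis
  \<comment> \<open>Shares out \<open>\<epsilon> / 4\<close> among the \<open>Suc n\<close> degrees;
    the Fejer error takes another \<open>\<epsilon> / 4\<close>, and the total
    \<open>\<epsilon> / 2\<close> leaves a strict inequality after the supremum.\<close>
  define e where "e = \<epsilon> / (4 * real (Suc n))"
  have e: "0 < e" using \<epsilon> by (simp add: e_def)
  define K where "K k = insert 0 (\<Union>j. (\<lambda>y. root k (\<alpha> j * w y) *\<^sub>R y) ` A j)" for k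
  have K: "compact (K k)" if "0 < k" for k
    unfolding K_def by (rule compact_root_weighted_points[OF \<alpha>A that])
  have "\<exists>\<delta>>0. \<forall>x z. 0 < k \<longrightarrow> x \<in> K k \<longrightarrow> dist z x < \<delta> \<longrightarrow> dist (P k z) (P k x) < e" for k
  proof (cases "0 < k")
    case True
    show ?thesis
      by (rule compact_uniform_nbhd[OF holomorphic_maps_continuous_on[OF P[of k]] K[OF True] e]) blast
  qed (auto intro: exI[of _ 1])
  then obtain \<delta> where \<delta>: "\<And>k. 0 < \<delta> k"
    "\<And>k x z. 0 < k \<Longrightarrow> x \<in> K k \<Longrightarrow> dist z x < \<delta> k \<Longrightarrow> dist (P k z) (P k x) < e"
    by metis
  \<comment> \<open>One operator has to serve all degrees up to \<open>n\<close> at once, hence the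
    smallest tolerance and the union of the compact sets.\<close>
  define d where "d = Min (\<delta> ` {..n})"
  have d: "0 < d" "\<And>k. k \<le> n \<Longrightarrow> d \<le> \<delta> k" using \<delta>(1) by (auto simp: d_def)
  have "compact (\<Union>k\<in>{1..n}. K k)" by (intro compact_UN K) auto
  then obtain T where T: "compact_operator T"
    and Td: "\<And>x. x \<in> (\<Union>k\<in>{1..n}. K k) \<Longrightarrow> norm (T x - x) < d"
    using CAP d(1) unfolding compact_approximation_property_def by metis
  have T_lin: "linear T" using T clinear_imp_linear by (auto simp: compact_operator_def)
  have close: "\<alpha> j * w y * norm (P k (T y) - P k y) \<le> e" if y: "y \<in> A j" and k: "k \<le> n" for j y k
  proof (cases "k = 0")
    case True
    have "P k x = P k 0" for x using hom[of 0 k x] True by simp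
    then have "P k (T y) = P k y" by metis
    then show ?thesis using e by simp
  next
    case False
    \<comment> \<open>By homogeneity the factor \<open>\<alpha> j * w y\<close> moves into the
      argument as its k-th root \<open>c\<close>, so the estimate at \<open>y\<close> becomes one at
      the point \<open>c *\<^sub>R y\<close> of \<open>K k\<close>.\<close>
    define c where "c = root k (\<alpha> j * w y)"
    have nn: "0 \<le> \<alpha> j * w y" using \<alpha>(1) weight_pos A(3) y by (simp add: less_imp_le subset_eq)
    have c: "0 \<le> c" "c ^ k = \<alpha> j * w y"
      using nn False by (simp_all add: c_def)
    have z: "c *\<^sub>R y \<in> K k" using y by (auto simp: K_def c_def)
    have "norm (T (c *\<^sub>R y) - c *\<^sub>R y) < \<delta> k"
      using Td[of "c *\<^sub>R y"] z k False d(2)[OF k] by force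
    then have "dist (P k (T (c *\<^sub>R y))) (P k (c *\<^sub>R y)) < e"
      using \<delta>(2)[OF _ z, of "T (c *\<^sub>R y)"] False by (simp add: dist_norm)
    moreover have "P k (T (c *\<^sub>R y)) - P k (c *\<^sub>R y) = (\<alpha> j * w y) *\<^sub>R (P k (T y) - P k y)"
      by (simp add: linear_cmul[OF T_lin] hom[OF c(1)] c(2) scaleR_diff_right)
    ultimately show ?thesis using nn by (simp add: dist_norm)
  qed
  define a where "a k = real (Suc n - k) / real (Suc n)" for k
  have a: "0 \<le> a k" "a k \<le> 1" for k by (simp_all add: a_def divide_le_eq)
  define g where "g x = (\<Sum>k\<le>n. a k *\<^sub>R P k (T x))" for x
  have "g \<in> Hwc U w F"
    unfolding g_def
    by (intro Hwc_sum[OF F weight] Hwc_scaleR[OF F weight]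
        homogeneous_compose_compact_in_Hwc[OF P hom T])
  moreover have "seminorm_M w \<alpha> A (\<lambda>x. g x - f x) \<le> \<epsilon> / 2"
  proof (rule seminorm_M_le[OF weight \<alpha> A])
    fix j y assume y: "y \<in> A j"
    then have yU: "y \<in> U" using A(3) by blast
    have nn: "0 \<le> \<alpha> j * w y" using \<alpha>(1)[of j] weight_pos[OF yU] by simp
    have "g y - fejer_mean f n y = (\<Sum>k\<le>n. a k *\<^sub>R (P k (T y) - P k y))"
      by (simp add: g_def fejer_mean_def a_def P_eq[OF yU] scaleR_diff_right sum_subtractf)
    also have "norm \<dots> \<le> (\<Sum>k\<le>n. norm (P k (T y) - P k y))"
      using a by (intro sum_norm_le) (simp add: mult_left_le_one_le)
    finally have "\<alpha> j * w y * norm (g y - fejer_mean f n y) \<le>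
        (\<Sum>k\<le>n. \<alpha> j * w y * norm (P k (T y) - P k y))"
      using nn by (simp add: sum_distrib_left[symmetric] mult_left_mono)
    also have "\<dots> \<le> (\<Sum>k\<le>n. e)" using close[OF y] by (intro sum_mono) simp
    also have "\<dots> = \<epsilon> / 4" by (simp add: e_def field_simps)
    finally have 1: "\<alpha> j * w y * norm (g y - fejer_mean f n y) \<le> \<epsilon> / 4" .
    have "norm (g y - f y) \<le> norm (g y - fejer_mean f n y) + norm (fejer_mean f n y - f y)"
      using norm_triangle_ineq[of "g y - fejer_mean f n y" "fejer_mean f n y - f y"] by simp
    then have "\<alpha> j * w y * norm (g y - f y) \<le>
        \<alpha> j * w y * (norm (g y - fejer_mean f n y) + norm (fejer_mean f n y - f y))"
      using nn by (intro mult_left_mono)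
    with 1 n[OF y] show "\<alpha> j * w y * norm (g y - f y) \<le> \<epsilon> / 2"
      by (simp add: distrib_left)
  qed
  ultimately show "\<exists>g\<in>Hwc U w F. seminorm_M w \<alpha> A (\<lambda>x. g x - f x) < \<epsilon>"
    using \<epsilon> by (intro bexI[of _ g]) auto
qed

end

section \<open>Comparison of the topologies\<close>

text \<open>The radius 8 makes the Schwarz factor 1/7, below the 1/4 used in the iteration, while a
  point moves away from \<open>K\<close> by at most \<open>8 * d\<close>.\<close>

definition disc_hull :: "real \<Rightarrow> 'e::complex_banach set \<Rightarrow> 'e set" where
  "disc_hull d K = {a + scaleC \<zeta> (y - a) | a y \<zeta>. a \<in> K \<and> y \<in> K \<and> dist a y \<le> d \<and> cmod \<zeta> \<le> 8}"

lemma compact_disc_hull: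
  assumes "compact K"
  shows "compact (disc_hull d K)"
proof -
  have "closed {p :: 'a \<times> 'a. dist (fst p) (snd p) \<le> d}"
    by (intro closed_Collect_le continuous_intros)
  then have "compact ((K \<times> K \<inter> {p. dist (fst p) (snd p) \<le> d}) \<times> cball (0 :: complex) 8)"
    using assms by (intro compact_Times compact_Int_closed compact_cball)
  then have "compact ((\<lambda>(p, \<zeta>). fst p + scaleC \<zeta> (snd p - fst p)) `
      ((K \<times> K \<inter> {p. dist (fst p) (snd p) \<le> d}) \<times> cball 0 8))"
    unfolding case_prod_unfold
    by (rule compact_continuous_image[rotated]) (intro continuous_intros)
  also have "(\<lambda>(p, \<zeta>). fst p + scaleC \<zeta> (snd p - fst p)) `
      ((K \<times> K \<inter> {p. dist (fst p) (snd p) \<le> d}) \<times> cball 0 8) = disc_hull d K"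
    by (force simp: disc_hull_def image_def)
  finally show ?thesis .
qed

lemma disc_hullI:
  "a \<in> K \<Longrightarrow> y \<in> K \<Longrightarrow> dist a y \<le> d \<Longrightarrow> cmod \<zeta> \<le> 8 \<Longrightarrow> a + scaleC \<zeta> (y - a) \<in> disc_hull d K"
  unfolding disc_hull_def by blast

text \<open>A Schwarz estimate: if \<open>a, y \<in> K\<close> and \<open>dist a y \<le> d\<close>, then the disc of radius 8 on the complex
  line through \<open>a\<close> and \<open>y\<close> lies in \<open>disc_hull d K\<close>.\<close>

lemma disc_hull_difference_le:
  assumes g: "g \<in> holomorphic_maps U F" and K: "disc_hull d K \<subseteq> U"
    and M: "\<And>x. x \<in> disc_hull d K \<Longrightarrow> norm (g x) \<le> M"
    and ay: "a \<in> K" "y \<in> K" "dist a y \<le> d"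
  shows "norm (g y - g a) \<le> M / 4"
proof (rule norm_le_if_functionals_le)
  fix \<phi> :: "'b \<Rightarrow> complex" assume \<phi>: "norm_le_one_functional \<phi>"
  define h where "h \<zeta> = \<phi> (g (a + scaleC \<zeta> (y - a)))" for \<zeta>
  have "h holomorphic_on {\<zeta>. a + scaleC \<zeta> (y - a) \<in> U}"
    using holomorphic_along_line[OF g \<phi>] by (simp add: h_def[abs_def])
  moreover have line: "a + scaleC \<zeta> (y - a) \<in> disc_hull d K" if "cmod \<zeta> \<le> 8" for \<zeta>
    by (rule disc_hullI[OF ay that])
  then have "cball 0 8 \<subseteq> {\<zeta>. a + scaleC \<zeta> (y - a) \<in> U}" using K by auto
  moreover have "cmod (h \<zeta>) \<le> M" if "\<zeta> \<in> cball 0 8" for \<zeta>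
    using order_trans[OF functional_le[OF \<phi>] M[OF line]] that by (simp add: h_def)
  ultimately have "cmod (h 1 - (\<Sum>k<1. (deriv ^^ k) h 0 / fact k)) \<le> M / 8 ^ 1 * (8 / (8 - 1))"
    by (intro taylor_remainder_le) auto
  moreover have "0 \<le> M"
    using order_trans[OF norm_ge_zero M[OF line[of 0]]] by simp
  ultimately show "cmod (\<phi> (g y - g a)) \<le> M / 4"
    using linear_diff[OF bounded_linear.linear[OF functional_bounded_linear[OF \<phi>]], of "g y" "g a"]
    by (simp add: h_def)
qed

context weighted_domain
begin

text \<open>The oscillation of \<open>h\<close> near the points of a net is governed by
  \<open>h\<close> on a larger compact set, this by the next net, and so on; the a priori bound of
  \<open>h\<close> coming from its weighted norm closes the recursion, its contribution shrinking by
  4 at each level.\<close>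

lemma tau_M_finer_than_tau_c:
  assumes K: "compact K" "K \<noteq> {}" "K \<subseteq> U"
  obtains \<alpha> A where "null_seq_finite_sets U \<alpha> A"
    "\<And>h F. h \<in> Hw U w F \<Longrightarrow> (SUP x\<in>K. norm (h x :: 'b::complex_banach)) \<le> seminorm_M w \<alpha> A h"
proof -
  have "K \<subseteq> \<Union>{U}" using K(3) by simp
  then obtain e where e: "0 < e" "\<And>x. x \<in> K \<Longrightarrow> ball x e \<subseteq> U"
    using Heine_Borel_lemma[OF K(1), of "{U}"] U(1) by auto
  \<comment> \<open>Two steps of length \<open>\<eta>\<close> from \<open>K\<close> stay in
    \<open>U\<close>: one for the enlarged sets, one for the margin that makes \<open>N\<close>
    bounded within \<open>U\<close>, so that the weight has a positive lower bound on
    \<open>N\<close>.\<close>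
  define \<eta> where "\<eta> = e / 3"
  have \<eta>: "0 < \<eta>" using e(1) by (simp add: \<eta>_def)
  define N where "N = {x. \<exists>z\<in>K. dist z x \<le> \<eta>}"
  have N_U: "x + v \<in> U" if x: "x \<in> N" and v: "norm v < \<eta>" for x v
  proof -
    obtain z where z: "z \<in> K" "dist z x \<le> \<eta>" using x by (auto simp: N_def)
    have "dist z (x + v) \<le> dist z x + norm v"
      using dist_triangle[of z "x + v" x] by (simp add: dist_norm)
    also have "\<dots> < e" using z v \<eta> by (simp add: \<eta>_def)
    finally show ?thesis using e(2)[OF z(1)] by auto
  qed
  have "bounded_within U N"
    unfolding bounded_within_def
  proof (intro conjI)
    show "N \<subseteq> U" using N_U[of _ 0] \<eta> by auto
    obtain b where b: "\<And>z. z \<in> K \<Longrightarrow> norm z \<le> b"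
      using compact_imp_bounded[OF K(1)] by (auto simp: bounded_iff)
    have "norm x \<le> b + \<eta>" if "x \<in> N" for x
    proof -
      obtain z where z: "z \<in> K" "dist z x \<le> \<eta>" using \<open>x \<in> N\<close> by (auto simp: N_def)
      then show ?thesis
        using norm_triangle_sub[of x z] b[OF z(1)] by (simp add: dist_norm norm_minus_commute)
    qed
    then show "bounded N" by (auto simp: bounded_iff)
    show "\<exists>V. open V \<and> 0 \<in> V \<and> (\<forall>a\<in>N. \<forall>v\<in>V. a + v \<in> U)"
      using N_U \<eta> by (intro exI[of _ "ball 0 \<eta>"]) auto
  qed
  then obtain m M where m: "0 < m" "\<And>x. x \<in> N \<Longrightarrow> m \<le> w x"
    using weight unfolding weight_on_def by blast
  \<comment> \<open>Passing from \<open>L i\<close> to \<open>L (Suc i)\<close> moves points by at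
    most \<open>8 * d i\<close>, half of \<open>\<eta> / 2 ^ i\<close>; all moves together stay
    within \<open>\<eta>\<close>.\<close>
  define d where "d i = \<eta> / (16 * 2 ^ i)" for i
  have d: "0 < d i" for i using \<eta> by (simp add: d_def)
  define L where "L = rec_nat K (\<lambda>i. disc_hull (d i))"
  have L0: "L 0 = K" and LSuc: "L (Suc i) = disc_hull (d i) (L i)" for i
    by (simp_all add: L_def)
  have L_compact: "compact (L i)" for i
    by (induction i) (simp_all add: L0 LSuc K(1) compact_disc_hull)
  have L_mono: "L i \<subseteq> L (Suc i)" for i
  proof
    fix x assume "x \<in> L i"
    from disc_hullI[OF this this, of "d i" 0] d[of i] show "x \<in> L (Suc i)" by (simp add: LSuc)
  qed
  have L_ne: "L i \<noteq> {}" for i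
    by (induction i) (use L0 K(2) L_mono in blast)+
  have L_near: "\<exists>z\<in>K. dist z x \<le> \<eta> * (1 - 1 / 2 ^ i)" if "x \<in> L i" for x i
    using that
  proof (induction i arbitrary: x)
    case 0
    then show ?case by (auto simp: L0 intro!: bexI[of _ x])
  next
    case (Suc i)
    then obtain a y \<zeta> where x: "x = a + scaleC \<zeta> (y - a)" and ay: "a \<in> L i" "dist a y \<le> d i" "cmod \<zeta> \<le> 8"
      by (auto simp: LSuc disc_hull_def)
    obtain z where z: "z \<in> K" "dist z a \<le> \<eta> * (1 - 1 / 2 ^ i)" using Suc.IH[OF ay(1)] by blast
    have "dist a x = cmod \<zeta> * dist a y" by (simp add: x dist_norm norm_scaleC norm_minus_commute)
    also have "\<dots> \<le> 8 * d i" using ay by (intro mult_mono) auto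
    finally have "dist z x \<le> \<eta> * (1 - 1 / 2 ^ i) + 8 * d i"
      using z(2) dist_triangle[of z x a] by simp
    also have "\<dots> = \<eta> * (1 - 1 / 2 ^ Suc i)" by (simp add: d_def algebra_simps)
    finally show ?case using z(1) by blast
  qed
  have L_N: "L i \<subseteq> N" for i
  proof
    fix x assume "x \<in> L i"
    then obtain z where z: "z \<in> K" "dist z x \<le> \<eta> * (1 - 1 / 2 ^ i)" using L_near by blast
    have "\<eta> * (1 - 1 / 2 ^ i) \<le> \<eta> * 1" using \<eta> by (intro mult_left_mono) auto
    with z show "x \<in> N" unfolding N_def by force
  qed
  have L_U: "L i \<subseteq> U" for i
    using L_N[of i] N_U[of _ 0] \<eta> by auto
  have "\<exists>A. finite A \<and> A \<subseteq> L i \<and> L i \<subseteq> (\<Union>a\<in>A. ball a (d i))" for i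
    using seq_compact_imp_totally_bounded[OF compact_imp_seq_compact[OF L_compact]] d by blast
  then obtain A where A: "\<And>i. finite (A i)" "\<And>i. A i \<subseteq> L i" "\<And>i. L i \<subseteq> (\<Union>a\<in>A i. ball a (d i))"
    by metis
  \<comment> \<open>Decays by 1/2 per level; the factor \<open>2 / m\<close> absorbs the lower bound
    of the weight, so that \<open>s\<close> controls \<open>h\<close> on \<open>A i\<close> by
    \<open>2 ^ i * s / 2\<close>.\<close>
  define \<alpha> :: "nat \<Rightarrow> real" where "\<alpha> i = (2 / m) * (1 / 2) ^ i" for i
  have "\<alpha> \<longlonglongrightarrow> (2 / m) * 0"
    unfolding \<alpha>_def[abs_def] by (intro tendsto_mult tendsto_const LIMSEQ_realpow_zero) auto
  then have \<alpha>: "\<And>i. 0 \<le> \<alpha> i" "\<alpha> \<longlonglongrightarrow> 0" using m(1) by (simp_all add: \<alpha>_def)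
  have A_ne: "A i \<noteq> {}" for i using A(3)[of i] L_ne[of i] by blast
  have A_U: "A i \<subseteq> U" for i using A(2) L_U by blast
  show ?thesis
  proof
    show "null_seq_finite_sets U \<alpha> A"
      using \<alpha> A(1) A_ne A_U by (simp add: null_seq_finite_sets_def)
    fix h :: "'e \<Rightarrow> 'b" and F assume h: "h \<in> Hw U w F"
    obtain B where hol: "h \<in> holomorphic_maps U F" and B: "\<And>x. x \<in> U \<Longrightarrow> w x * norm (h x) \<le> B"
      by (rule HwE[OF h]) blast
    have hB: "norm (h x) \<le> B / m" if "x \<in> L i" for x i
    proof -
      have "m * norm (h x) \<le> w x * norm (h x)"
        using m(2)[of x] L_N[of i] that by (intro mult_right_mono) auto
      also have "\<dots> \<le> B" using B L_U that by blast
      finally show ?thesis using m(1) by (simp add: field_simps)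
    qed
    define s where "s = seminorm_M w \<alpha> A h"
    have net: "norm (h a) \<le> 2 ^ i * s / 2" if a: "a \<in> A i" for a i
    proof -
      have "m \<le> (INF x\<in>A i. w x)"
        using m(2) A(2)[of i] L_N[of i] by (intro cINF_greatest A_ne) blast
      moreover have "norm (h a) \<le> (SUP y\<in>A i. norm (h y))"
        using A(1)[of i] a by (intro cSUP_upper) auto
      ultimately have "\<alpha> i * m * norm (h a) \<le> \<alpha> i * (INF x\<in>A i. w x) * (SUP y\<in>A i. norm (h y))"
        using \<alpha>(1)[of i] m(1) by (intro mult_mono mult_nonneg_nonneg) auto
      also have "\<dots> \<le> s"
        unfolding s_def by (rule le_seminorm_M[OF weight \<alpha> A(1) A_ne A_U h])
      finally show ?thesis using m(1) by (simp add: \<alpha>_def power_one_over field_simps)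
    qed
    \<comment> \<open>Induction on the number \<open>n\<close> of levels climbed, for all
      \<open>i\<close>: the net gives \<open>2 ^ i * s / 2\<close>, and a quarter of the term
      \<open>2 ^ Suc i * s\<close> from the next level gives the other half.\<close>
    have bound: "norm (h x) \<le> 2 ^ i * s + B / m / 4 ^ n" if "x \<in> L i" for x i n
      using that
    proof (induction n arbitrary: i x)
      case 0
      obtain a where "a \<in> A i" using A_ne by blast
      then have "0 \<le> 2 ^ i * s" using order_trans[OF norm_ge_zero net] by simp
      then show ?case using hB[OF 0] by simp
    next
      case (Suc n)
      obtain a where a: "a \<in> A i" "dist a x < d i" using A(3)[of i] Suc.prems by auto
      have "norm (h x - h a) \<le> (2 ^ Suc i * s + B / m / 4 ^ n) / 4"
      proof (rule disc_hull_difference_le[OF hol])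
        show "disc_hull (d i) (L i) \<subseteq> U" using L_U[of "Suc i"] by (simp add: LSuc)
        show "norm (h y) \<le> 2 ^ Suc i * s + B / m / 4 ^ n" if "y \<in> disc_hull (d i) (L i)" for y
          using Suc.IH[of y "Suc i"] that by (simp add: LSuc)
        show "a \<in> L i" "x \<in> L i" "dist a x \<le> d i" using a A(2) Suc.prems by auto
      qed
      moreover define X Y where "X = B / m / 4 ^ n" and "Y = 2 ^ i * s"
      ultimately have "norm (h x - h a) \<le> (2 * Y + X) / 4" by (simp add: mult.assoc)
      moreover have "norm (h a) \<le> Y / 2" using net[OF a(1)] by (simp add: Y_def)
      ultimately have "norm (h x) \<le> Y + X / 4"
        using norm_triangle_sub[of "h x" "h a"] by (simp add: add_divide_distrib)
      then show ?case by (simp add: X_def Y_def)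
    qed
    have "norm (h x) \<le> s" if x: "x \<in> K" for x
    proof (rule LIMSEQ_le_const)
      show "(\<lambda>n. s + B / m * (1 / 4) ^ n) \<longlonglongrightarrow> s"
        using tendsto_add[OF tendsto_const[of s]
            tendsto_mult_right_zero[OF LIMSEQ_realpow_zero[of "1 / 4"], of "B / m"]] by simp
      show "\<exists>k. \<forall>n\<ge>k. norm (h x) \<le> s + B / m * (1 / 4) ^ n"
        using bound[of x 0] x by (simp add: L0 power_one_over)
    qed
    then show "(SUP x\<in>K. norm (h x)) \<le> seminorm_M w \<alpha> A h"
      unfolding s_def[symmetric] by (rule cSUP_least[OF K(2)])
  qed
qed

lemma tau_M_dense_imp_tau_c_dense:
  assumes F: "banach_subspace F" and f: "f \<in> Hw U w F"
    and dense: "f \<in> tau_M U w F closure_of Hwc U w F"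
  shows "f \<in> tau_c U F closure_of Hwc U w F"
proof -
  have hol: "f \<in> holomorphic_maps U F" using f by (simp add: Hw_def)
  show ?thesis
    unfolding in_closure_of_tau_c[OF U(3) F hol]
  proof (intro allI impI, elim conjE)
    fix K :: "'e set" and \<epsilon> :: real assume K: "compact K" "K \<noteq> {}" "K \<subseteq> U" and \<epsilon>: "0 < \<epsilon>"
    obtain \<alpha> A where \<alpha>A: "null_seq_finite_sets U \<alpha> A"
      and le: "\<And>h :: 'e \<Rightarrow> 'a. \<And>F. h \<in> Hw U w F \<Longrightarrow> (SUP x\<in>K. norm (h x)) \<le> seminorm_M w \<alpha> A h"
      by (rule tau_M_finer_than_tau_c[OF K]) blast
    obtain g where g: "g \<in> Hwc U w F" "seminorm_M w \<alpha> A (\<lambda>x. g x - f x) < \<epsilon>"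
      using dense \<alpha>A \<epsilon> unfolding in_closure_of_tau_M[OF U(3) weight F f] by blast
    have "g \<in> Hw U w F" using g(1) by (simp add: Hwc_def)
    from le[OF Hw_diff[OF F weight this f]] g(2)
    have "(SUP x\<in>K. norm (g x - f x)) < \<epsilon>" by simp
    with g(1) show "\<exists>g\<in>Hwc U w F. (SUP x\<in>K. norm (g x - f x)) < \<epsilon>" by blast
  qed
qed

text \<open>Identifies the derivative with a Cauchy integral, through which hull membership and sup
  bounds on a circle pass to \<open>D\<close>.\<close>

lemma taylor_term_1_eq_derivative:
  fixes g :: "'e \<Rightarrow> 'b::complex_banach"
  assumes g: "g \<in> holomorphic_maps U F" and D: "clinear D" "(g has_derivative D) (at 0)" and x: "x \<in> U"
  shows "taylor_term g 1 x = D x"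
proof (rule eq_if_functionals_eq)
  fix \<phi> :: "'b \<Rightarrow> complex" assume \<phi>: "norm_le_one_functional \<phi>"
  have "((\<lambda>\<zeta>. \<phi> (g (0 + scaleC \<zeta> x))) has_field_derivative \<phi> (D x)) (at 0)"
    using D by (intro has_field_derivative_along_line \<phi>) auto
  then have "deriv (\<lambda>\<zeta>. \<phi> (g (scaleC \<zeta> x))) 0 = \<phi> (D x)" by (simp add: DERIV_imp_deriv)
  then show "\<phi> (taylor_term g 1 x) = \<phi> (D x)"
    using functional_taylor_term[OF g scaleC_in_U[OF x] \<phi>, of 1] by simp
qed

text \<open>On a small ball the weight is at least \<open>m\<close>, so the values of
  \<open>g\<close> arise from the relatively compact weighted range by factors of modulus at most
  \<open>1 / m\<close>. They stay in a compact set, and the Cauchy integral lies in its closed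
  convex hull, compact by Mazur.\<close>

lemma compact_derivative_at_0:
  fixes g :: "'e \<Rightarrow> 'b::complex_banach"
  assumes g: "g \<in> Hwc U w F" and D: "clinear D" "(g has_derivative D) (at 0)"
  shows "compact_operator D"
  unfolding compact_operator_def
proof (intro conjI allI impI)
  fix S :: "'e set" assume "bounded S"
  then obtain b where b: "0 < b" "\<And>x. x \<in> S \<Longrightarrow> norm x \<le> b" using bounded_pos by metis
  obtain r where r: "0 < r" "ball 0 (2 * r) \<subseteq> U"
  proof -
    obtain u where "0 < u" "ball 0 u \<subseteq> U" using U(1) zero_in_U by (meson openE)
    then show ?thesis by (intro that[of "u / 2"]) auto
  qed
  have "bounded_within U (cball 0 (r / 2))"
    unfolding bounded_within_def
  proof (intro conjI exI[of _ "ball 0 r"] ballI)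
    show "a + v \<in> U" if "a \<in> cball 0 (r / 2)" "v \<in> ball 0 r" for a v
      using that r norm_triangle_ineq[of a v] by (intro subsetD[OF r(2)]) simp
  qed (use r in auto)
  then obtain m where m: "0 < m" "\<And>x. x \<in> cball 0 (r / 2) \<Longrightarrow> m \<le> w x"
    using weight unfolding weight_on_def by blast
  have small_U: "x \<in> U" if "norm x \<le> r / 2" for x using that r by auto
  obtain C where hol: "g \<in> holomorphic_maps U F" and C: "compact C" "\<And>x. x \<in> U \<Longrightarrow> w x *\<^sub>R g x \<in> C"
    by (rule HwcE[OF g]) blast
  define C' where "C' = (\<lambda>(\<zeta>, y). scaleC \<zeta> y) ` (cball 0 (1 / m) \<times> C)"
  have "compact C'"
    unfolding C'_def case_prod_unfold
    by (intro compact_continuous_image continuous_intros compact_Times compact_cball C(1))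
  define H where "H = closure (convex hull C')"
  have H: "compact H" unfolding H_def by (rule compact_closed_convex_hull[OF \<open>compact C'\<close>])
  have DH: "D x \<in> H" if x: "norm x \<le> r / 2" for x
  proof -
    have "taylor_term g 1 x \<in> H"
      unfolding taylor_term_def
    proof (rule integral_in_closed_convex)
      show "convex H" "closed H" unfolding H_def by (simp_all add: convex_closure)
      show "(\<lambda>t. scaleC (cis (- (2 * pi * t)) ^ 1) (g (scaleC (cis (2 * pi * t)) x))) integrable_on {0..1}"
        using small_U[OF x] scaleC_in_U by (intro taylor_term_integrable[OF hol]) auto
      fix t :: real
      define y where "y = scaleC (cis (2 * pi * t)) x"
      have y: "norm y \<le> r / 2" using x by (simp add: y_def norm_scaleC)
      have wy: "m \<le> w y" using m(2) y by simp
      have "scaleC (cis (- (2 * pi * t))) (g y) =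
          scaleC (cis (- (2 * pi * t)) * complex_of_real (1 / w y)) (w y *\<^sub>R g y)"
        using m(1) wy by (simp add: scaleR_scaleC complex_vs.scale_scale)
      moreover have "cis (- (2 * pi * t)) * complex_of_real (1 / w y) \<in> cball 0 (1 / m)"
        using m(1) wy by (simp add: norm_mult norm_divide frac_le)
      ultimately have "scaleC (cis (- (2 * pi * t))) (g y) \<in> C'"
        using C(2)[OF small_U[OF y]] unfolding C'_def by force
      then have "scaleC (cis (- (2 * pi * t))) (g y) \<in> H"
        unfolding H_def by (intro subsetD[OF closure_subset] hull_inc)
      then show "scaleC (cis (- (2 * pi * t)) ^ 1) (g (scaleC (cis (2 * pi * t)) x)) \<in> H"
        by (simp add: y_def)
    qed
    then show ?thesis using taylor_term_1_eq_derivative[OF hol D small_U[OF x]] by simp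
  qed
  \<comment> \<open>Division by \<open>c\<close> shrinks a set of radius \<open>b\<close> into the
    ball of radius \<open>r / 2\<close>.\<close>
  define c where "c = 2 * b / r"
  have c: "0 < c" using b r by (simp add: c_def)
  have "D x \<in> (*\<^sub>R) c ` H" if "x \<in> S" for x
  proof -
    have "norm ((1 / c) *\<^sub>R x) \<le> r / 2" using b(2)[OF that] b(1) r(1) by (simp add: c_def field_simps)
    from DH[OF this] have "(1 / c) *\<^sub>R D x \<in> H" by (simp add: linear_cmul[OF clinear_imp_linear[OF D(1)]])
    then show ?thesis using c by (intro image_eqI[of _ _ "(1 / c) *\<^sub>R D x"]) auto
  qed
  then have "closure (D ` S) \<subseteq> (*\<^sub>R) c ` H"
    using compact_scaling[OF H, of c] by (intro closure_minimal compact_imp_closed) auto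
  then show "compact (closure (D ` S))"
    using compact_Int_closed[OF compact_scaling[OF H, of c] closed_closure, of "D ` S"]
    by (simp add: Int_absorb1)
qed (rule D(1))

lemma tau_c_dense_imp_CAP:
  assumes dense: "\<And>F :: ('e \<times> 'f::complex_banach) set. banach_subspace F \<Longrightarrow>
    Hw U w F \<subseteq> tau_c U F closure_of Hwc U w F"
  shows "compact_approximation_property TYPE('e)"
  unfolding compact_approximation_property_def
proof (intro allI impI)
  fix K :: "'e set" and \<epsilon> :: real assume \<epsilon>: "0 < \<epsilon>" and K: "compact K"
  \<comment> \<open>A copy of the domain space among the admissible target spaces; this is what the
    product type is for.\<close>
  define F :: "('e \<times> 'f) set" where "F = UNIV \<times> {0}"
  have F: "banach_subspace F"
    by (auto simp: banach_subspace_def F_def complex_vs.subspace_def scaleC_prod_def zero_prod_def intro: closed_Times)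
  define f :: "'e \<Rightarrow> 'e \<times> 'f" where "f x = (x, 0)" for x
  have f_bl: "bounded_linear f"
    unfolding f_def[abs_def] by (intro bounded_linear_Pair bounded_linear_ident bounded_linear_zero)
  have f_cl: "clinear f" by (simp add: clinear_iff f_def scaleC_prod_def)
  have f_hol: "f \<in> holomorphic_maps U F"
    using f_cl bounded_linear_imp_has_derivative[OF f_bl] by (auto simp: holomorphic_maps_def F_def f_def)
  \<comment> \<open>The case \<open>k = 1\<close> of the root estimate says that the identity has
    finite weighted norm.\<close>
  obtain B where B: "\<And>x. x \<in> U \<Longrightarrow> norm (root 1 (w x) *\<^sub>R x) \<le> B"
    using bounded_root_weight[of 1] by (auto simp: bounded_iff)
  have "f \<in> Hw U w F"
  proof (rule HwI[OF f_hol])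
    show "w x * norm (f x) \<le> B" if "x \<in> U" for x
      using B[OF that] weight_pos[OF that] by (simp add: f_def norm_Pair)
  qed
  then have "f \<in> tau_c U F closure_of Hwc U w F" using dense[OF F] by blast
  then have approx: "\<exists>g\<in>Hwc U w F. (SUP x\<in>L. norm (g x - f x)) < \<delta>"
    if "compact L" "L \<noteq> {}" "L \<subseteq> U" "0 < \<delta>" for L \<delta>
    using that unfolding in_closure_of_tau_c[OF U(3) F f_hol] by blast
  obtain u where u: "0 < u" "ball 0 u \<subseteq> U" using U(1) zero_in_U by (meson openE)
  obtain b where b: "0 < b" "\<And>x. x \<in> K \<Longrightarrow> norm x \<le> b" using compact_imp_bounded[OF K] bounded_pos by metis
  \<comment> \<open>Scales \<open>K\<close> into the ball of radius \<open>u\<close>, as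
    \<open>s * b = u / 2\<close>; linearity undoes the scaling later, whence the tolerance
    \<open>s * \<epsilon>\<close>.\<close>
  define s where "s = u / (2 * b)"
  have s: "0 < s" using u b by (simp add: s_def)
  \<comment> \<open>Contains the circles through all points of the scaled \<open>K\<close>, over
    which the Cauchy formula integrates; the inserted 0 keeps \<open>L\<close> nonempty when
    \<open>K\<close> is empty.\<close>
  define L where "L = insert 0 ((\<lambda>(\<zeta>, x). scaleC \<zeta> (s *\<^sub>R x)) ` (cball 0 1 \<times> K))"
  have L: "compact L"
    unfolding L_def case_prod_unfold
    by (intro compact_insert compact_continuous_image continuous_intros compact_Times compact_cball K)
  have sK: "s *\<^sub>R x \<in> U" if "x \<in> K" for x
  proof -
    have "s * norm x \<le> s * b" using b(2)[OF that] s by (intro mult_left_mono) auto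
    also have "\<dots> < u" using u b by (simp add: s_def)
    finally show ?thesis using s by (intro subsetD[OF u(2)]) simp
  qed
  have L_U: "L \<subseteq> U"
    using sK scaleC_in_U zero_in_U by (auto simp: L_def)
  have L_ne: "L \<noteq> {}" by (simp add: L_def)
  obtain g where g: "g \<in> Hwc U w F" "(SUP x\<in>L. norm (g x - f x)) < s * \<epsilon>"
    using approx[OF L L_ne L_U, of "s * \<epsilon>"] s \<epsilon> by auto
  have g_hol: "g \<in> holomorphic_maps U F" using g(1) by (simp add: Hwc_def Hw_def)
  obtain D where D: "clinear D" "(g has_derivative D) (at 0)"
    by (rule holomorphic_mapsD[OF g_hol zero_in_U])
  \<comment> \<open>Projecting to the first factor turns the derivative into an operator on the
    original space.\<close>
  define T where "T x = fst (D x)" for x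
  have "compact_operator T"
    unfolding compact_operator_def
  proof (intro conjI allI impI)
    show "clinear T" using D(1) by (simp add: T_def clinear_iff scaleC_prod_def)
    fix S :: "'e set" assume "bounded S"
    then have "compact (closure (D ` S))"
      using compact_derivative_at_0[OF g(1) D] by (simp add: compact_operator_def)
    then have cp: "compact (fst ` closure (D ` S))"
      by (intro compact_continuous_image continuous_intros)
    have "T ` S \<subseteq> fst ` closure (D ` S)"
      unfolding T_def[abs_def] image_image[symmetric, of fst D]
      by (intro image_mono closure_subset)
    then have "closure (T ` S) \<subseteq> fst ` closure (D ` S)"
      using cp by (intro closure_minimal compact_imp_closed)
    then show "compact (closure (T ` S))"
      using compact_Int_closed[OF cp closed_closure, of "T ` S"] by (simp add: Int_absorb1)
  qed
  moreover have "norm (T x - x) < \<epsilon>" if x: "x \<in> K" for x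
  proof -
    have diff: "(\<lambda>x. g x - f x) \<in> holomorphic_maps U F"
      by (rule holomorphic_maps_diff[OF F g_hol f_hol])
    have deriv: "((\<lambda>x. g x - f x) has_derivative (\<lambda>h. D h - f h)) (at 0)"
      by (intro has_derivative_diff D(2) bounded_linear_imp_has_derivative f_bl)
    have cl: "clinear (\<lambda>h. D h - f h)"
      using D(1) f_cl by (simp add: clinear_iff complex_vs.scale_right_diff_distrib)
    have "norm (D (s *\<^sub>R x) - f (s *\<^sub>R x)) = norm (taylor_term (\<lambda>x. g x - f x) 1 (s *\<^sub>R x))"
      using taylor_term_1_eq_derivative[OF diff cl deriv sK[OF x]] by simp
    also have "\<dots> \<le> (SUP x\<in>L. norm (g x - f x))"
    proof (rule norm_taylor_term_le[OF diff])
      show "scaleC \<zeta> (s *\<^sub>R x) \<in> U" if "cmod \<zeta> = 1" for \<zeta>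
        using scaleC_in_U[OF sK[OF x]] that by simp
      show "norm (g (scaleC \<zeta> (s *\<^sub>R x)) - f (scaleC \<zeta> (s *\<^sub>R x))) \<le> (SUP x\<in>L. norm (g x - f x))"
        if "cmod \<zeta> = 1" for \<zeta>
        by (rule norm_le_SUP_compact[OF diff L L_U]) (use x that in \<open>force simp: L_def\<close>)
    qed
    finally have le: "norm (D (s *\<^sub>R x) - f (s *\<^sub>R x)) < s * \<epsilon>" using g(2) by simp
    have "s * norm (T x - x) = norm (fst (D (s *\<^sub>R x) - f (s *\<^sub>R x)))"
      using s by (simp add: T_def f_def linear_cmul[OF clinear_imp_linear[OF D(1)]] flip: scaleR_diff_right)
    also have "\<dots> \<le> norm (D (s *\<^sub>R x) - f (s *\<^sub>R x))"
      using norm_fst_le[of "fst (D (s *\<^sub>R x) - f (s *\<^sub>R x))" "snd (D (s *\<^sub>R x) - f (s *\<^sub>R x))"]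
      by (simp only: prod.collapse)
    finally have "s * norm (T x - x) < s * \<epsilon>" using le by (rule le_less_trans)
    then show ?thesis using s by simp
  qed
  ultimately show "\<exists>T. compact_operator T \<and> (\<forall>x\<in>K. norm (T x - x) < \<epsilon>)" by blast
qed

end

section \<open>The main theorem\<close>

theorem theorem3p5:
  fixes U :: "'e::complex_banach set" and w :: "'e \<Rightarrow> real"
  assumes "open U" and "U \<noteq> {}" and "balanced U"
    and "radial_weight_on U w"
    and "polynomials \<subseteq> Hw U w (UNIV :: complex set)"
  shows "(compact_approximation_property TYPE('e) \<longleftrightarrow>
            (\<forall>F :: ('e \<times> 'f::complex_banach) set. banach_subspace F \<longrightarrow>
               tau_M U w F closure_of Hwc U w F = Hw U w F))
       \<and> (compact_approximation_property TYPE('e) \<longleftrightarrow>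
            (\<forall>F :: ('e \<times> 'f) set. banach_subspace F \<longrightarrow>
               Hw U w F \<subseteq> tau_c U F closure_of Hwc U w F))"
proof -
  interpret weighted_domain U w
    using assms by (intro weighted_domain.intro)
  \<comment> \<open>The space underlying \<open>tau_M\<close> consists of members of
    \<open>Hw U w F\<close>, which settles one inclusion of the equality in (b).\<close>
  have topspace: "tau_M U w F closure_of Hwc U w F \<subseteq> Hw U w F" for F :: "('e \<times> 'f) set"
  proof -
    have "topspace (tau_M U w F) \<subseteq> Hw U w F"
      unfolding tau_M_def seminorm_topology_def topology_generated_by_topspace by blast
    with closure_of_subset_topspace show ?thesis by (rule order_trans)
  qed
  have ab: "tau_M U w F closure_of Hwc U w F = Hw U w F"
    if "compact_approximation_property TYPE('e)" "banach_subspace F" for F :: "('e \<times> 'f) set"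
    using CAP_imp_tau_M_dense[OF that] by (intro antisym topspace subsetI)
  have bc: "Hw U w F \<subseteq> tau_c U F closure_of Hwc U w F"
    if "tau_M U w F closure_of Hwc U w F = Hw U w F" "banach_subspace F" for F :: "('e \<times> 'f) set"
    using tau_M_dense_imp_tau_c_dense[OF that(2)] that(1) by blast
  have ca: "compact_approximation_property TYPE('e)"
    if "\<forall>F :: ('e \<times> 'f) set. banach_subspace F \<longrightarrow> Hw U w F \<subseteq> tau_c U F closure_of Hwc U w F"
    by (rule tau_c_dense_imp_CAP[where 'f = 'f]) (use that in simp)
  show ?thesis
    using ab bc ca by metis
qed

end
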